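(* Consider the FA-$1$f KCM on $G=\mathbb T_n^d$ with parameter $p_n=\Theta(1/n)$, and let $T_{\rm mix}^{\rm FA}$, $T_2^{\rm FA}$ and $(\alpha^{\rm FA})^{-1}$ be its mixing time, $\ell^2$-mixing time and inverse logarithmic Sobolev constant, respectively. Let $\alpha^{-1}$ be the inverse logarithmic Sobolev constant of CBSEP on $\mathbb T_n^d$ with parameter $p_n$. Then, as $n\to\infty$ with $d$ fixed, for some constant $c>0$, $$T_{\rm mix}^{\rm FA}\le T_2^{\rm FA}\le(\alpha^{\rm FA})^{-1}\log(n)\le c\,n\log(n)\,\alpha^{-1}\le O(1)\times\begin{cases}n^3\log^2(n)&d=1,\\ n^2\log^3(n)&d=2,\\ n^2\log^2(n)&d\ge3.\end{cases}$$
   Context: For positive integers $d,L$ and $n=L^d$, $\mathbb T_n^d$ is the set $(\mathbb Z/L\mathbb Z)^d$ with nearest-neighbour graph structure inherited from $\mathbb Z^d$. Constants may depend on $d$ and on the constants in $p_n=\Theta(1/n)$, but not on $n$. Let $G=(V,E)$ be a finite connected graph, $\Omega=\{0,1\}^V$, $\Omega_+=\Omega\setminus\{0\}$, $\pi=\bigotimes_{x\in V}\pi_x$ the product Bernoulli($p$) measure on $\Omega$ and $\mu=\pi(\cdot\mid\Omega_+)$. FA-$1$f KCM with parameter $p$: the continuous-time Markov chain on $\Omega_+$ in which, with rate one and independently, the state of each vertex $x\in V$ having at least one neighbour $y$ with $\omega_y=1$ is resampled from $\pi_x$. It is ergodic on $\Omega_+$ and reversible with respect to $\mu$, with Dirichlet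 form $$\mathcal D^{\rm FA}(f)=\sum_x\mu\left(\mathbf 1_{\{\sum_{y:\{x,y\}\in E}\omega_y\ge1\}}\,p(1-p)\,(f(\omega^x)-f(\omega))^2\right),$$ where $\omega^x$ is $\omega$ flipped at $x$. CBSEP with parameter $p$: for an edge $e=\{x,y\}$ let $\pi_e=\pi_x\otimes\pi_y$ and $E_e=\{\omega:\omega_x+\omega_y\neq0\}$. CBSEP is the continuous-time Markov chain on $\Omega_+$ in which, for each edge $e$ such that $E_e$ occurs, the state of $e$ is resampled with rate $1$ from $\pi_e(\cdot\mid E_e)$. Its reversible measure is $\mu$ and its Dirichlet form is $\mathcal D(f)=\sum_{e\in E}\mu(\mathbf 1_{E_e}\operatorname{Var}_e(f\mid E_e))$, where $\operatorname{Var}_e(\cdot\mid E_e)$ is the variance with respect to $\pi_e(\cdot\mid E_e)$, the other coordinates being fixed. For a chain on $\Omega_+$ reversible with respect to $\mu$, with law $P^t_\omega$ at time $t$ started from $\omega$, set $h^t_\omega=P^t_\omega(\cdot)/\mu(\cdot)$ and $\|g\|_q^q=\mu(|g|^q)$. Then $T_{\rm mix}=\inf\{t>0:\max_\omega\frac12\|h_\omega^t-1\|_1\le 1/(2e)\}$ and $T_2=\inf\{t>0:\max_\omega\|h^t_\omega-1\|_2\le1/e\}$. The inverse logarithmic Sobolev constant is the best (smallest) $C$ such that $\mu(f^2\log(f^2/\mu(f^2)))\le C\,\mathcal D(f)$ for all $f:\Omega_+\to\mathbb R$, with the Dirichlet form of the chain in question. The superscript FA refers to the FA-$1$f KCM;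 no superscript refers to CBSEP. *)

theory Defs
  imports "HOL-Probability.Probability" "HOL-Probability.Product_PMF"
begin

(* A graph is a pair of a vertex set V and a set E of two-element subsets of V. A configuration
   in {0,1}^V is a predicate on vertices (True for 1) which is False outside V. *)

definition torus_verts :: "nat \<Rightarrow> nat \<Rightarrow> (nat \<Rightarrow> nat) set" where
  "torus_verts d L = {..<d} \<rightarrow>\<^sub>E {..<L}"

(* The condition x \<noteq> y only removes the loops that would appear for L = 1. *)
definition torus_edges :: "nat \<Rightarrow> nat \<Rightarrow> (nat \<Rightarrow> nat) set set" where
  "torus_edges d L =
     {{x, y} | x y. x \<in> torus_verts d L \<and> y \<in> torus_verts d L \<and> x \<noteq> y \<and>
        (\<exists>i<d. y i = (x i + 1) mod L \<and> (\<forall>j. j \<noteq> i \<longrightarrow> y j = x j))}"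

definition Omega_plus :: "'v set \<Rightarrow> ('v \<Rightarrow> bool) set" where
  "Omega_plus V = {\<eta>. (\<forall>x. x \<notin> V \<longrightarrow> \<not> \<eta> x) \<and> (\<exists>x\<in>V. \<eta> x)}"

definition bernoulli_product :: "'v set \<Rightarrow> real \<Rightarrow> ('v \<Rightarrow> bool) pmf" where
  "bernoulli_product V p = Pi_pmf V False (\<lambda>_. bernoulli_pmf p)"

(* The product measure conditioned on not being identically zero. This is used both for the
   global measure on V and for the measure on an edge e given the event that e is not empty.
   Both conditionings are meaningful when 0 < p < 1 and A is finite and nonempty. *)
definition bernoulli_plus :: "'v set \<Rightarrow> real \<Rightarrow> ('v \<Rightarrow> bool) pmf" where
  "bernoulli_plus A p = cond_pmf (bernoulli_product A p) (Omega_plus A)"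

definition fa_constraint :: "'v set set \<Rightarrow> 'v \<Rightarrow> ('v \<Rightarrow> bool) \<Rightarrow> bool" where
  "fa_constraint E x \<eta> \<longleftrightarrow> (\<exists>y. {x, y} \<in> E \<and> \<eta> y)"

definition fa_generator ::
  "'v set \<Rightarrow> 'v set set \<Rightarrow> real \<Rightarrow> (('v \<Rightarrow> bool) \<Rightarrow> real) \<Rightarrow> ('v \<Rightarrow> bool) \<Rightarrow> real" where
  "fa_generator V E p f \<eta> =
     (\<Sum>x\<in>V. of_bool (fa_constraint E x \<eta>) *
        (measure_pmf.expectation (bernoulli_pmf p) (\<lambda>b. f (\<eta>(x := b))) - f \<eta>))"

definition fa_dirichlet ::
  "'v set \<Rightarrow> 'v set set \<Rightarrow> real \<Rightarrow> (('v \<Rightarrow> bool) \<Rightarrow> real) \<Rightarrow> real" where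
  "fa_dirichlet V E p f =
     (\<Sum>x\<in>V. measure_pmf.expectation (bernoulli_plus V p)
        (\<lambda>\<eta>. of_bool (fa_constraint E x \<eta>) * (p * (1 - p) * (f (\<eta>(x := \<not> \<eta> x)) - f \<eta>)\<^sup>2)))"

definition cbsep_dirichlet ::
  "'v set \<Rightarrow> 'v set set \<Rightarrow> real \<Rightarrow> (('v \<Rightarrow> bool) \<Rightarrow> real) \<Rightarrow> real" where
  "cbsep_dirichlet V E p f =
     (\<Sum>e\<in>E. measure_pmf.expectation (bernoulli_plus V p)
        (\<lambda>\<eta>. of_bool (\<exists>x\<in>e. \<eta> x) *
              measure_pmf.variance (bernoulli_plus e p) (\<lambda>\<sigma>. f (override_on \<eta> \<sigma> e))))"

(* The matrix exponential exp (t A): the probability of being at y at time t, started from x,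
   for the continuous-time Markov chain on a finite state space with generator A. *)
definition transition_prob ::
  "(('s \<Rightarrow> real) \<Rightarrow> 's \<Rightarrow> real) \<Rightarrow> real \<Rightarrow> 's \<Rightarrow> 's \<Rightarrow> real" where
  "transition_prob A t x y = (\<Sum>k. t ^ k / fact k * (A ^^ k) (indicator {y}) x)"

definition rel_density ::
  "'s pmf \<Rightarrow> (('s \<Rightarrow> real) \<Rightarrow> 's \<Rightarrow> real) \<Rightarrow> real \<Rightarrow> 's \<Rightarrow> 's \<Rightarrow> real" where
  "rel_density M A t x y = transition_prob A t x y / pmf M y"

definition Lq_norm :: "'s pmf \<Rightarrow> real \<Rightarrow> ('s \<Rightarrow> real) \<Rightarrow> real" where
  "Lq_norm M q g = (measure_pmf.expectation M (\<lambda>x. \<bar>g x\<bar> powr q)) powr (1 / q)"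

(* Infima are taken in ereal, so that the infimum of an empty set is infinity. *)
definition mixing_time ::
  "'s set \<Rightarrow> 's pmf \<Rightarrow> (('s \<Rightarrow> real) \<Rightarrow> 's \<Rightarrow> real) \<Rightarrow> ereal" where
  "mixing_time S M A =
     Inf (ereal ` {t. t > 0 \<and>
       (MAX x\<in>S. 1 / 2 * Lq_norm M 1 (\<lambda>y. rel_density M A t x y - 1)) \<le> 1 / (2 * exp 1)})"

definition l2_mixing_time ::
  "'s set \<Rightarrow> 's pmf \<Rightarrow> (('s \<Rightarrow> real) \<Rightarrow> 's \<Rightarrow> real) \<Rightarrow> ereal" where
  "l2_mixing_time S M A =
     Inf (ereal ` {t. t > 0 \<and>
       (MAX x\<in>S. Lq_norm M 2 (\<lambda>y. rel_density M A t x y - 1)) \<le> 1 / exp 1})"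

(* Since the product with ln is zero wherever f is zero, the convention 0 log 0 = 0 is built in.
   Only the values of f on the support of M matter for the chains considered here. *)
definition inv_log_sobolev :: "'s pmf \<Rightarrow> (('s \<Rightarrow> real) \<Rightarrow> real) \<Rightarrow> ereal" where
  "inv_log_sobolev M D =
     Inf (ereal ` {C. \<forall>f.
       measure_pmf.expectation M
         (\<lambda>x. (f x)\<^sup>2 * ln ((f x)\<^sup>2 / measure_pmf.expectation M (\<lambda>z. (f z)\<^sup>2))) \<le> C * D f})"

definition Tmix_FA :: "'v set \<Rightarrow> 'v set set \<Rightarrow> real \<Rightarrow> ereal" where
  "Tmix_FA V E p = mixing_time (Omega_plus V) (bernoulli_plus V p) (fa_generator V E p)"

definition T2_FA :: "'v set \<Rightarrow> 'v set set \<Rightarrow> real \<Rightarrow> ereal" where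
  "T2_FA V E p = l2_mixing_time (Omega_plus V) (bernoulli_plus V p) (fa_generator V E p)"

definition inv_alpha_FA :: "'v set \<Rightarrow> 'v set set \<Rightarrow> real \<Rightarrow> ereal" where
  "inv_alpha_FA V E p = inv_log_sobolev (bernoulli_plus V p) (fa_dirichlet V E p)"

definition inv_alpha_CBSEP :: "'v set \<Rightarrow> 'v set set \<Rightarrow> real \<Rightarrow> ereal" where
  "inv_alpha_CBSEP V E p = inv_log_sobolev (bernoulli_plus V p) (cbsep_dirichlet V E p)"

end

theory Submission
  imports Defs "HOL-Real_Asymp.Real_Asymp"
begin

text \<open>
  Three of the four inequalities are general facts about chains on the nonempty configurations.
  The total variation distance is dominated by the \<open>L\<^sup>2\<close> distance. If \<open>u\<close> is the density at time
  \<open>t\<close> and \<open>U = \<mu>(u\<^sup>2)\<close>, then \<open>U' = - 2 D(u)\<close>, while \<open>Ent(u\<^sup>2) \<ge> U ln U\<close> because \<open>u\<close> has mean one; so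
  a logarithmic Sobolev inequality with constant \<open>C\<close> gives \<open>(ln U)' \<le> - (2 / C) ln U\<close>, and after
  time \<open>C ln n\<close> the initial value \<open>ln U \<le> n ln (1 / p)\<close> has been divided at least by \<open>n\<^sup>2\<close>
  (\<open>log_sobolev_L2_decay\<close>, \<open>T2_FA_le_inv_alpha\<close>). A resampling of an edge by CBSEP
  is a combination of at most two legal FA-1f flips; an exclusion move passes through the doubly
  occupied edge, which is rarer by a factor \<open>p\<close>, so the comparison costs a factor \<open>1 / p\<close> (\<open>cbsep_edge_le_fa\<close>, \<open>inv_alpha_FA_le_CBSEP\<close>).

  The main point is the bound on the logarithmic Sobolev constant of CBSEP
  (\<open>torus_inv_alpha_CBSEP_le\<close>). The product Bernoulli measure satisfies a logarithmic Sobolev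
  inequality with constant of order \<open>ln (1 / p)\<close> for the chain that refreshes single sites
  (\<open>product_log_sobolev\<close>). Extending a function to the empty configuration by the average of its
  values on single particles transfers this to the measure conditioned on being nonempty, with the
  form of the chain that creates and destroys particles subject only to
  staying nonempty (\<open>plus_log_sobolev_site\<close>).

  It remains to compare that form with the one of CBSEP. Fix a nonempty configuration \<open>S\<close> and
  set \<open>g z = F (S \<union> {z})\<close>. For an occupied site \<open>y\<close> one has \<open>g y = F S\<close>, so creating a particle at
  \<open>x\<close> changes \<open>F\<close> by \<open>g x - g y\<close>; and the difference of \<open>g\<close> along an edge is an
  exclusion move, a coalescence or zero, hence is controlled by CBSEP. The comparison
  therefore costs only the constant \<open>T\<close> in
  \<open>\<Sum>\<^sub>x (g x - g y)\<^sup>2 \<le> T \<Sum>\<^sub>e (\<nabla>\<^sub>e g)\<^sup>2\<close>, which is at most the sum over \<open>x\<close> of the effective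
  resistances between \<open>x\<close> and \<open>y\<close>, whatever the number of particles in \<open>S\<close>
  (\<open>site_form_le_cbsep\<close>). On the torus \<open>T\<close> has order \<open>n\<^sup>2\<close>, \<open>n ln n\<close> or \<open>n\<close> for \<open>d = 1\<close>, \<open>d = 2\<close>
  and \<open>d \<ge> 3\<close>. The bound follows by spreading the value at \<open>y\<close> over the layers
  \<open>{y + v. v\<^sub>1 + \<dots> + v\<^sub>d = k}\<close> with the transition probabilities of Polya's urn, which keep the
  distribution on every layer uniform: the resistance between \<open>y\<close> and a distant layer is at
  most the sum over \<open>k\<close> of the reciprocals of the sizes of the layers, and far away the
  Poincare inequality takes over (\<open>torus_pinned_poincare\<close>).
\<close>

section \<open>Configurations as sets of occupied sites\<close>

text \<open>The expectation under the Bernoulli product measure, with a configuration coded as its set of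
  occupied sites. As a finite sum it can be split one site at a time.\<close>

definition bexp :: "real \<Rightarrow> 'v set \<Rightarrow> ('v set \<Rightarrow> real) \<Rightarrow> real" where
  "bexp p V F = (\<Sum>S\<in>Pow V. p ^ card S * (1 - p) ^ card (V - S) * F S)"

lemma bexp_empty [simp]: "bexp p {} F = F {}"
  by (simp add: bexp_def)

lemma bexp_insert:
  assumes "finite V" "x \<notin> V"
  shows "bexp p (insert x V) F = (1 - p) * bexp p V F + p * bexp p V (\<lambda>S. F (insert x S))"
proof -
  have "bexp p (insert x V) F =
      (\<Sum>S\<in>Pow V. p ^ card S * (1 - p) ^ card (insert x V - S) * F S) +
      (\<Sum>S\<in>insert x ` Pow V. p ^ card S * (1 - p) ^ card (insert x V - S) * F S)"
    unfolding bexp_def Pow_insert using assms by (intro sum.union_disjoint) auto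
  also have "(\<Sum>S\<in>insert x ` Pow V. p ^ card S * (1 - p) ^ card (insert x V - S) * F S) =
      (\<Sum>S\<in>Pow V. p ^ card (insert x S) * (1 - p) ^ card (insert x V - insert x S) * F (insert x S))"
    using assms by (subst sum.reindex) (auto intro!: inj_onI)
  also have "\<dots> = (\<Sum>S\<in>Pow V. p * (p ^ card S * (1 - p) ^ card (V - S) * F (insert x S)))"
  proof (intro sum.cong refl)
    fix S assume "S \<in> Pow V"
    then have "x \<notin> S" "finite S" using assms by (auto intro: finite_subset)
    moreover have "insert x V - insert x S = V - S" using assms by auto
    ultimately show "p ^ card (insert x S) * (1 - p) ^ card (insert x V - insert x S) * F (insert x S)
        = p * (p ^ card S * (1 - p) ^ card (V - S) * F (insert x S))"
      by simp
  qed
  also have "(\<Sum>S\<in>Pow V. p ^ card S * (1 - p) ^ card (insert x V - S) * F S) =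
      (\<Sum>S\<in>Pow V. (1 - p) * (p ^ card S * (1 - p) ^ card (V - S) * F S))"
  proof (intro sum.cong refl)
    fix S assume "S \<in> Pow V"
    then have "insert x V - S = insert x (V - S)" "x \<notin> V - S" "finite (V - S)" using assms by auto
    then show "p ^ card S * (1 - p) ^ card (insert x V - S) * F S
        = (1 - p) * (p ^ card S * (1 - p) ^ card (V - S) * F S)"
      by simp
  qed
  finally show ?thesis
    by (simp add: bexp_def sum_distrib_left)
qed

lemma bexp_cong: "(\<And>S. S \<subseteq> V \<Longrightarrow> F S = G S) \<Longrightarrow> bexp p V F = bexp p V G"
  unfolding bexp_def by (intro sum.cong) auto

lemma bexp_add: "bexp p V (\<lambda>S. F S + G S) = bexp p V F + bexp p V G"
  unfolding bexp_def by (simp add: algebra_simps sum.distrib)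

lemma bexp_diff: "bexp p V (\<lambda>S. F S - G S) = bexp p V F - bexp p V G"
  unfolding bexp_def by (simp add: algebra_simps sum_subtractf)

lemma bexp_cmult: "bexp p V (\<lambda>S. c * F S) = c * bexp p V F"
  unfolding bexp_def by (simp add: algebra_simps sum_distrib_left)

lemma bexp_sum: "bexp p V (\<lambda>S. \<Sum>i\<in>I. F i S) = (\<Sum>i\<in>I. bexp p V (F i))"
  unfolding bexp_def by (simp add: sum_distrib_left) (rule sum.swap)

lemma bexp_mono:
  assumes "0 \<le> p" "p \<le> 1" "\<And>S. S \<subseteq> V \<Longrightarrow> F S \<le> G S"
  shows "bexp p V F \<le> bexp p V G"
  unfolding bexp_def using assms by (intro sum_mono mult_left_mono) auto

lemma bexp_nonneg:
  assumes "0 \<le> p" "p \<le> 1" "\<And>S. S \<subseteq> V \<Longrightarrow> 0 \<le> F S"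
  shows "0 \<le> bexp p V F"
  unfolding bexp_def using assms by (intro sum_nonneg mult_nonneg_nonneg) auto

lemma bexp_const [simp]: "finite V \<Longrightarrow> bexp p V (\<lambda>_. c) = c"
  by (induction V rule: finite_induct) (auto simp: bexp_insert algebra_simps)

lemma bexp_pos:
  assumes "0 < p" "p < 1" "finite V" "\<And>S. S \<subseteq> V \<Longrightarrow> 0 \<le> F S" "S0 \<subseteq> V" "0 < F S0"
  shows "0 < bexp p V F"
  unfolding bexp_def using assms by (intro sum_pos2[where i = S0]) auto

lemma inj_on_member: "inj_on (\<lambda>S x. x \<in> S) A"
  by (auto simp: inj_on_def fun_eq_iff)

lemma configurations_eq: "{\<eta>. \<forall>x. x \<notin> V \<longrightarrow> \<not> \<eta> x} = (\<lambda>S x. x \<in> S) ` Pow V"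
proof (intro equalityI subsetI)
  fix \<eta> assume "\<eta> \<in> {\<eta>. \<forall>x. x \<notin> V \<longrightarrow> \<not> \<eta> x}"
  then have "\<eta> = (\<lambda>x. x \<in> {x. \<eta> x})" "{x. \<eta> x} \<in> Pow V" by auto
  then show "\<eta> \<in> (\<lambda>S x. x \<in> S) ` Pow V" by blast
qed auto

lemma Omega_plus_eq: "Omega_plus V = (\<lambda>S x. x \<in> S) ` (Pow V - {{}})"
proof (intro equalityI subsetI)
  fix \<eta> assume "\<eta> \<in> Omega_plus V"
  then have "\<eta> = (\<lambda>x. x \<in> {x. \<eta> x})" "{x. \<eta> x} \<in> Pow V - {{}}" by (auto simp: Omega_plus_def)
  then show "\<eta> \<in> (\<lambda>S x. x \<in> S) ` (Pow V - {{}})" by blast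
qed (auto simp: Omega_plus_def)

lemma finite_Omega_plus: "finite V \<Longrightarrow> finite (Omega_plus V)"
  by (simp add: Omega_plus_eq)

lemma pmf_bernoulli_product:
  assumes "finite V" "0 < p" "p < 1" "S \<subseteq> V"
  shows "pmf (bernoulli_product V p) (\<lambda>x. x \<in> S) = p ^ card S * (1 - p) ^ card (V - S)"
proof -
  have "pmf (bernoulli_product V p) (\<lambda>x. x \<in> S) = (\<Prod>x\<in>V. pmf (bernoulli_pmf p) (x \<in> S))"
    unfolding bernoulli_product_def using assms by (subst pmf_Pi) auto
  also have "\<dots> = (\<Prod>x\<in>S. pmf (bernoulli_pmf p) (x \<in> S)) * (\<Prod>x\<in>V - S. pmf (bernoulli_pmf p) (x \<in> S))"
    using assms by (metis mult.commute prod.subset_diff)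
  also have "(\<Prod>x\<in>S. pmf (bernoulli_pmf p) (x \<in> S)) = p ^ card S"
    using assms by simp
  also have "(\<Prod>x\<in>V - S. pmf (bernoulli_pmf p) (x \<in> S)) = (1 - p) ^ card (V - S)"
    using assms by simp
  finally show ?thesis .
qed

lemma set_bernoulli_product:
  assumes "finite V" "0 < p" "p < 1"
  shows "set_pmf (bernoulli_product V p) = (\<lambda>S x. x \<in> S) ` Pow V"
proof -
  have "set_pmf (bernoulli_product V p) = {\<eta>. \<forall>x. x \<notin> V \<longrightarrow> \<not> \<eta> x}"
    unfolding bernoulli_product_def using assms
    by (subst set_Pi_pmf) (auto simp: PiE_dflt_def)
  then show ?thesis by (simp add: configurations_eq)
qed

lemma expectation_bernoulli_product:
  assumes "finite V" "0 < p" "p < 1"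
  shows "measure_pmf.expectation (bernoulli_product V p) F = bexp p V (\<lambda>S. F (\<lambda>x. x \<in> S))"
proof -
  have "measure_pmf.expectation (bernoulli_product V p) F =
      (\<Sum>\<eta>\<in>(\<lambda>S x. x \<in> S) ` Pow V. F \<eta> * pmf (bernoulli_product V p) \<eta>)"
    using assms by (intro integral_measure_pmf_real) (auto simp: set_bernoulli_product)
  also have "\<dots> = (\<Sum>S\<in>Pow V. F (\<lambda>x. x \<in> S) * pmf (bernoulli_product V p) (\<lambda>x. x \<in> S))"
    by (subst sum.reindex[OF inj_on_member]) simp
  also have "\<dots> = bexp p V (\<lambda>S. F (\<lambda>x. x \<in> S))"
    unfolding bexp_def using assms by (intro sum.cong refl) (simp add: pmf_bernoulli_product)
  finally show ?thesis .
qed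

lemma prob_Omega_plus:
  assumes "finite V" "0 < p" "p < 1"
  shows "measure (measure_pmf (bernoulli_product V p)) (Omega_plus V) = 1 - (1 - p) ^ card V"
proof -
  have "measure (measure_pmf (bernoulli_product V p)) (Omega_plus V) =
      measure_pmf.expectation (bernoulli_product V p) (indicator (Omega_plus V))"
    by simp
  also have "\<dots> = bexp p V (\<lambda>S. indicator (Omega_plus V) (\<lambda>x. x \<in> S))"
    by (rule expectation_bernoulli_product[OF assms])
  also have "\<dots> = bexp p V (\<lambda>S. 1 - (if S = {} then 1 else 0))"
    by (intro bexp_cong) (auto simp: Omega_plus_def indicator_def)
  also have "\<dots> = 1 - bexp p V (\<lambda>S. if S = {} then 1 else 0)"
    using assms by (simp add: bexp_diff)
  also have "bexp p V (\<lambda>S. if S = {} then 1 else 0) = (1 - p) ^ card V"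
    unfolding bexp_def using assms by (simp add: if_distrib[of "\<lambda>z. _ * z"] cong: if_cong)
  finally show ?thesis .
qed

lemma Omega_plus_nonempty:
  assumes "V \<noteq> {}" shows "Omega_plus V \<noteq> {}"
  using assms by (auto simp: Omega_plus_eq)

lemma
  assumes "finite V" "V \<noteq> {}" "0 < p" "p < 1"
  shows set_bernoulli_plus: "set_pmf (bernoulli_plus V p) = Omega_plus V"
    and pmf_bernoulli_plus:
      "\<And>S. S \<subseteq> V \<Longrightarrow> S \<noteq> {} \<Longrightarrow> pmf (bernoulli_plus V p) (\<lambda>x. x \<in> S) =
        p ^ card S * (1 - p) ^ card (V - S) / (1 - (1 - p) ^ card V)"
proof -
  have ne: "set_pmf (bernoulli_product V p) \<inter> Omega_plus V \<noteq> {}"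
    using assms Omega_plus_nonempty[of V]
    by (auto simp: set_bernoulli_product Omega_plus_eq)
  show "set_pmf (bernoulli_plus V p) = Omega_plus V"
    unfolding bernoulli_plus_def set_cond_pmf[OF ne]
    using assms by (auto simp: set_bernoulli_product Omega_plus_eq)
  fix S assume "S \<subseteq> V" "S \<noteq> {}"
  then show "pmf (bernoulli_plus V p) (\<lambda>x. x \<in> S) =
        p ^ card S * (1 - p) ^ card (V - S) / (1 - (1 - p) ^ card V)"
    unfolding bernoulli_plus_def pmf_cond[OF ne] prob_Omega_plus[OF assms(1,3,4)]
    using assms by (auto simp: pmf_bernoulli_product Omega_plus_def)
qed

text \<open>All means under the conditioned measure reduce to finite sums over sets. The
  normalising constant occurs on both sides of every inequality below and cancels.\<close>

lemma expectation_bernoulli_plus: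
  assumes "finite V" "V \<noteq> {}" "0 < p" "p < 1"
  shows "measure_pmf.expectation (bernoulli_plus V p) F =
    bexp p V (\<lambda>S. of_bool (S \<noteq> {}) * F (\<lambda>x. x \<in> S)) / (1 - (1 - p) ^ card V)"
proof -
  have "measure_pmf.expectation (bernoulli_plus V p) F =
      (\<Sum>\<eta>\<in>(\<lambda>S x. x \<in> S) ` (Pow V - {{}}). F \<eta> * pmf (bernoulli_plus V p) \<eta>)"
    using assms by (intro integral_measure_pmf_real) (auto simp: set_bernoulli_plus Omega_plus_eq)
  also have "\<dots> = (\<Sum>S\<in>Pow V - {{}}. F (\<lambda>x. x \<in> S) * pmf (bernoulli_plus V p) (\<lambda>x. x \<in> S))"
    by (subst sum.reindex[OF inj_on_member]) simp
  also have "\<dots> = (\<Sum>S\<in>Pow V. of_bool (S \<noteq> {}) * F (\<lambda>x. x \<in> S) *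
      (p ^ card S * (1 - p) ^ card (V - S) / (1 - (1 - p) ^ card V)))"
    using assms by (intro sum.mono_neutral_cong_left) (auto simp: pmf_bernoulli_plus)
  also have "\<dots> = bexp p V (\<lambda>S. of_bool (S \<noteq> {}) * F (\<lambda>x. x \<in> S)) / (1 - (1 - p) ^ card V)"
    unfolding bexp_def by (simp add: sum_divide_distrib algebra_simps)
  finally show ?thesis .
qed

section \<open>Logarithmic Sobolev inequality for the Bernoulli product measure\<close>

definition bern_entropy :: "real \<Rightarrow> 'v set \<Rightarrow> ('v set \<Rightarrow> real) \<Rightarrow> real" where
  "bern_entropy p V F = bexp p V (\<lambda>S. F S * ln (F S)) - bexp p V F * ln (bexp p V F)"

text \<open>From \<open>ln s \<le> s - 1\<close>, applied to the ratio of each value to the mean.\<close>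

lemma two_point_entropy_le_variance:
  fixes p A B :: real
  assumes p: "0 < p" "p < 1" and AB: "0 \<le> A" "0 \<le> B" and m: "0 < p * A + (1 - p) * B"
  defines "m \<equiv> p * A + (1 - p) * B"
  shows "p * (A * ln A) + (1 - p) * (B * ln B) - m * ln m \<le> p * (1 - p) * (A - B)\<^sup>2 / m"
proof -
  have key: "X * ln X \<le> X * ln m + X * (X / m - 1)" if "0 \<le> X" for X
  proof (cases "X = 0")
    case False
    then have "ln (X / m) \<le> X / m - 1" using that m by (intro ln_le_minus_one) (auto simp: m_def)
    then have "X * ln (X / m) \<le> X * (X / m - 1)" using that by (rule mult_left_mono)
    moreover have "ln (X / m) = ln X - ln m" using False that m by (simp add: ln_div m_def)
    ultimately show ?thesis by (simp add: algebra_simps)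
  qed auto
  have "p * (A * ln A) + (1 - p) * (B * ln B) \<le>
      p * (A * ln m + A * (A / m - 1)) + (1 - p) * (B * ln m + B * (B / m - 1))"
    using p AB by (intro add_mono mult_left_mono key) auto
  also have "\<dots> = (p * A + (1 - p) * B) * ln m + ((p * A\<^sup>2 + (1 - p) * B\<^sup>2) / m - (p * A + (1 - p) * B))"
    by (simp add: algebra_simps power2_eq_square add_divide_distrib diff_divide_distrib)
  also have "\<dots> = m * ln m + (p * A\<^sup>2 + (1 - p) * B\<^sup>2 - m\<^sup>2) / m"
    using m unfolding m_def[symmetric] by (simp add: diff_divide_distrib power2_eq_square)
  also have "p * A\<^sup>2 + (1 - p) * B\<^sup>2 - m\<^sup>2 = p * (1 - p) * (A - B)\<^sup>2"
    unfolding m_def by (simp add: algebra_simps power2_eq_square)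
  finally show ?thesis by simp
qed

text \<open>If \<open>a \<le> 2 b\<close>, the mean of the squares is at least \<open>b\<^sup>2 / 2\<close> and the entropy is at most the variance
  of the squares divided by their mean. If \<open>a > 2 b\<close>, then \<open>a\<^sup>2\<close> is at most \<open>1 / p\<close> times the mean, so
  the entropy is at most \<open>p a\<^sup>2 ln (1 / p)\<close>, and \<open>(a - b)\<^sup>2 \<ge> a\<^sup>2 / 4\<close>.\<close>

lemma two_point_log_sobolev:
  fixes p a b :: real
  assumes p: "0 < p" "p \<le> 1 / 2" and ab: "0 \<le> a" "0 \<le> b"
  defines "m \<equiv> p * a\<^sup>2 + (1 - p) * b\<^sup>2"
  shows "p * (a\<^sup>2 * ln (a\<^sup>2)) + (1 - p) * (b\<^sup>2 * ln (b\<^sup>2)) - m * ln m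
    \<le> (18 + 8 * ln (1 / p)) * (p * (1 - p) * (a - b)\<^sup>2)"
proof -
  have lnp: "0 \<le> ln (1 / p)" using p by simp
  \<comment> \<open>The values are comparable, or \<open>(a - b)\<^sup>2\<close> is of the order of \<open>a\<^sup>2\<close>.\<close>
  consider (zero) "a = 0" "b = 0" | (small) "a \<le> 2 * b" "0 < b" | (big) "2 * b < a"
    using ab by linarith
  then show ?thesis
  proof cases
    case zero then show ?thesis by (simp add: m_def)
  next
    case small
    have "p * b\<^sup>2 \<le> 1 / 2 * b\<^sup>2" using p by (intro mult_right_mono) auto
    moreover have "0 \<le> p * a\<^sup>2" using p by simp
    ultimately have mb: "b\<^sup>2 / 2 \<le> m" unfolding m_def by (simp add: algebra_simps)
    have m0: "0 < m" using mb small by (smt (verit) half_gt_zero_iff zero_less_power)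
    have "(a + b)\<^sup>2 \<le> (3 * b)\<^sup>2" using ab small by (intro power_mono) auto
    also have "\<dots> = 18 * (b\<^sup>2 / 2)" by (simp add: power2_eq_square)
    also have "\<dots> \<le> 18 * m" using mb by simp
    finally have ab18: "(a + b)\<^sup>2 / m \<le> 18" using m0 by (simp add: divide_le_eq)
    have "p * (a\<^sup>2 * ln (a\<^sup>2)) + (1 - p) * (b\<^sup>2 * ln (b\<^sup>2)) - m * ln m
        \<le> p * (1 - p) * (a\<^sup>2 - b\<^sup>2)\<^sup>2 / m"
      unfolding m_def using p m0 by (intro two_point_entropy_le_variance) (auto simp: m_def)
    also have "\<dots> = (a + b)\<^sup>2 / m * (p * (1 - p) * (a - b)\<^sup>2)"
    proof -
      have "(a\<^sup>2 - b\<^sup>2)\<^sup>2 = (a + b)\<^sup>2 * (a - b)\<^sup>2" by (simp add: power2_eq_square algebra_simps)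
      then show ?thesis by simp
    qed
    also have "\<dots> \<le> 18 * (p * (1 - p) * (a - b)\<^sup>2)"
      using p ab18 by (intro mult_right_mono) auto
    also have "\<dots> \<le> (18 + 8 * ln (1 / p)) * (p * (1 - p) * (a - b)\<^sup>2)"
      using p lnp by (intro mult_right_mono) auto
    finally show ?thesis .
  next
    case big
    then have a0: "0 < a" using ab by linarith
    then have m0: "0 < m" using p unfolding m_def by (intro add_pos_nonneg) auto
    have "b\<^sup>2 \<le> a\<^sup>2" using big ab by (intro power_mono) auto
    then have "p * b\<^sup>2 \<le> p * a\<^sup>2" using p by simp
    then have bm: "b\<^sup>2 \<le> m" unfolding m_def by (simp add: algebra_simps)
    have am: "p * a\<^sup>2 \<le> m" using p unfolding m_def by simp
    have 1: "a\<^sup>2 * ln (a\<^sup>2) \<le> a\<^sup>2 * (ln m + ln (1 / p))"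
    proof -
      have "a\<^sup>2 \<le> m / p" using am p by (simp add: field_simps)
      then have "ln (a\<^sup>2) \<le> ln (m / p)" using a0 m0 p by (subst ln_le_cancel_iff) auto
      also have "\<dots> = ln m + ln (1 / p)" using m0 p by (simp add: ln_div)
      finally show ?thesis by (intro mult_left_mono) auto
    qed
    have 2: "b\<^sup>2 * ln (b\<^sup>2) \<le> b\<^sup>2 * ln m"
    proof (cases "b = 0")
      case False then show ?thesis using bm m0 by (intro mult_left_mono) (auto simp: ln_le_cancel_iff)
    qed auto
    have "p * (a\<^sup>2 * ln (a\<^sup>2)) + (1 - p) * (b\<^sup>2 * ln (b\<^sup>2)) - m * ln m
       \<le> p * (a\<^sup>2 * (ln m + ln (1 / p))) + (1 - p) * (b\<^sup>2 * ln m) - m * ln m"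
      using p by (intro diff_right_mono add_mono mult_left_mono[OF 1] mult_left_mono[OF 2]) auto
    also have "\<dots> = p * a\<^sup>2 * ln (1 / p)" unfolding m_def by (simp add: algebra_simps)
    also have "\<dots> \<le> (8 * ln (1 / p)) * (p * (1 - p) * (a - b)\<^sup>2)"
    proof -
      have "(a / 2)\<^sup>2 \<le> (a - b)\<^sup>2" using big ab by (intro power_mono) auto
      then have "a\<^sup>2 \<le> 4 * (a - b)\<^sup>2" by (simp add: power2_eq_square)
      moreover have "1 * (4 * (a - b)\<^sup>2) \<le> (2 * (1 - p)) * (4 * (a - b)\<^sup>2)"
        using p by (intro mult_right_mono) auto
      ultimately have "a\<^sup>2 \<le> (2 * (1 - p)) * (4 * (a - b)\<^sup>2)" by linarith
      then have "(p * ln (1 / p)) * a\<^sup>2 \<le> (p * ln (1 / p)) * ((2 * (1 - p)) * (4 * (a - b)\<^sup>2))"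
        using p lnp by (intro mult_left_mono) auto
      then show ?thesis by (simp add: algebra_simps)
    qed
    also have "\<dots> \<le> (18 + 8 * ln (1 / p)) * (p * (1 - p) * (a - b)\<^sup>2)"
      using p lnp by (intro mult_right_mono) auto
    finally show ?thesis .
  qed
qed

text \<open>The reverse triangle inequality in \<open>L\<^sup>2\<close>.\<close>

lemma bexp_L2_norm_diff:
  assumes p: "0 \<le> p" "p \<le> 1"
  shows "(sqrt (bexp p V (\<lambda>S. (f S)\<^sup>2)) - sqrt (bexp p V (\<lambda>S. (g S)\<^sup>2)))\<^sup>2
    \<le> bexp p V (\<lambda>S. (f S - g S)\<^sup>2)"
proof -
  define w where "w S = sqrt (p ^ card S * (1 - p) ^ card (V - S))" for S
  have w2: "(w S)\<^sup>2 = p ^ card S * (1 - p) ^ card (V - S)" for S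
    using p by (simp add: w_def)
  have L: "sqrt (bexp p V (\<lambda>S. (h S)\<^sup>2)) = L2_set (\<lambda>S. w S * h S) (Pow V)" for h
    unfolding bexp_def L2_set_def by (simp add: power_mult_distrib w2)
  have tri: "L2_set (\<lambda>S. w S * h S) (Pow V) \<le>
     L2_set (\<lambda>S. w S * k S) (Pow V) + L2_set (\<lambda>S. w S * (h S - k S)) (Pow V)" for h k
    using L2_set_triangle_ineq[of "\<lambda>S. w S * k S" "\<lambda>S. w S * (h S - k S)" "Pow V"]
    by (simp add: algebra_simps)
  have sym: "L2_set (\<lambda>S. w S * (g S - f S)) (Pow V) = L2_set (\<lambda>S. w S * (f S - g S)) (Pow V)"
    unfolding L2_set_def by (simp add: power_mult_distrib power2_commute)
  have "\<bar>sqrt (bexp p V (\<lambda>S. (f S)\<^sup>2)) - sqrt (bexp p V (\<lambda>S. (g S)\<^sup>2))\<bar>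
      \<le> sqrt (bexp p V (\<lambda>S. (f S - g S)\<^sup>2))"
    using tri[of f g] tri[of g f] sym unfolding L by linarith
  then have "\<bar>sqrt (bexp p V (\<lambda>S. (f S)\<^sup>2)) - sqrt (bexp p V (\<lambda>S. (g S)\<^sup>2))\<bar>\<^sup>2
      \<le> (sqrt (bexp p V (\<lambda>S. (f S - g S)\<^sup>2)))\<^sup>2"
    by (intro power_mono) auto
  then show ?thesis using bexp_nonneg[OF p, of V "\<lambda>S. (f S - g S)\<^sup>2"] by simp
qed

text \<open>The constant does not depend on the number of sites: adding a site \<open>x\<close> contributes the
  two-point entropy of the conditional means of \<open>f\<^sup>2\<close>, and the square roots of these means are \<open>L\<^sup>2\<close>
  norms, whose difference is at most the \<open>L\<^sup>2\<close> norm of the gradient at \<open>x\<close>.\<close>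

theorem product_log_sobolev:
  assumes "finite V" and p: "0 < p" "p \<le> 1 / 2"
  shows "bern_entropy p V (\<lambda>S. (f S)\<^sup>2) \<le> (18 + 8 * ln (1 / p)) *
    (p * (\<Sum>x\<in>V. bexp p V (\<lambda>S. of_bool (x \<notin> S) * (f (insert x S) - f S)\<^sup>2)))"
  using assms(1)
proof (induction V arbitrary: f rule: finite_induct)
  case empty
  then show ?case by (simp add: bern_entropy_def)
next
  case (insert x V)
  define C where "C = 18 + 8 * ln (1 / p)"
  have C: "0 \<le> C" using p by (simp add: C_def)
  define g where "g S = f (insert x S)" for S
  let ?A = "bexp p V (\<lambda>S. (g S)\<^sup>2)" and ?B = "bexp p V (\<lambda>S. (f S)\<^sup>2)"
  have A0: "0 \<le> ?A" and B0: "0 \<le> ?B" using p by (auto intro!: bexp_nonneg)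
  \<comment> \<open>Chain rule: the mean of the entropies given the state of \<open>x\<close>, plus the entropy of the
      two conditional means \<open>?A\<close> and \<open>?B\<close>.\<close>
  have "bern_entropy p (insert x V) (\<lambda>S. (f S)\<^sup>2) =
      p * bern_entropy p V (\<lambda>S. (g S)\<^sup>2) + (1 - p) * bern_entropy p V (\<lambda>S. (f S)\<^sup>2) +
      (p * (?A * ln ?A) + (1 - p) * (?B * ln ?B) -
        (p * ?A + (1 - p) * ?B) * ln (p * ?A + (1 - p) * ?B))"
    unfolding bern_entropy_def bexp_insert[OF insert(1,2)] by (simp add: g_def algebra_simps)
  also have "p * (?A * ln ?A) + (1 - p) * (?B * ln ?B) -
        (p * ?A + (1 - p) * ?B) * ln (p * ?A + (1 - p) * ?B)
      \<le> C * (p * (1 - p) * (sqrt ?A - sqrt ?B)\<^sup>2)"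
    using two_point_log_sobolev[OF p, of "sqrt ?A" "sqrt ?B"] A0 B0 by (simp add: C_def)
  also have "\<dots> \<le> C * (p * (1 - p) * bexp p V (\<lambda>S. (g S - f S)\<^sup>2))"
    using p C by (intro mult_left_mono bexp_L2_norm_diff) auto
  finally have 1: "bern_entropy p (insert x V) (\<lambda>S. (f S)\<^sup>2) \<le>
      p * bern_entropy p V (\<lambda>S. (g S)\<^sup>2) + (1 - p) * bern_entropy p V (\<lambda>S. (f S)\<^sup>2) +
      C * (p * (1 - p) * bexp p V (\<lambda>S. (g S - f S)\<^sup>2))" by simp
  have 2: "p * bern_entropy p V (\<lambda>S. (g S)\<^sup>2) \<le>
     p * (C * (p * (\<Sum>y\<in>V. bexp p V (\<lambda>S. of_bool (y \<notin> S) * (g (insert y S) - g S)\<^sup>2))))"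
    using p by (intro mult_left_mono insert.IH[folded C_def]) auto
  have 3: "(1 - p) * bern_entropy p V (\<lambda>S. (f S)\<^sup>2) \<le>
     (1 - p) * (C * (p * (\<Sum>y\<in>V. bexp p V (\<lambda>S. of_bool (y \<notin> S) * (f (insert y S) - f S)\<^sup>2))))"
    using p by (intro mult_left_mono insert.IH[folded C_def]) auto
  have x: "bexp p (insert x V) (\<lambda>S. of_bool (x \<notin> S) * (f (insert x S) - f S)\<^sup>2) =
      (1 - p) * bexp p V (\<lambda>S. (g S - f S)\<^sup>2)"
  proof -
    have "bexp p V (\<lambda>S. of_bool (x \<notin> S) * (f (insert x S) - f S)\<^sup>2) = bexp p V (\<lambda>S. (g S - f S)\<^sup>2)"
      using insert(2) by (intro bexp_cong) (auto simp: g_def)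
    then show ?thesis using insert(1,2) by (simp add: bexp_insert)
  qed
  have y: "bexp p (insert x V) (\<lambda>S. of_bool (y \<notin> S) * (f (insert y S) - f S)\<^sup>2) =
      (1 - p) * bexp p V (\<lambda>S. of_bool (y \<notin> S) * (f (insert y S) - f S)\<^sup>2) +
      p * bexp p V (\<lambda>S. of_bool (y \<notin> S) * (g (insert y S) - g S)\<^sup>2)" if "y \<in> V" for y
  proof -
    have "y \<noteq> x" using that insert by auto
    then show ?thesis using insert(1,2) by (simp add: bexp_insert g_def insert_commute)
  qed
  have sum_eq: "(\<Sum>y\<in>insert x V. bexp p (insert x V) (\<lambda>S. of_bool (y \<notin> S) * (f (insert y S) - f S)\<^sup>2)) =
     (1 - p) * bexp p V (\<lambda>S. (g S - f S)\<^sup>2) +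
     (1 - p) * (\<Sum>y\<in>V. bexp p V (\<lambda>S. of_bool (y \<notin> S) * (f (insert y S) - f S)\<^sup>2)) +
     p * (\<Sum>y\<in>V. bexp p V (\<lambda>S. of_bool (y \<notin> S) * (g (insert y S) - g S)\<^sup>2))"
    using insert(1,2) x y by (simp add: sum.distrib sum_distrib_left)
  have combine: "E \<le> C * (p * ((1 - p) * X + (1 - p) * Y + p * Z))"
    if "E \<le> A + B + C * (p * (1 - p) * X)" "A \<le> p * (C * (p * Z))" "B \<le> (1 - p) * (C * (p * Y))"
    for A B E X Y Z :: real
    using that by (simp add: algebra_simps)
  show ?case unfolding C_def[symmetric] sum_eq by (rule combine[OF 1 2 3])
qed

section \<open>Resampling an edge\<close>

text \<open>The ordered pairs that span an edge; an edge with two elements occurs twice.\<close>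

definition arcs :: "'v set set \<Rightarrow> ('v \<times> 'v) set" where
  "arcs E = {(x, y). {x, y} \<in> E}"

lemma finite_arcs: "finite V \<Longrightarrow> E \<subseteq> Pow V \<Longrightarrow> finite (arcs E)"
  by (rule finite_subset[of _ "V \<times> V"]) (auto simp: arcs_def)

lemma sum_arcs:
  assumes "finite V" "E \<subseteq> Pow V"
  shows "(\<Sum>a\<in>arcs E. \<psi> a) = (\<Sum>e\<in>E. \<Sum>a\<in>arcs {e}. (\<psi> a :: real))"
proof -
  have fE: "finite E" using assms by (meson finite_Pow_iff finite_subset)
  have "arcs E = (\<Union>e\<in>E. arcs {e})" by (auto simp: arcs_def)
  moreover have "(\<Sum>a\<in>(\<Union>e\<in>E. arcs {e}). \<psi> a) = (\<Sum>e\<in>E. \<Sum>a\<in>arcs {e}. \<psi> a)"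
  proof (intro sum.UNION_disjoint ballI impI)
    fix e assume "e \<in> E"
    then show "finite (arcs {e})" using assms by (intro finite_arcs[of V]) auto
  qed (use fE in \<open>auto simp: arcs_def\<close>)
  ultimately show ?thesis by simp
qed

lemma arcs_single: "arcs {{x, y}} = {(x, y), (y, x)}"
  by (auto simp: arcs_def doubleton_eq_iff)

lemma sum_arcs_single:
  assumes "x \<noteq> y"
  shows "(\<Sum>a\<in>arcs {{x, y}}. \<psi> a) = \<psi> (x, y) + (\<psi> (y, x) :: real)"
  using assms by (simp add: arcs_single)

text \<open>The contribution of the edge \<open>e\<close> to the CBSEP Dirichlet form, times the probability of being
  nonempty. The intersection with \<open>e\<close> mirrors \<open>override_on\<close>, which ignores \<open>\<sigma>\<close> outside \<open>e\<close>.\<close>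

definition cbsep_edge ::
  "'v set \<Rightarrow> real \<Rightarrow> ('v set \<Rightarrow> real) \<Rightarrow> 'v set \<Rightarrow> real" where
  "cbsep_edge V p F e = bexp p V (\<lambda>S. of_bool (S \<inter> e \<noteq> {}) *
     measure_pmf.variance (bernoulli_plus e p) (\<lambda>\<sigma>. F ((S - e) \<union> {v. \<sigma> v} \<inter> e)))"

text \<open>The variance as a sum over pairs of the three states of a nonempty edge.\<close>

lemma three_point_variance:
  fixes a b c q r :: real
  assumes "2 * q + r = 1"
  defines "m \<equiv> q * a + q * b + r * c"
  shows "q * (a - m)\<^sup>2 + q * (b - m)\<^sup>2 + r * (c - m)\<^sup>2 =
    q\<^sup>2 * (a - b)\<^sup>2 + q * r * ((a - c)\<^sup>2 + (b - c)\<^sup>2)"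
proof -
  have r: "r = 1 - 2 * q" using assms by simp
  show ?thesis unfolding m_def r by (simp add: power2_eq_square algebra_simps)
qed

lemma edge_variance:
  assumes "x \<noteq> y" "0 < p" "p < 1"
  shows "measure_pmf.variance (bernoulli_plus {x, y} p) (\<lambda>\<sigma>. h {v. \<sigma> v}) =
    ((1 - p)\<^sup>2 * (h {x} - h {y})\<^sup>2 + p * (1 - p) * ((h {x} - h {x, y})\<^sup>2 + (h {y} - h {x, y})\<^sup>2)) / (2 - p)\<^sup>2"
proof -
  define q where "q = (1 - p) / (2 - p)"
  define r where "r = p / (2 - p)"
  have p2: "0 < 2 - p" using assms by simp
  have E: "measure_pmf.expectation (bernoulli_plus {x, y} p) (\<lambda>\<sigma>. G {v. \<sigma> v}) = q * G {x} + q * G {y} + r * G {x, y}" for G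
  proof -
    have Z: "1 - (1 - p) ^ card {x, y} = p * (2 - p)" using assms by (simp add: power2_eq_square algebra_simps)
    have "measure_pmf.expectation (bernoulli_plus {x, y} p) (\<lambda>\<sigma>. G {v. \<sigma> v}) =
        (p * ((1 - p) * G {x}) + p * ((1 - p) * G {y}) + p * (p * G {x, y})) / (p * (2 - p))"
      using assms unfolding expectation_bernoulli_plus[of "{x, y}", OF _ _ assms(2,3), simplified, unfolded Z]
      by (simp add: bexp_insert Z algebra_simps)
    also have "\<dots> = ((1 - p) * G {x} + (1 - p) * G {y} + p * G {x, y}) / (2 - p)"
      using assms by (simp only: distrib_left[symmetric]) simp
    finally show ?thesis by (simp add: q_def r_def add_divide_distrib)
  qed
  have "2 * q + r = 1" using p2 unfolding q_def r_def by (simp add: divide_simps)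
  then have "measure_pmf.variance (bernoulli_plus {x, y} p) (\<lambda>\<sigma>. h {v. \<sigma> v}) =
      q\<^sup>2 * (h {x} - h {y})\<^sup>2 + q * r * ((h {x} - h {x, y})\<^sup>2 + (h {y} - h {x, y})\<^sup>2)"
    unfolding E[of h] E[of "\<lambda>S. (h S - _)\<^sup>2"] by (rule three_point_variance)
  also have "\<dots> = ((1 - p)\<^sup>2 * (h {x} - h {y})\<^sup>2 + p * (1 - p) * ((h {x} - h {x, y})\<^sup>2 + (h {y} - h {x, y})\<^sup>2)) / (2 - p)\<^sup>2"
    by (simp add: q_def r_def power_divide add_divide_distrib power2_eq_square mult.commute)
  finally show ?thesis .
qed

lemma bexp_insert2:
  assumes "finite W" "x \<notin> W" "y \<notin> W" "x \<noteq> y"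
  shows "bexp p (insert x (insert y W)) F = bexp p W (\<lambda>U. (1 - p)\<^sup>2 * F U +
    p * (1 - p) * (F (insert x U) + F (insert y U)) + p\<^sup>2 * F (insert x (insert y U)))"
  using assms
  by (simp add: bexp_insert bexp_add bexp_cmult insert_commute)
    (simp add: power2_eq_square algebra_simps)

text \<open>The exclusion move has conductance of order \<open>p\<close> and each branching move of order
  \<open>p\<^sup>2\<close>, relative to the configuration outside the edge.\<close>

lemma cbsep_edge_eq:
  assumes "finite W" "x \<notin> W" "y \<notin> W" "x \<noteq> y" "0 < p" "p < 1"
  shows "cbsep_edge (insert x (insert y W)) p F {x, y} =
    p / (2 - p) * bexp p W (\<lambda>U. (1 - p)\<^sup>2 * (F (insert x U) - F (insert y U))\<^sup>2 + p * (1 - p) *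
      ((F (insert x U) - F (insert x (insert y U)))\<^sup>2 + (F (insert y U) - F (insert x (insert y U)))\<^sup>2))"
proof -
  let ?Q = "\<lambda>U. (1 - p)\<^sup>2 * (F (insert x U) - F (insert y U))\<^sup>2 + p * (1 - p) *
      ((F (insert x U) - F (insert x (insert y U)))\<^sup>2 + (F (insert y U) - F (insert x (insert y U)))\<^sup>2)"
  have p2: "0 < 2 - p" using assms by simp
  have var: "measure_pmf.variance (bernoulli_plus {x, y} p) (\<lambda>\<sigma>. F (U \<union> {v. \<sigma> v} \<inter> {x, y})) = ?Q U / (2 - p)\<^sup>2" for U
    using edge_variance[OF assms(4-6), of "\<lambda>R. F (U \<union> R \<inter> {x, y})"] by simp
  have rest: "insert x U - {x, y} = U" "insert y U - {x, y} = U" "insert x (insert y U) - {x, y} = U" "U \<inter> {x, y} = {}" if "U \<subseteq> W" for U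
    using that assms by auto
  have "cbsep_edge (insert x (insert y W)) p F {x, y} =
      bexp p W (\<lambda>U. (p / (2 - p)) * ?Q U)"
    unfolding cbsep_edge_def bexp_insert2[OF assms(1-4)] var
  proof (intro bexp_cong)
    fix U assume U: "U \<subseteq> W"
    have "(2 * p * (1 - p) + p\<^sup>2) / (2 - p)\<^sup>2 = p * (2 - p) / ((2 - p) * (2 - p))"
      by (simp add: power2_eq_square algebra_simps)
    also have "\<dots> = p / (2 - p)" using p2 by simp
    finally have coef: "(2 * p * (1 - p) + p\<^sup>2) / (2 - p)\<^sup>2 = p / (2 - p)" .
    have collect: "p * (1 - p) * (q / k + q / k) + p\<^sup>2 * (q / k) = (2 * p * (1 - p) + p\<^sup>2) / k * q" for q k :: real
      by (simp add: algebra_simps add_divide_distrib diff_divide_distrib)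
    have "(1 - p)\<^sup>2 * (of_bool (U \<inter> {x, y} \<noteq> {}) * (?Q (U - {x, y}) / (2 - p)\<^sup>2)) +
        p * (1 - p) * (of_bool (insert x U \<inter> {x, y} \<noteq> {}) * (?Q (insert x U - {x, y}) / (2 - p)\<^sup>2) +
          of_bool (insert y U \<inter> {x, y} \<noteq> {}) * (?Q (insert y U - {x, y}) / (2 - p)\<^sup>2)) +
        p\<^sup>2 * (of_bool (insert x (insert y U) \<inter> {x, y} \<noteq> {}) * (?Q (insert x (insert y U) - {x, y}) / (2 - p)\<^sup>2))
        = p * (1 - p) * (?Q U / (2 - p)\<^sup>2 + ?Q U / (2 - p)\<^sup>2) + p\<^sup>2 * (?Q U / (2 - p)\<^sup>2)"
      unfolding rest[OF U] by simp
    also have "\<dots> = (2 * p * (1 - p) + p\<^sup>2) / (2 - p)\<^sup>2 * ?Q U"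
      by (rule collect)
    finally show "(1 - p)\<^sup>2 * (of_bool (U \<inter> {x, y} \<noteq> {}) * (?Q (U - {x, y}) / (2 - p)\<^sup>2)) +
        p * (1 - p) * (of_bool (insert x U \<inter> {x, y} \<noteq> {}) * (?Q (insert x U - {x, y}) / (2 - p)\<^sup>2) +
          of_bool (insert y U \<inter> {x, y} \<noteq> {}) * (?Q (insert y U - {x, y}) / (2 - p)\<^sup>2)) +
        p\<^sup>2 * (of_bool (insert x (insert y U) \<inter> {x, y} \<noteq> {}) * (?Q (insert x (insert y U) - {x, y}) / (2 - p)\<^sup>2))
      = p / (2 - p) * ?Q U" unfolding coef .
  qed
  then show ?thesis by (simp only: bexp_cmult)
qed

lemma edge_cases:
  assumes "finite V" "e \<subseteq> V" "card e = 2"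
  obtains x y W where "e = {x, y}" "x \<noteq> y" "V = insert x (insert y W)" "finite W" "x \<notin> W" "y \<notin> W"
proof -
  obtain x y where e: "e = {x, y}" "x \<noteq> y" using assms(3) by (auto simp: card_2_iff)
  show ?thesis
    by (rule that[OF e, of "V - {x, y}"]) (use assms(1,2) e in auto)
qed

text \<open>If \<open>S\<close> misses the edge, then carrying the added particle across it is an exclusion move; if
  \<open>S\<close> occupies one endpoint, it is a coalescence; if it occupies both, nothing changes. The
  prefactor \<open>p\<close> gives exactly the orders of the two conductances in \<open>cbsep_edge_eq\<close>. The
  factor 4 is a 2 from the two orientations and a 2 from \<open>p \<le> 2 p / (2 - p)\<close>.\<close>

lemma moves_le_cbsep_edge:
  assumes "finite V" "e \<subseteq> V" "card e = 2" and p: "0 < p" "p < 1"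
  shows "p * bexp p V (\<lambda>S. of_bool (S \<noteq> {}) * (\<Sum>(z, w)\<in>arcs {e}. (F (insert z S) - F (insert w S))\<^sup>2))
    \<le> 4 * cbsep_edge V p F e"
proof -
  obtain x y W where e: "e = {x, y}" "x \<noteq> y" and V: "V = insert x (insert y W)" "finite W" "x \<notin> W" "y \<notin> W"
    using edge_cases[OF assms(1-3)] by metis
  let ?Q = "\<lambda>U. (1 - p)\<^sup>2 * (F (insert x U) - F (insert y U))\<^sup>2 + p * (1 - p) *
      ((F (insert x U) - F (insert x (insert y U)))\<^sup>2 + (F (insert y U) - F (insert x (insert y U)))\<^sup>2)"
  have "bexp p V (\<lambda>S. of_bool (S \<noteq> {}) * (\<Sum>(z, w)\<in>arcs {e}. (F (insert z S) - F (insert w S))\<^sup>2))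
      = bexp p V (\<lambda>S. of_bool (S \<noteq> {}) * (2 * (F (insert x S) - F (insert y S))\<^sup>2))"
    unfolding e(1) sum_arcs_single[OF e(2)] by (simp add: power2_commute)
  also have "\<dots> \<le> bexp p V (\<lambda>S. 2 * (F (insert x S) - F (insert y S))\<^sup>2)"
    using p by (intro bexp_mono) auto
  also have "\<dots> = bexp p W (\<lambda>U. 2 * ?Q U)"
    unfolding V(1) bexp_insert2[OF V(2-4) e(2)]
    by (intro bexp_cong) (simp add: insert_commute power2_commute algebra_simps)
  also have "\<dots> = 2 * bexp p W ?Q" by (rule bexp_cmult)
  finally have 1: "bexp p V (\<lambda>S. of_bool (S \<noteq> {}) * (\<Sum>(z, w)\<in>arcs {e}. (F (insert z S) - F (insert w S))\<^sup>2))
    \<le> 2 * bexp p W ?Q" .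
  have Q0: "0 \<le> bexp p W ?Q" using p by (intro bexp_nonneg add_nonneg_nonneg mult_nonneg_nonneg) auto
  have "p \<le> 2 * (p / (2 - p))" using p by (simp add: field_simps)
  then have "p * bexp p W ?Q \<le> 2 * (p / (2 - p)) * bexp p W ?Q" using Q0 by (rule mult_right_mono)
  also have "\<dots> = 2 * cbsep_edge V p F e"
    unfolding V(1) e(1) cbsep_edge_eq[OF V(2-4) e(2) p] by simp
  finally have 2: "p * bexp p W ?Q \<le> 2 * cbsep_edge V p F e" .
  have "p * bexp p V (\<lambda>S. of_bool (S \<noteq> {}) * (\<Sum>(z, w)\<in>arcs {e}. (F (insert z S) - F (insert w S))\<^sup>2))
    \<le> p * (2 * bexp p W ?Q)"
    using p by (intro mult_left_mono 1) auto
  then show ?thesis using 2 by linarith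
qed

text \<open>The exclusion move from \<open>x\<close> to \<open>y\<close> is replaced by the flips that create a particle at \<open>y\<close> next to
  \<open>x\<close> and then remove the one at \<open>x\<close>.\<close>

lemma cbsep_edge_le_fa:
  assumes "finite V" "e \<subseteq> V" "card e = 2" and p: "0 < p" "p < 1"
  shows "cbsep_edge V p F e \<le> 2 * bexp p V (\<lambda>S. \<Sum>(x, y)\<in>arcs {e}. of_bool (x \<notin> S \<and> y \<in> S) * (F (insert x S) - F S)\<^sup>2)"
proof -
  obtain x y W where e: "e = {x, y}" "x \<noteq> y" and V: "V = insert x (insert y W)" "finite W" "x \<notin> W" "y \<notin> W"
    using edge_cases[OF assms(1-3)] by metis
  let ?A = "\<lambda>U. (F (insert x U) - F (insert x (insert y U)))\<^sup>2 + (F (insert y U) - F (insert x (insert y U)))\<^sup>2"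
  let ?Q = "\<lambda>U. (1 - p)\<^sup>2 * (F (insert x U) - F (insert y U))\<^sup>2 + p * (1 - p) * ?A U"
  have Q: "?Q U \<le> 2 * ((1 - p) * ?A U)" for U
  proof -
    have "(a - b)\<^sup>2 \<le> 2 * ((a - c)\<^sup>2 + (b - c)\<^sup>2)" for a b c :: real
      using zero_le_power2[of "(a - c) + (b - c)"] by (simp add: power2_eq_square algebra_simps)
    then have "(1 - p)\<^sup>2 * (F (insert x U) - F (insert y U))\<^sup>2 \<le> (1 - p)\<^sup>2 * (2 * ?A U)"
      by (intro mult_left_mono) auto
    moreover have "((1 - p)\<^sup>2 * 2 + p * (1 - p)) * ?A U \<le> (2 * (1 - p)) * ?A U"
    proof (rule mult_right_mono)
      have "0 \<le> p * (1 - p)" using p by simp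
      then show "(1 - p)\<^sup>2 * 2 + p * (1 - p) \<le> 2 * (1 - p)" by (simp add: power2_eq_square algebra_simps)
    qed simp
    ultimately show ?thesis by (simp add: algebra_simps)
  qed
  have "cbsep_edge V p F e = p / (2 - p) * bexp p W ?Q"
    unfolding V(1) e(1) cbsep_edge_eq[OF V(2-4) e(2) p] ..
  also have "\<dots> \<le> p * bexp p W ?Q"
  proof (rule mult_right_mono)
    show "p / (2 - p) \<le> p" using p by (simp add: field_simps)
    show "0 \<le> bexp p W ?Q" using p by (intro bexp_nonneg add_nonneg_nonneg mult_nonneg_nonneg) auto
  qed
  also have "\<dots> \<le> p * bexp p W (\<lambda>U. 2 * ((1 - p) * ?A U))"
    using p Q by (intro mult_left_mono bexp_mono) auto
  also have "\<dots> = 2 * bexp p W (\<lambda>U. p * (1 - p) * ?A U)"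
    unfolding bexp_cmult by simp
  also have "bexp p W (\<lambda>U. p * (1 - p) * ?A U) =
      bexp p V (\<lambda>S. \<Sum>(x, y)\<in>arcs {e}. of_bool (x \<notin> S \<and> y \<in> S) * (F (insert x S) - F S)\<^sup>2)"
    unfolding V(1) e(1) sum_arcs_single[OF e(2)] bexp_insert2[OF V(2-4) e(2)]
  proof (intro bexp_cong)
    fix U assume "U \<subseteq> W"
    then have "x \<notin> U" "y \<notin> U" using V by auto
    then show "p * (1 - p) * ?A U = (1 - p)\<^sup>2 * ((case (x, y) of (x, y) \<Rightarrow> of_bool (x \<notin> U \<and> y \<in> U) * (F (insert x U) - F U)\<^sup>2) +
        (case (y, x) of (x, y) \<Rightarrow> of_bool (x \<notin> U \<and> y \<in> U) * (F (insert x U) - F U)\<^sup>2)) +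
      p * (1 - p) * ((case (x, y) of (xa, y) \<Rightarrow> of_bool (xa \<notin> insert x U \<and> y \<in> insert x U) * (F (insert xa (insert x U)) - F (insert x U))\<^sup>2) +
        (case (y, x) of (xa, y) \<Rightarrow> of_bool (xa \<notin> insert x U \<and> y \<in> insert x U) * (F (insert xa (insert x U)) - F (insert x U))\<^sup>2) +
        ((case (x, y) of (x, ya) \<Rightarrow> of_bool (x \<notin> insert y U \<and> ya \<in> insert y U) * (F (insert x (insert y U)) - F (insert y U))\<^sup>2) +
         (case (y, x) of (x, ya) \<Rightarrow> of_bool (x \<notin> insert y U \<and> ya \<in> insert y U) * (F (insert x (insert y U)) - F (insert y U))\<^sup>2))) +
      p\<^sup>2 * ((case (x, y) of (xa, ya) \<Rightarrow> of_bool (xa \<notin> insert x (insert y U) \<and> ya \<in> insert x (insert y U)) * (F (insert xa (insert x (insert y U))) - F (insert x (insert y U)))\<^sup>2) +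
        (case (y, x) of (xa, ya) \<Rightarrow> of_bool (xa \<notin> insert x (insert y U) \<and> ya \<in> insert x (insert y U)) * (F (insert xa (insert x (insert y U))) - F (insert x (insert y U)))\<^sup>2))"
      using e(2) by (simp add: insert_commute power2_commute)
  qed
  finally show ?thesis .
qed

section \<open>The conditioned measure and comparison of Dirichlet forms\<close>

text \<open>The Dirichlet form, up to normalisation, of the chain that refreshes single sites and is only
  constrained to stay nonempty: the pair \<open>S\<close>, \<open>insert x S\<close> has conductance \<open>p\<close> times the weight of
  \<open>S\<close>.\<close>

definition site_form :: "'v set \<Rightarrow> real \<Rightarrow> ('v set \<Rightarrow> real) \<Rightarrow> real" where
  "site_form V p F = p * bexp p V (\<lambda>S. of_bool (S \<noteq> {}) * (\<Sum>x\<in>V. (F (insert x S) - F S)\<^sup>2))"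

lemma bexp_at_empty:
  assumes "finite V"
  shows "bexp p V (\<lambda>S. of_bool (S = {}) * F S) = (1 - p) ^ card V * F {}"
proof -
  have "bexp p V (\<lambda>S. of_bool (S = {}) * F S) =
     (\<Sum>S\<in>Pow V. if S = {} then (1 - p) ^ card V * F {} else 0)"
    unfolding bexp_def by (intro sum.cong) auto
  then show ?thesis using assms by simp
qed

lemma bexp_singletons:
  assumes "finite V" "0 \<le> p" "p \<le> 1" "\<And>S. S \<subseteq> V \<Longrightarrow> 0 \<le> F S"
  shows "(\<Sum>x\<in>V. p * (1 - p) ^ (card V - 1) * F {x}) \<le> bexp p V (\<lambda>S. of_bool (S \<noteq> {}) * F S)"
proof -
  have "(\<Sum>x\<in>V. p * (1 - p) ^ (card V - 1) * F {x}) = (\<Sum>S\<in>(\<lambda>x. {x}) ` V. p ^ card S * (1 - p) ^ card (V - S) * (of_bool (S \<noteq> {}) * F S))"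
    using assms(1) by (subst sum.reindex) (auto simp: card_Diff_singleton intro!: sum.cong)
  also have "\<dots> \<le> bexp p V (\<lambda>S. of_bool (S \<noteq> {}) * F S)"
    unfolding bexp_def using assms by (intro sum_mono2) auto
  finally show ?thesis .
qed

text \<open>The variance is half the mean square of \<open>h x - h y\<close>, and the path from \<open>h x\<close> to \<open>h y\<close> through
  \<open>k x y\<close> bounds each difference. It is used for single particles at \<open>x\<close> and \<open>y\<close> and the pair of
  both.\<close>

lemma sum_sq_dev_le:
  fixes h :: "'a \<Rightarrow> real" and k :: "'a \<Rightarrow> 'a \<Rightarrow> real"
  assumes "finite V" "V \<noteq> {}" and k: "\<And>x y. k x y = k y x"
  defines "m \<equiv> (\<Sum>x\<in>V. h x) / card V"
  shows "(\<Sum>x\<in>V. (h x - m)\<^sup>2) \<le> 2 / card V * (\<Sum>x\<in>V. \<Sum>y\<in>V. (k x y - h x)\<^sup>2)"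
proof -
  let ?n = "real (card V)"
  have n: "0 < ?n" using assms by (simp add: card_gt_0_iff)
  have m: "(\<Sum>x\<in>V. h x) = ?n * m" using n by (simp add: m_def)
  have "(\<Sum>x\<in>V. \<Sum>y\<in>V. (h x - h y)\<^sup>2) = (\<Sum>x\<in>V. \<Sum>y\<in>V. (h x - m)\<^sup>2 - 2 * (h x - m) * (h y - m) + (h y - m)\<^sup>2)"
    by (intro sum.cong refl) (simp add: power2_eq_square algebra_simps)
  also have "\<dots> = 2 * ?n * (\<Sum>x\<in>V. (h x - m)\<^sup>2) - 2 * (\<Sum>x\<in>V. h x - m) * (\<Sum>y\<in>V. h y - m)"
  proof -
    have "(\<Sum>x\<in>V. \<Sum>y\<in>V. 2 * (h x - m) * (h y - m)) = 2 * (\<Sum>x\<in>V. h x - m) * (\<Sum>y\<in>V. h y - m)"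
      by (simp only: mult.assoc sum_product) (simp only: sum_distrib_left)
    then show ?thesis by (simp add: sum.distrib sum_subtractf sum_distrib_left mult.assoc)
  qed
  also have "(\<Sum>x\<in>V. h x - m) = 0" by (simp add: sum_subtractf m)
  finally have 1: "(\<Sum>x\<in>V. \<Sum>y\<in>V. (h x - h y)\<^sup>2) = 2 * ?n * (\<Sum>x\<in>V. (h x - m)\<^sup>2)" by simp
  have "(h x - h y)\<^sup>2 \<le> 2 * (k x y - h x)\<^sup>2 + 2 * (k y x - h y)\<^sup>2" for x y
    using zero_le_power2[of "(k x y - h x) + (k x y - h y)"] k[of x y]
    by (simp add: power2_eq_square algebra_simps)
  then have "(\<Sum>x\<in>V. \<Sum>y\<in>V. (h x - h y)\<^sup>2) \<le> (\<Sum>x\<in>V. \<Sum>y\<in>V. 2 * (k x y - h x)\<^sup>2 + 2 * (k y x - h y)\<^sup>2)"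
    by (intro sum_mono)
  also have "\<dots> = 2 * (\<Sum>x\<in>V. \<Sum>y\<in>V. (k x y - h x)\<^sup>2) + 2 * (\<Sum>x\<in>V. \<Sum>y\<in>V. (k y x - h y)\<^sup>2)"
    by (simp add: sum.distrib sum_distrib_left)
  also have "(\<Sum>x\<in>V. \<Sum>y\<in>V. (k y x - h y)\<^sup>2) = (\<Sum>x\<in>V. \<Sum>y\<in>V. (k x y - h x)\<^sup>2)"
    by (rule sum.swap)
  finally show ?thesis unfolding 1 using n by (simp add: field_simps)
qed

text \<open>For fixed \<open>c\<close> this integrand is nonnegative, and its mean is minimal, and then
  equal to the entropy, when \<open>c\<close> is the mean of \<open>a\<close>.\<close>

lemma entropy_variational:
  fixes a c :: real
  assumes "0 \<le> a" "0 < c"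
  shows "0 \<le> a * ln (a / c) - a + c"
proof (cases "a = 0")
  case False
  then have a: "0 < a" using assms by simp
  have "ln (c / a) \<le> c / a - 1" using a assms by (intro ln_le_minus_one) auto
  then have "a * ln (c / a) \<le> a * (c / a - 1)" using a by (intro mult_left_mono) auto
  moreover have "ln (c / a) = - ln (a / c)" using a assms by (simp add: ln_div)
  ultimately show ?thesis using a by (simp add: algebra_simps)
qed (use assms in auto)

text \<open>The entropy of \<open>F\<^sup>2\<close> under the conditioned measure, times the probability of being nonempty.\<close>

definition plus_entropy :: "'v set \<Rightarrow> real \<Rightarrow> ('v set \<Rightarrow> real) \<Rightarrow> real" where
  "plus_entropy V p F = (let m = bexp p V (\<lambda>S. of_bool (S \<noteq> {}) * (F S)\<^sup>2) / (1 - (1 - p) ^ card V)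
     in bexp p V (\<lambda>S. of_bool (S \<noteq> {}) * ((F S)\<^sup>2 * ln ((F S)\<^sup>2 / m))))"

text \<open>By \<open>entropy_variational\<close> the conditioned entropy is at most the integral over the nonempty
  configurations of the integrand with \<open>c\<close> the unconditioned mean. Adding the nonnegative
  contribution of the empty configuration gives the unconditioned entropy.\<close>

lemma plus_entropy_le_bern_entropy:
  assumes "finite V" "V \<noteq> {}" and p: "0 < p" "p < 1"
  shows "plus_entropy V p F \<le> bern_entropy p V (\<lambda>S. (F S)\<^sup>2)"
proof -
  define Z where "Z = 1 - (1 - p) ^ card V"
  define M where "M = bexp p V (\<lambda>S. of_bool (S \<noteq> {}) * (F S)\<^sup>2)"
  define c where "c = bexp p V (\<lambda>S. (F S)\<^sup>2)"
  have "(1 - p) ^ card V < 1" using assms by (intro power_less_one_iff[THEN iffD2]) (auto simp: card_gt_0_iff)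
  then have Z: "0 < Z" by (simp add: Z_def)
  have M0: "0 \<le> M" unfolding M_def using p by (intro bexp_nonneg) auto
  have Mc: "M \<le> c" unfolding M_def c_def using p by (intro bexp_mono) auto
  have bool: "bexp p V (\<lambda>S. of_bool (S \<noteq> {}) * k) = Z * k" for k
  proof -
    have "bexp p V (\<lambda>S. of_bool (S \<noteq> {}) * k) = bexp p V (\<lambda>S. k - of_bool (S = {}) * k)"
      by (intro bexp_cong) auto
    then show ?thesis
      by (simp only: bexp_diff bexp_const[OF assms(1)] bexp_at_empty[OF assms(1), where F = "\<lambda>_. k"] Z_def)
        (simp add: algebra_simps)
  qed
  show ?thesis
  proof (cases "M = 0")
    case True
    have zero: "F S = 0" if "S \<subseteq> V" "S \<noteq> {}" for S
    proof (rule ccontr)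
      assume "F S \<noteq> 0"
      then have "0 < M" unfolding M_def using p assms that by (intro bexp_pos[where ?S0.0 = S]) auto
      then show False using True by simp
    qed
    have "plus_entropy V p F = bexp p V (\<lambda>S. 0)"
      unfolding plus_entropy_def Let_def
    proof (intro bexp_cong)
      fix S assume "S \<subseteq> V"
      then show "of_bool (S \<noteq> {}) * ((F S)\<^sup>2 * ln ((F S)\<^sup>2 /
          (bexp p V (\<lambda>S. of_bool (S \<noteq> {}) * (F S)\<^sup>2) / (1 - (1 - p) ^ card V)))) = 0"
        by (cases "S = {}") (simp_all add: zero)
    qed
    then have 0: "plus_entropy V p F = 0" using assms by simp
    have "bern_entropy p V (\<lambda>S. (F S)\<^sup>2) = (1 - p) ^ card V * ((F {})\<^sup>2 * ln ((F {})\<^sup>2)) - (1 - p) ^ card V * (F {})\<^sup>2 * ln ((1 - p) ^ card V * (F {})\<^sup>2)"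
    proof -
      have "bexp p V (\<lambda>S. (F S)\<^sup>2 * ln ((F S)\<^sup>2)) = bexp p V (\<lambda>S. of_bool (S = {}) * ((F S)\<^sup>2 * ln ((F S)\<^sup>2)))"
         "bexp p V (\<lambda>S. (F S)\<^sup>2) = bexp p V (\<lambda>S. of_bool (S = {}) * (F S)\<^sup>2)"
      proof (intro bexp_cong)
        fix S assume "S \<subseteq> V"
        then show "(F S)\<^sup>2 * ln ((F S)\<^sup>2) = of_bool (S = {}) * ((F S)\<^sup>2 * ln ((F S)\<^sup>2))"
          using zero[of S] by (cases "S = {}") simp_all
      next
        show "bexp p V (\<lambda>S. (F S)\<^sup>2) = bexp p V (\<lambda>S. of_bool (S = {}) * (F S)\<^sup>2)"
        proof (intro bexp_cong)
          fix S assume "S \<subseteq> V"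
          then show "(F S)\<^sup>2 = of_bool (S = {}) * (F S)\<^sup>2"
            using zero[of S] by (cases "S = {}") simp_all
        qed
      qed
      then show ?thesis unfolding bern_entropy_def by (simp add: bexp_at_empty[OF assms(1)])
    qed
    also have "\<dots> \<ge> 0"
    proof (cases "F {} = 0")
      case False
      have "ln ((1 - p) ^ card V * (F {})\<^sup>2) \<le> ln ((F {})\<^sup>2)"
        using p False by (subst ln_le_cancel_iff) (auto intro!: mult_left_le_one_le power_le_one)
      then have "(1 - p) ^ card V * (F {})\<^sup>2 * ln ((1 - p) ^ card V * (F {})\<^sup>2) \<le> (1 - p) ^ card V * (F {})\<^sup>2 * ln ((F {})\<^sup>2)"
        using p by (intro mult_left_mono) auto
      then show ?thesis by (simp add: mult.assoc)
    qed simp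
    finally show ?thesis using 0 by simp
  next
    case False
    then have Mp: "0 < M" using M0 by simp
    have cp: "0 < c" using Mp Mc by simp
    \<comment> \<open>Replace the conditional mean \<open>M / Z\<close> inside the logarithm by the unconditioned mean \<open>c\<close>.\<close>
    have 1: "plus_entropy V p F = bexp p V (\<lambda>S. of_bool (S \<noteq> {}) * ((F S)\<^sup>2 * ln ((F S)\<^sup>2 / c))) - M * ln (M / Z / c)"
    proof -
      have pt: "(F S)\<^sup>2 * ln ((F S)\<^sup>2 / (M / Z)) = (F S)\<^sup>2 * ln ((F S)\<^sup>2 / c) - (F S)\<^sup>2 * ln (M / Z / c)" for S
      proof (cases "F S = 0")
        case False
        then have "ln ((F S)\<^sup>2 / (M / Z)) = ln ((F S)\<^sup>2 / c) - ln (M / Z / c)"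
          using Mp Z cp by (simp add: ln_div ln_mult)
        then show ?thesis by (simp add: right_diff_distrib)
      qed simp
      have "plus_entropy V p F = bexp p V (\<lambda>S. of_bool (S \<noteq> {}) * ((F S)\<^sup>2 * ln ((F S)\<^sup>2 / c)) - ln (M / Z / c) * (of_bool (S \<noteq> {}) * (F S)\<^sup>2))"
        unfolding plus_entropy_def Let_def M_def[symmetric] Z_def[symmetric] pt
        by (intro bexp_cong) (simp add: algebra_simps)
      then show ?thesis unfolding bexp_diff bexp_cmult M_def[symmetric] by (simp only: mult.commute)
    qed
    have "0 \<le> Z * (M / Z * ln (M / Z / c) - M / Z + c)"
      using Z Mp cp by (intro mult_nonneg_nonneg entropy_variational) auto
    also have "\<dots> = M * ln (M / Z / c) - M + Z * c" using Z by (simp add: algebra_simps)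
    finally have "plus_entropy V p F \<le> bexp p V (\<lambda>S. of_bool (S \<noteq> {}) * ((F S)\<^sup>2 * ln ((F S)\<^sup>2 / c))) - M + Z * c"
      using 1 by simp
    also have "\<dots> = bexp p V (\<lambda>S. of_bool (S \<noteq> {}) * ((F S)\<^sup>2 * ln ((F S)\<^sup>2 / c) - (F S)\<^sup>2 + c))"
    proof -
      have "bexp p V (\<lambda>S. of_bool (S \<noteq> {}) * ((F S)\<^sup>2 * ln ((F S)\<^sup>2 / c) - (F S)\<^sup>2 + c)) =
         bexp p V (\<lambda>S. of_bool (S \<noteq> {}) * ((F S)\<^sup>2 * ln ((F S)\<^sup>2 / c)) - of_bool (S \<noteq> {}) * (F S)\<^sup>2 + of_bool (S \<noteq> {}) * c)"
        by (intro bexp_cong) (simp add: algebra_simps)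
      then show ?thesis by (simp only: bexp_diff bexp_add M_def bool)
    qed
    also have "\<dots> \<le> bexp p V (\<lambda>S. (F S)\<^sup>2 * ln ((F S)\<^sup>2 / c) - (F S)\<^sup>2 + c)"
    proof (rule bexp_mono)
      fix S
      have "0 \<le> (F S)\<^sup>2 * ln ((F S)\<^sup>2 / c) - (F S)\<^sup>2 + c" using cp by (intro entropy_variational) auto
      then show "of_bool (S \<noteq> {}) * ((F S)\<^sup>2 * ln ((F S)\<^sup>2 / c) - (F S)\<^sup>2 + c) \<le> (F S)\<^sup>2 * ln ((F S)\<^sup>2 / c) - (F S)\<^sup>2 + c"
        by auto
    qed (use p in auto)
    also have "\<dots> = bexp p V (\<lambda>S. (F S)\<^sup>2 * ln ((F S)\<^sup>2 / c))"
      using assms by (simp add: bexp_diff bexp_add c_def)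
    also have "\<dots> = bexp p V (\<lambda>S. (F S)\<^sup>2 * ln ((F S)\<^sup>2) - ln c * (F S)\<^sup>2)"
    proof (intro bexp_cong)
      fix S show "(F S)\<^sup>2 * ln ((F S)\<^sup>2 / c) = (F S)\<^sup>2 * ln ((F S)\<^sup>2) - ln c * (F S)\<^sup>2"
        using cp by (cases "F S = 0") (auto simp: ln_div algebra_simps)
    qed
    also have "\<dots> = bern_entropy p V (\<lambda>S. (F S)\<^sup>2)"
      unfolding bexp_diff bexp_cmult bern_entropy_def c_def by simp
    finally show ?thesis .
  qed
qed

text \<open>The product form has one family of terms that \<open>site_form\<close> lacks, the jumps between the
  empty configuration and single particles. With the chosen value at the empty
  configuration they form a variance over single particles, which is controlled by passing
  through pairs of particles; this costs the factor \<open>2 / (n p)\<close>.\<close>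

lemma plus_log_sobolev_site:
  fixes p :: real
  assumes "finite V" "V \<noteq> {}" and p: "0 < p" "p \<le> 1 / 2"
  shows "plus_entropy V p F \<le> (18 + 8 * ln (1 / p)) * (1 + 2 / (card V * p)) * site_form V p F"
proof -
  let ?n = "real (card V)" and ?C = "18 + 8 * ln (1 / p)"
  have n: "0 < ?n" using assms by (simp add: card_gt_0_iff)
  have C: "0 \<le> ?C" using p by simp
  define m where "m = (\<Sum>x\<in>V. F {x}) / card V"
  \<comment> \<open>The value at the empty configuration is free; the mean over the single particles makes the
      additional term of the product form a variance.\<close>
  define f where "f S = (if S = {} then m else F S)" for S
  have "of_bool (S \<noteq> {}) * (F S)\<^sup>2 = of_bool (S \<noteq> {}) * (f S)\<^sup>2"
    and "of_bool (S \<noteq> {}) * ((F S)\<^sup>2 * ln ((F S)\<^sup>2 / c)) = of_bool (S \<noteq> {}) * ((f S)\<^sup>2 * ln ((f S)\<^sup>2 / c))" for S c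
    by (simp_all add: f_def)
  then have "plus_entropy V p F = plus_entropy V p f"
    unfolding plus_entropy_def by (simp only:)
  also have "\<dots> \<le> bern_entropy p V (\<lambda>S. (f S)\<^sup>2)" using assms p by (intro plus_entropy_le_bern_entropy) auto
  also have "\<dots> \<le> ?C * (p * (\<Sum>x\<in>V. bexp p V (\<lambda>S. of_bool (x \<notin> S) * (f (insert x S) - f S)\<^sup>2)))"
    by (rule product_log_sobolev[OF assms(1) p])
  also have "(\<Sum>x\<in>V. bexp p V (\<lambda>S. of_bool (x \<notin> S) * (f (insert x S) - f S)\<^sup>2)) =
      bexp p V (\<lambda>S. of_bool (S = {}) * (\<Sum>x\<in>V. (F {x} - m)\<^sup>2) + of_bool (S \<noteq> {}) * (\<Sum>x\<in>V. (F (insert x S) - F S)\<^sup>2))"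
    unfolding bexp_sum[symmetric]
    by (intro bexp_cong) (auto simp: f_def insert_absorb intro!: sum.cong)
  also have "\<dots> = (1 - p) ^ card V * (\<Sum>x\<in>V. (F {x} - m)\<^sup>2) + bexp p V (\<lambda>S. of_bool (S \<noteq> {}) * (\<Sum>x\<in>V. (F (insert x S) - F S)\<^sup>2))"
    unfolding bexp_add bexp_at_empty[OF assms(1)] ..
  also have "p * \<dots> = p * ((1 - p) ^ card V * (\<Sum>x\<in>V. (F {x} - m)\<^sup>2)) + site_form V p F"
    unfolding site_form_def by (simp add: distrib_left)
  finally have main: "plus_entropy V p F \<le> ?C * (p * ((1 - p) ^ card V * (\<Sum>x\<in>V. (F {x} - m)\<^sup>2)) + site_form V p F)" .
  have empty: "p * ((1 - p) ^ card V * (\<Sum>x\<in>V. (F {x} - m)\<^sup>2)) \<le> 2 / (?n * p) * site_form V p F"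
  proof -
    let ?s = "\<Sum>x\<in>V. \<Sum>y\<in>V. (F {x, y} - F {x})\<^sup>2"
    have "(\<Sum>x\<in>V. (F {x} - m)\<^sup>2) \<le> 2 / ?n * ?s"
      unfolding m_def using sum_sq_dev_le[OF assms(1,2), of "\<lambda>x y. F {x, y}" "\<lambda>x. F {x}"] by (simp add: insert_commute)
    then have "(1 - p) ^ card V * (\<Sum>x\<in>V. (F {x} - m)\<^sup>2) \<le> (1 - p) ^ card V * (2 / ?n * ?s)"
      using p by (intro mult_left_mono) auto
    also have "\<dots> \<le> (1 - p) ^ (card V - 1) * (2 / ?n * ?s)"
      using p n by (intro mult_right_mono power_decreasing mult_nonneg_nonneg sum_nonneg) auto
    also have "\<dots> = 2 / (?n * p) * (\<Sum>x\<in>V. p * (1 - p) ^ (card V - 1) * (\<Sum>y\<in>V. (F (insert y {x}) - F {x})\<^sup>2))"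
      using p by (simp add: sum_distrib_left[symmetric] insert_commute)
    also have "\<dots> \<le> 2 / (?n * p) * bexp p V (\<lambda>S. of_bool (S \<noteq> {}) * (\<Sum>x\<in>V. (F (insert x S) - F S)\<^sup>2))"
      using p n assms(1)
      by (intro mult_left_mono bexp_singletons[where F = "\<lambda>S. \<Sum>x\<in>V. (F (insert x S) - F S)\<^sup>2"]) (auto intro!: sum_nonneg)
    finally have "p * ((1 - p) ^ card V * (\<Sum>x\<in>V. (F {x} - m)\<^sup>2)) \<le> p * (2 / (?n * p) * bexp p V (\<lambda>S. of_bool (S \<noteq> {}) * (\<Sum>x\<in>V. (F (insert x S) - F S)\<^sup>2)))"
      using p by (intro mult_left_mono) auto
    then show ?thesis by (simp add: site_form_def mult_ac)
  qed
  have "?C * (p * ((1 - p) ^ card V * (\<Sum>x\<in>V. (F {x} - m)\<^sup>2)) + site_form V p F) \<le>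
      ?C * (2 / (?n * p) * site_form V p F + site_form V p F)"
    using C empty by (intro mult_left_mono add_right_mono) auto
  also have "\<dots> = ?C * (1 + 2 / (?n * p)) * site_form V p F"
    by (simp add: distrib_left distrib_right)
  finally show ?thesis using main by (rule order_trans[rotated])
qed

text \<open>The hypothesis \<open>pinned\<close> holds as soon as \<open>T\<close> bounds the sum over \<open>x\<close> of the effective resistances
  to \<open>y\<close>. It is applied to
  \<open>z \<mapsto> F (insert z S)\<close> with an arbitrary occupied site \<open>y\<close>; a single target \<open>y\<close> suffices, so
  no factor counting the particles of \<open>S\<close> appears.\<close>

lemma site_form_le_cbsep:
  assumes V: "finite V" and E: "\<And>e. e \<in> E \<Longrightarrow> e \<subseteq> V \<and> card e = 2" and p: "0 < p" "p < 1" and T: "0 \<le> T"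
    and pinned: "\<And>g y. y \<in> V \<Longrightarrow> (\<Sum>x\<in>V. (g x - g y)\<^sup>2) \<le> T * (\<Sum>(x, z)\<in>arcs E. (g x - g z)\<^sup>2)"
  shows "site_form V p F \<le> 4 * T * (\<Sum>e\<in>E. cbsep_edge V p F e)"
proof -
  have E': "E \<subseteq> Pow V" using E by auto
  let ?en = "\<lambda>S A. \<Sum>(z, w)\<in>A. (F (insert z S) - F (insert w S))\<^sup>2"
  have "site_form V p F \<le> p * bexp p V (\<lambda>S. T * (of_bool (S \<noteq> {}) * ?en S (arcs E)))"
    unfolding site_form_def
  proof (intro mult_left_mono bexp_mono)
    fix S assume S: "S \<subseteq> V"
    show "of_bool (S \<noteq> {}) * (\<Sum>x\<in>V. (F (insert x S) - F S)\<^sup>2) \<le> T * (of_bool (S \<noteq> {}) * ?en S (arcs E))"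
    proof (cases "S = {}")
      case False
      then obtain y where y: "y \<in> S" by auto
      \<comment> \<open>\<open>F (insert x S) - F S\<close> is, up to sign, the effect of carrying a particle from \<open>x\<close> to the occupied site
          \<open>y\<close>, where it disappears.\<close>
      then have "F S = F (insert y S)" by (simp add: insert_absorb)
      then show ?thesis
        using pinned[of y "\<lambda>x. F (insert x S)"] y S False by auto
    qed simp
  qed (use p in auto)
  also have "\<dots> = T * (p * bexp p V (\<lambda>S. \<Sum>e\<in>E. of_bool (S \<noteq> {}) * ?en S (arcs {e})))"
    unfolding bexp_cmult sum_arcs[OF V E'] by (simp only: sum_distrib_left) (rule mult.left_commute)
  also have "\<dots> = T * (\<Sum>e\<in>E. p * bexp p V (\<lambda>S. of_bool (S \<noteq> {}) * ?en S (arcs {e})))"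
    unfolding bexp_sum by (simp add: sum_distrib_left)
  also have "\<dots> \<le> T * (\<Sum>e\<in>E. 4 * cbsep_edge V p F e)"
    using T E V p by (intro mult_left_mono sum_mono moves_le_cbsep_edge) auto
  finally show ?thesis by (simp add: sum_distrib_left mult_ac)
qed

text \<open>The FA-1f Dirichlet form, times the probability of being nonempty.\<close>

definition fa_form :: "'v set \<Rightarrow> 'v set set \<Rightarrow> real \<Rightarrow> ('v set \<Rightarrow> real) \<Rightarrow> real" where
  "fa_form V E p F = p * (\<Sum>x\<in>V. bexp p V (\<lambda>S. of_bool (x \<notin> S \<and> fa_constraint E x (\<lambda>v. v \<in> S)) * (F (insert x S) - F S)\<^sup>2))"

text \<open>Every occupied neighbour \<open>y\<close> of \<open>x\<close> contributes once for the edge between them, so a flip at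
  \<open>x\<close> is used at most \<open>\<Delta>\<close> times.\<close>

lemma cbsep_le_fa_form:
  assumes V: "finite V" and E: "\<And>e. e \<in> E \<Longrightarrow> e \<subseteq> V \<and> card e = 2" and p: "0 < p" "p < 1"
    and deg: "\<And>x. x \<in> V \<Longrightarrow> card {y. {x, y} \<in> E} \<le> \<Delta>"
  shows "(\<Sum>e\<in>E. cbsep_edge V p F e) \<le> 2 * real \<Delta> / p * fa_form V E p F"
proof -
  have E': "E \<subseteq> Pow V" using E by auto
  let ?g = "\<lambda>S x. (F (insert x S) - F S)\<^sup>2"
  have arcs_Sigma: "arcs E = Sigma V (\<lambda>x. {y. {x, y} \<in> E})" using E' by (auto simp: arcs_def)
  have finN: "finite {y. {x, y} \<in> E}" for x
    using E' by (intro finite_subset[OF _ V]) auto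
  have "(\<Sum>e\<in>E. cbsep_edge V p F e) \<le> (\<Sum>e\<in>E. 2 * bexp p V (\<lambda>S. \<Sum>(x, y)\<in>arcs {e}. of_bool (x \<notin> S \<and> y \<in> S) * ?g S x))"
    using E V p by (intro sum_mono cbsep_edge_le_fa) auto
  also have "\<dots> = 2 * bexp p V (\<lambda>S. \<Sum>(x, y)\<in>arcs E. of_bool (x \<notin> S \<and> y \<in> S) * ?g S x)"
    unfolding sum_arcs[OF V E'] bexp_sum sum_distrib_left ..
  also have "\<dots> \<le> 2 * bexp p V (\<lambda>S. \<Sum>x\<in>V. real \<Delta> * (of_bool (x \<notin> S \<and> fa_constraint E x (\<lambda>v. v \<in> S)) * ?g S x))"
  proof (intro mult_left_mono bexp_mono)
    fix S
    have "(\<Sum>(x, y)\<in>arcs E. of_bool (x \<notin> S \<and> y \<in> S) * ?g S x) = (\<Sum>x\<in>V. \<Sum>y\<in>{y. {x, y} \<in> E}. of_bool (x \<notin> S \<and> y \<in> S) * ?g S x)"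
      unfolding arcs_Sigma using V finN by (intro sum.Sigma[symmetric]) auto
    also have "\<dots> \<le> (\<Sum>x\<in>V. real \<Delta> * (of_bool (x \<notin> S \<and> fa_constraint E x (\<lambda>v. v \<in> S)) * ?g S x))"
    proof (rule sum_mono)
      fix x assume x: "x \<in> V"
      have "(\<Sum>y\<in>{y. {x, y} \<in> E}. of_bool (x \<notin> S \<and> y \<in> S) * ?g S x) \<le>
          (\<Sum>y\<in>{y. {x, y} \<in> E}. of_bool (x \<notin> S \<and> fa_constraint E x (\<lambda>v. v \<in> S)) * ?g S x)"
        by (intro sum_mono mult_right_mono) (auto simp: fa_constraint_def)
      also have "\<dots> = real (card {y. {x, y} \<in> E}) * (of_bool (x \<notin> S \<and> fa_constraint E x (\<lambda>v. v \<in> S)) * ?g S x)"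
        by simp
      also have "\<dots> \<le> real \<Delta> * (of_bool (x \<notin> S \<and> fa_constraint E x (\<lambda>v. v \<in> S)) * ?g S x)"
        using deg[OF x] by (intro mult_right_mono) auto
      finally show "(\<Sum>y\<in>{y. {x, y} \<in> E}. of_bool (x \<notin> S \<and> y \<in> S) * ?g S x) \<le> \<dots>" .
    qed
    finally show "(\<Sum>(x, y)\<in>arcs E. of_bool (x \<notin> S \<and> y \<in> S) * ?g S x) \<le> \<dots>" .
  qed (use p in auto)
  also have "\<dots> = 2 * real \<Delta> / p * fa_form V E p F"
    unfolding bexp_sum bexp_cmult fa_form_def using p by (simp add: sum_distrib_left[symmetric])
  finally show ?thesis .
qed

section \<open>Translations of the torus\<close>

definition torus_shift :: "nat \<Rightarrow> nat \<Rightarrow> (nat \<Rightarrow> nat) \<Rightarrow> (nat \<Rightarrow> nat) \<Rightarrow> nat \<Rightarrow> nat" where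
  "torus_shift d L v x = (\<lambda>i\<in>{..<d}. (x i + v i) mod L)"

definition unit_step :: "nat \<Rightarrow> nat \<Rightarrow> nat" where
  "unit_step i = (\<lambda>j. if j = i then 1 else 0)"

text \<open>Unlike a sum over edges, the sum over directed unit steps is visibly invariant under
  translations.\<close>

definition unit_step_energy :: "nat \<Rightarrow> nat \<Rightarrow> ((nat \<Rightarrow> nat) \<Rightarrow> real) \<Rightarrow> real" where
  "unit_step_energy d L g = (\<Sum>x\<in>torus_verts d L. \<Sum>i<d. (g (torus_shift d L (unit_step i) x) - g x)\<^sup>2)"

lemma finite_torus_verts [simp]: "finite (torus_verts d L)"
  by (simp add: torus_verts_def finite_PiE)

lemma card_torus_verts: "card (torus_verts d L) = L ^ d"
  by (simp add: torus_verts_def card_PiE)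

lemma torus_vertsD: "x \<in> torus_verts d L \<Longrightarrow> i < d \<Longrightarrow> x i < L"
  by (auto simp: torus_verts_def)

lemma shift_in_verts: "0 < L \<Longrightarrow> torus_shift d L v x \<in> torus_verts d L"
  by (auto simp: torus_shift_def torus_verts_def)

lemma torus_verts_eqI:
  assumes "x \<in> torus_verts d L" "y \<in> torus_verts d L" "\<And>i. i < d \<Longrightarrow> x i = y i"
  shows "x = y"
  using assms unfolding torus_verts_def by (intro PiE_ext[of x "{..<d}" _ y]) auto

lemma shift_shift: "torus_shift d L v (torus_shift d L u x) = torus_shift d L (\<lambda>i. u i + v i) x"
  by (auto simp: torus_shift_def fun_eq_iff mod_add_left_eq add.assoc)

lemma shift_period:
  assumes "x \<in> torus_verts d L" "\<And>i. i < d \<Longrightarrow> v i mod L = 0"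
  shows "torus_shift d L v x = x"
proof
  fix i show "torus_shift d L v x i = x i"
  proof (cases "i < d")
    case True
    then have "(x i + v i) mod L = x i mod L" using assms(2) by (metis add.right_neutral mod_add_right_eq)
    then show ?thesis using True torus_vertsD[OF assms(1)] by (simp add: torus_shift_def)
  next
    case False
    then show ?thesis using assms(1) by (auto simp: torus_shift_def torus_verts_def PiE_def extensional_def)
  qed
qed

lemma shift_bij:
  assumes L: "0 < L"
  shows "bij_betw (torus_shift d L v) (torus_verts d L) (torus_verts d L)"
proof -
  have inv: "torus_shift d L (\<lambda>i. L - v i mod L) (torus_shift d L v x) = x" if "x \<in> torus_verts d L" for x
    unfolding shift_shift
  proof (rule shift_period[OF that])
    fix i
    have "v i + (L - v i mod L) = L * (v i div L) + L"
      using mult_div_mod_eq[of L "v i"] mod_less_divisor[OF L, of "v i"] by linarith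
    then show "(v i + (L - v i mod L)) mod L = 0" by simp
  qed
  have inj: "inj_on (torus_shift d L v) (torus_verts d L)" 
    by (rule inj_on_inverseI[where g = "torus_shift d L (\<lambda>i. L - v i mod L)", OF inv])
  moreover have "torus_shift d L v ` torus_verts d L = torus_verts d L"
    using shift_in_verts[OF L] by (intro endo_inj_surj inj) auto
  ultimately show ?thesis by (simp add: bij_betw_def)
qed

lemma sum_shift:
  fixes g :: "(nat \<Rightarrow> nat) \<Rightarrow> real"
  assumes "0 < L"
  shows "(\<Sum>x\<in>torus_verts d L. g (torus_shift d L v x)) = (\<Sum>x\<in>torus_verts d L. g x)"
  by (rule sum.reindex_bij_betw[OF shift_bij[OF assms]])

lemma unit_step_energy_nonneg: "0 \<le> unit_step_energy d L g"
  by (auto simp: unit_step_energy_def intro!: sum_nonneg)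

text \<open>The left side is the squared \<open>L\<^sup>2\<close> distance of \<open>g\<close> from a translate. Translations are isometries,
  so the distance is subadditive along the unit steps that make up \<open>v\<close>.\<close>

lemma shift_energy:
  assumes L: "0 < L"
  shows "(\<Sum>i<d. v i) = k \<Longrightarrow> (\<Sum>x\<in>torus_verts d L. (g (torus_shift d L v x) - g x)\<^sup>2) \<le> (real k)\<^sup>2 * unit_step_energy d L g"
proof (induction k arbitrary: v)
  case 0
  then have "torus_shift d L v x = x" if "x \<in> torus_verts d L" for x
    using shift_period[OF that, of v] by auto
  then show ?case by simp
next
  case (Suc k)
  let ?V = "torus_verts d L" and ?E = "unit_step_energy d L g"
  obtain i where i: "i < d" "0 < v i"
    using Suc.prems by (metis (no_types, lifting) finite_lessThan gr0I lessThan_iff nat.distinct(1) sum.neutral)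
  define u where "u = v(i := v i - 1)"
  have v: "v = (\<lambda>j. u j + unit_step i j)" using i by (auto simp: u_def unit_step_def fun_eq_iff)
  have "(\<Sum>j<d. unit_step i j) = 1" using i by (simp add: unit_step_def)
  then have u: "(\<Sum>j<d. u j) = k" using Suc.prems unfolding v by (simp add: sum.distrib)
  have L2: "L2_set (\<lambda>x. g (torus_shift d L v x) - g x) ?V \<le>
      L2_set (\<lambda>x. g (torus_shift d L v x) - g (torus_shift d L u x)) ?V + L2_set (\<lambda>x. g (torus_shift d L u x) - g x) ?V"
    using L2_set_triangle_ineq[of "\<lambda>x. g (torus_shift d L v x) - g (torus_shift d L u x)" "\<lambda>x. g (torus_shift d L u x) - g x" ?V]
    by simp
  have "(\<Sum>x\<in>?V. (g (torus_shift d L v x) - g (torus_shift d L u x))\<^sup>2) = (\<Sum>x\<in>?V. (g (torus_shift d L (unit_step i) x) - g x)\<^sup>2)"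
    using sum_shift[OF L, of "\<lambda>x. (g (torus_shift d L (unit_step i) x) - g x)\<^sup>2" d u]
    unfolding v by (simp add: shift_shift)
  also have "\<dots> \<le> ?E"
    unfolding unit_step_energy_def using i
    by (intro sum_mono member_le_sum[where f = "\<lambda>i. (g (torus_shift d L (unit_step i) _) - g _)\<^sup>2"]) auto
  finally have 1: "L2_set (\<lambda>x. g (torus_shift d L v x) - g (torus_shift d L u x)) ?V \<le> sqrt ?E"
    unfolding L2_set_def by simp
  have "(\<Sum>x\<in>?V. (g (torus_shift d L u x) - g x)\<^sup>2) \<le> (real k)\<^sup>2 * ?E"
    by (rule Suc.IH[OF u])
  then have 2: "L2_set (\<lambda>x. g (torus_shift d L u x) - g x) ?V \<le> real k * sqrt ?E"
    unfolding L2_set_def using real_sqrt_le_mono[of _ "(real k)\<^sup>2 * ?E"] by (simp add: real_sqrt_mult)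
  have "L2_set (\<lambda>x. g (torus_shift d L v x) - g x) ?V \<le> real (Suc k) * sqrt ?E"
    using L2 1 2 by (simp add: algebra_simps)
  then have "(L2_set (\<lambda>x. g (torus_shift d L v x) - g x) ?V)\<^sup>2 \<le> (real (Suc k) * sqrt ?E)\<^sup>2"
    by (intro power_mono L2_set_nonneg)
  then show ?case
    using unit_step_energy_nonneg[of d L g]
    by (simp add: L2_set_def power_mult_distrib sum_nonneg)
qed

definition torus_mean :: "nat \<Rightarrow> nat \<Rightarrow> ((nat \<Rightarrow> nat) \<Rightarrow> real) \<Rightarrow> real" where
  "torus_mean d L g = (\<Sum>x\<in>torus_verts d L. g x) / real L ^ d"

lemma exists_shift:
  assumes "x \<in> torus_verts d L" "y \<in> torus_verts d L"
  obtains v where "v \<in> torus_verts d L" "torus_shift d L v x = y"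
proof
  let ?v = "\<lambda>i\<in>{..<d}. (y i + (L - x i)) mod L"
  show "?v \<in> torus_verts d L"
    using torus_vertsD[OF assms(1)] by (force simp: torus_verts_def)
  show "torus_shift d L ?v x = y"
  proof (rule torus_verts_eqI[OF _ assms(2)])
    show "torus_shift d L ?v x i = y i" if "i < d" for i
      using torus_vertsD[OF assms(1) that] torus_vertsD[OF assms(2) that] that
      by (simp add: torus_shift_def mod_add_right_eq)
    show "torus_shift d L ?v x \<in> torus_verts d L"
      using torus_vertsD[OF assms(1)] by (force simp: torus_verts_def torus_shift_def)
  qed
qed

lemma sum_all_shifts:
  fixes g :: "(nat \<Rightarrow> nat) \<Rightarrow> real"
  assumes "0 < L" "x \<in> torus_verts d L"
  shows "(\<Sum>v\<in>torus_verts d L. g (torus_shift d L v x)) = (\<Sum>y\<in>torus_verts d L. g y)"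
proof (rule sum.reindex_bij_betw[of "\<lambda>v. torus_shift d L v x"])
  have "(\<lambda>v. torus_shift d L v x) ` torus_verts d L = torus_verts d L"
    using shift_in_verts[OF assms(1)] by (auto elim: exists_shift[OF assms(2)])
  then show "bij_betw (\<lambda>v. torus_shift d L v x) (torus_verts d L) (torus_verts d L)"
    by (simp add: bij_betw_def eq_card_imp_inj_on)
qed

text \<open>By Jensen's inequality, \<open>g x\<close> minus the mean is bounded by the average of
  \<open>g (x + v) - g x\<close> over all translations \<open>v\<close>, which have at most \<open>d L\<close> unit steps.\<close>

lemma torus_poincare:
  assumes L: "0 < L"
  shows "(\<Sum>x\<in>torus_verts d L. (g x - torus_mean d L g)\<^sup>2) \<le> (real d * real L)\<^sup>2 * unit_step_energy d L g"
proof -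
  let ?V = "torus_verts d L" and ?E = "unit_step_energy d L g" and ?n = "real L ^ d"
  have n: "0 < ?n" "real (card ?V) = ?n" using L by (simp_all add: card_torus_verts)
  have "(g x - torus_mean d L g)\<^sup>2 \<le> (\<Sum>v\<in>?V. (g (torus_shift d L v x) - g x)\<^sup>2) / ?n" if x: "x \<in> ?V" for x
  proof -
    have "?n * (g x - torus_mean d L g) = (\<Sum>v\<in>?V. g x - g (torus_shift d L v x))"
      using n by (simp add: sum_subtractf sum_all_shifts[OF L x] torus_mean_def algebra_simps)
    then have "(?n * (g x - torus_mean d L g))\<^sup>2 = (\<Sum>v\<in>?V. 1 * (g x - g (torus_shift d L v x)))\<^sup>2" by simp
    also have "\<dots> \<le> (\<Sum>v\<in>?V. 1\<^sup>2) * (\<Sum>v\<in>?V. (g x - g (torus_shift d L v x))\<^sup>2)"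
      by (rule Cauchy_Schwarz_ineq_sum)
    also have "\<dots> = ?n * (\<Sum>v\<in>?V. (g (torus_shift d L v x) - g x)\<^sup>2)"
      using n by (simp add: power2_commute)
    finally have "?n * (?n * (g x - torus_mean d L g)\<^sup>2) \<le> ?n * (\<Sum>v\<in>?V. (g (torus_shift d L v x) - g x)\<^sup>2)"
      by (simp add: power2_eq_square algebra_simps)
    then show ?thesis using n by (simp add: pos_le_divide_eq mult.commute)
  qed
  then have "(\<Sum>x\<in>?V. (g x - torus_mean d L g)\<^sup>2) \<le> (\<Sum>x\<in>?V. (\<Sum>v\<in>?V. (g (torus_shift d L v x) - g x)\<^sup>2) / ?n)"
    by (intro sum_mono)
  also have "\<dots> = (\<Sum>v\<in>?V. \<Sum>x\<in>?V. (g (torus_shift d L v x) - g x)\<^sup>2) / ?n"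
    by (simp add: sum_divide_distrib[symmetric]) (subst sum.swap, simp)
  also have "\<dots> \<le> (\<Sum>v\<in>?V. (real d * real L)\<^sup>2 * ?E) / ?n"
  proof (intro divide_right_mono sum_mono)
    fix v assume v: "v \<in> ?V"
    have "(\<Sum>i<d. v i) \<le> (\<Sum>i<d. L)" using torus_vertsD[OF v] by (intro sum_mono) (auto intro: less_imp_le)
    then have "(\<Sum>i<d. v i) \<le> d * L" by simp
    then have "real (\<Sum>i<d. v i) \<le> real d * real L" by (metis of_nat_le_iff of_nat_mult)
    then have "(real (\<Sum>i<d. v i))\<^sup>2 * ?E \<le> (real d * real L)\<^sup>2 * ?E"
      using unit_step_energy_nonneg by (intro mult_right_mono power_mono of_nat_0_le_iff)
    then show "(\<Sum>x\<in>?V. (g (torus_shift d L v x) - g x)\<^sup>2) \<le> (real d * real L)\<^sup>2 * ?E"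
      using shift_energy[where v = v and d = d and g = g, OF L refl] by simp
  qed (use n in auto)
  also have "\<dots> = (real d * real L)\<^sup>2 * ?E" using n by simp
  finally show ?thesis .
qed

text \<open>For \<open>L \<ge> 2\<close> distinct steps from a site lead to distinct neighbours.\<close>

lemma unit_step_energy_le_arcs:
  assumes L: "2 \<le> L"
  shows "unit_step_energy d L g \<le> (\<Sum>(x, y)\<in>arcs (torus_edges d L). (g x - g y)\<^sup>2)"
proof -
  let ?V = "torus_verts d L"
  let ?h = "\<lambda>(x, i). (x, torus_shift d L (unit_step i) x)"
  have ne: "torus_shift d L (unit_step i) x i \<noteq> x i" and oth: "\<And>j. j \<noteq> i \<Longrightarrow> torus_shift d L (unit_step i) x j = x j"
    and eqi: "torus_shift d L (unit_step i) x i = (x i + 1) mod L"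
    if "x \<in> ?V" "i < d" for x i
  proof -
    show eqi: "torus_shift d L (unit_step i) x i = (x i + 1) mod L" using that by (simp add: torus_shift_def unit_step_def)
    have "x i < L" using torus_vertsD that by auto
    then show "torus_shift d L (unit_step i) x i \<noteq> x i" unfolding eqi using L
      by (cases "x i + 1 = L") auto
    show "torus_shift d L (unit_step i) x j = x j" if "j \<noteq> i" for j
    proof (cases "j < d")
      case True then show ?thesis using that torus_vertsD[OF \<open>x \<in> ?V\<close>] by (simp add: torus_shift_def unit_step_def)
    next
      case False then show ?thesis using \<open>x \<in> ?V\<close> by (auto simp: torus_shift_def torus_verts_def PiE_def extensional_def)
    qed
  qed
  have "i = j" if "x \<in> ?V" "i < d" "j < d" "torus_shift d L (unit_step i) x = torus_shift d L (unit_step j) x" for x i j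
    using ne[OF that(1,2)] oth[OF that(1,3), of i] that(4) by metis
  then have inj: "inj_on ?h (?V \<times> {..<d})" by (auto simp: inj_on_def)
  have sub: "?h ` (?V \<times> {..<d}) \<subseteq> arcs (torus_edges d L)"
  proof clarify
    fix x i assume x: "x \<in> ?V" and i: "i < d"
    then have nx: "torus_shift d L (unit_step i) x \<noteq> x" using ne[of x i] by metis
    have "\<exists>i'<d. torus_shift d L (unit_step i) x i' = (x i' + 1) mod L \<and>
        (\<forall>j. j \<noteq> i' \<longrightarrow> torus_shift d L (unit_step i) x j = x j)"
      using eqi[OF x i] oth[OF x i] i by blast
    then have "{x, torus_shift d L (unit_step i) x} \<in> torus_edges d L"
      unfolding torus_edges_def mem_Collect_eq
      using x nx shift_in_verts[of L d "unit_step i" x] L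
      by (intro exI[of _ x] exI[of _ "torus_shift d L (unit_step i) x"] conjI) auto
    then show "(x, torus_shift d L (unit_step i) x) \<in> arcs (torus_edges d L)"
      by (simp add: arcs_def)
  qed
  have fin: "finite (arcs (torus_edges d L))"
    by (rule finite_subset[of _ "?V \<times> ?V"]) (auto simp: arcs_def torus_edges_def doubleton_eq_iff)
  have "unit_step_energy d L g = (\<Sum>(x, i)\<in>?V \<times> {..<d}. (g (torus_shift d L (unit_step i) x) - g x)\<^sup>2)"
    by (simp add: unit_step_energy_def sum.cartesian_product)
  also have "\<dots> = (\<Sum>(x, y)\<in>?h ` (?V \<times> {..<d}). (g x - g y)\<^sup>2)"
    by (subst sum.reindex[OF inj]) (auto simp: power2_commute intro!: sum.cong)
  also have "\<dots> \<le> (\<Sum>(x, y)\<in>arcs (torus_edges d L). (g x - g y)\<^sup>2)"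
    using fin sub by (intro sum_mono2) auto
  finally show ?thesis .
qed

section \<open>Layers and effective resistances\<close>

text \<open>The vectors are extensional, so that the layers below \<open>L\<close> are subsets of \<open>torus_verts d L\<close>.\<close>

definition layer :: "nat \<Rightarrow> nat \<Rightarrow> (nat \<Rightarrow> nat) set" where
  "layer d k = {v \<in> extensional {..<d}. (\<Sum>i<d. v i) = k}"

lemma layer_le: "v \<in> layer d k \<Longrightarrow> i < d \<Longrightarrow> v i \<le> k"
  unfolding layer_def by (auto intro!: member_le_sum)

lemma layer_subset_torus: "k < L \<Longrightarrow> layer d k \<subseteq> torus_verts d L"
  using layer_le by (fastforce simp: torus_verts_def layer_def PiE_def)

lemma finite_layer [simp]: "finite (layer d k)"
  using layer_subset_torus[of k "Suc k" d] by (rule finite_subset) auto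

lemma layer_disjoint: "j \<noteq> k \<Longrightarrow> layer d j \<inter> layer d k = {}"
  by (auto simp: layer_def)

lemma layer_0: "layer d 0 = {\<lambda>i\<in>{..<d}. 0}"
  by (auto simp: layer_def extensional_def fun_eq_iff)

text \<open>Raising coordinate \<open>i\<close> of \<open>v\<close> with weight \<open>v i + 1\<close> reaches every \<open>w\<close> in the next layer with total
  weight \<open>w 0 + \<dots> + w (d - 1) = k + 1\<close>. Hence the urn step, which divides by the total
  weight \<open>k + d\<close> available at \<open>v\<close>, maps the uniform distribution to the uniform distribution.\<close>

lemma layer_sum_Suc:
  fixes G :: "(nat \<Rightarrow> nat) \<Rightarrow> real"
  shows "(\<Sum>v\<in>layer d k. \<Sum>i<d. real (v i + 1) * G (v(i := v i + 1))) =
    real (k + 1) * (\<Sum>w\<in>layer d (Suc k). G w)"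
proof -
  have upd: "(\<Sum>j<d. (w(i := c)) j) + w i = (\<Sum>j<d. w j) + c" if "i < d" for w :: "nat \<Rightarrow> nat" and i c
    using that by (simp add: sum.remove[of "{..<d}" i])
  have "(\<Sum>v\<in>layer d k. \<Sum>i<d. real (v i + 1) * G (v(i := v i + 1))) =
      (\<Sum>(v, i)\<in>layer d k \<times> {..<d}. real (v i + 1) * G (v(i := v i + 1)))"
    by (simp add: sum.cartesian_product)
  also have "\<dots> = (\<Sum>(w, i)\<in>{(w, i) \<in> layer d (Suc k) \<times> {..<d}. 0 < w i}. real (w i) * G w)"
  proof (rule sum.reindex_bij_witness[where i = "\<lambda>(w, i). (w(i := w i - 1), i)"
        and j = "\<lambda>(v, i). (v(i := v i + 1), i)"]; clarsimp)
    fix v i assume "v \<in> layer d k" "i < d"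
    then show "v(i := Suc (v i)) \<in> layer d (Suc k)"
      using upd[of i v "Suc (v i)"] by (auto simp: layer_def extensional_def)
  next
    fix w i assume "w \<in> layer d (Suc k)" "i < d" "0 < w i"
    then show "w(i := w i - Suc 0) \<in> layer d k"
      using upd[of i w "w i - 1"] by (auto simp: layer_def extensional_def)
  qed
  also have "\<dots> = (\<Sum>(w, i)\<in>layer d (Suc k) \<times> {..<d}. real (w i) * G w)"
    by (intro sum.mono_neutral_left) auto
  also have "\<dots> = (\<Sum>w\<in>layer d (Suc k). real (\<Sum>i<d. w i) * G w)"
    by (simp add: sum.cartesian_product[symmetric] sum_distrib_right)
  also have "\<dots> = (\<Sum>w\<in>layer d (Suc k). real (k + 1) * G w)"
    by (intro sum.cong refl) (auto simp: layer_def)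
  finally show ?thesis by (simp add: sum_distrib_left)
qed

lemma card_layer_Suc: "(k + 1) * card (layer d (Suc k)) = (k + d) * card (layer d k)"
proof -
  have "real (k + 1) * (\<Sum>w\<in>layer d (Suc k). 1) = (\<Sum>v\<in>layer d k. \<Sum>i<d. real (v i + 1))"
    using layer_sum_Suc[where d = d and k = k and G = "\<lambda>_. 1"] by simp
  also have "\<dots> = (\<Sum>v\<in>layer d k. real ((\<Sum>i<d. v i) + d))"
    by (simp add: sum.distrib)
  also have "\<dots> = (\<Sum>v\<in>layer d k. real (k + d))"
    by (intro sum.cong refl) (auto simp: layer_def)
  finally have "real ((k + 1) * card (layer d (Suc k))) = real ((k + d) * card (layer d k))"
    by (simp add: algebra_simps)
  then show ?thesis by (simp only: of_nat_eq_iff)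
qed

lemma card_layer_pos: "1 \<le> d \<Longrightarrow> 0 < card (layer d k)"
proof (induction k)
  case (Suc k)
  then have "0 < (k + d) * card (layer d k)" by simp
  then have "0 < (k + 1) * card (layer d (Suc k))" unfolding card_layer_Suc .
  then show ?case by auto
qed (simp add: layer_0)

lemma card_layer_2: "card (layer 2 k) = k + 1"
proof (induction k)
  case (Suc k)
  then have "(k + 1) * card (layer 2 (Suc k)) = (k + 1) * (k + 2)"
    using card_layer_Suc[of k 2] by (simp add: algebra_simps)
  then show ?case by (simp only: mult_cancel1) simp
qed (simp add: layer_0)

lemma card_layer_ge_3: "3 \<le> d \<Longrightarrow> (k + 1) * (k + 2) \<le> 2 * card (layer d k)"
proof (induction k)
  case (Suc k)
  have "(k + 1) * (k + 2) * (k + 3) \<le> 2 * card (layer d k) * (k + d)"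
    using Suc.prems by (intro mult_mono[OF Suc.IH[OF Suc.prems]]) auto
  also have "\<dots> = (k + 1) * (2 * card (layer d (Suc k)))"
    unfolding mult.assoc[of "k + 1", symmetric] mult.commute[of "k + 1" 2] mult.assoc[of 2]
    unfolding card_layer_Suc by (simp add: mult.commute)
  finally have "(k + 1) * ((k + 2) * (k + 3)) \<le> (k + 1) * (2 * card (layer d (Suc k)))"
    by (simp only: mult.assoc)
  then show ?case by (simp only: mult_le_cancel1) (simp add: algebra_simps)
qed (simp add: layer_0)

definition layer_mean :: "nat \<Rightarrow> ((nat \<Rightarrow> nat) \<Rightarrow> real) \<Rightarrow> nat \<Rightarrow> real" where
  "layer_mean d G k = (\<Sum>v\<in>layer d k. G v) / card (layer d k)"

text \<open>The difference of consecutive means is an average of \<open>G (v + e) - G v\<close> over the urn step,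
  whose individual weights are at most the reciprocal of the size of the layer.\<close>

lemma layer_mean_step:
  assumes d: "1 \<le> d"
  shows "card (layer d k) * (layer_mean d G (Suc k) - layer_mean d G k)\<^sup>2
    \<le> (\<Sum>v\<in>layer d k. \<Sum>i<d. (G (v(i := v i + 1)) - G v)\<^sup>2)"
proof -
  let ?N = "real (card (layer d k))"
  have N: "0 < ?N" and N': "0 < real (card (layer d (Suc k)))" using card_layer_pos[OF d] by auto
  have kd: "0 < real (k + d)" using d by simp
  have rec: "real (k + 1) * real (card (layer d (Suc k))) = real (k + d) * ?N"
    using card_layer_Suc[of k d] by (metis of_nat_mult)
  \<comment> \<open>The uniform distribution on layer \<open>k\<close> times the urn probability of raising coordinate \<open>i\<close>.\<close>
  define w where "w v i = real (v i + 1) / (real (k + d) * ?N)" for v :: "nat \<Rightarrow> nat" and i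
  have row: "(\<Sum>i<d. real (v i + 1)) = real (k + d)" if "v \<in> layer d k" for v
  proof -
    have "(\<Sum>i<d. real (v i + 1)) = real ((\<Sum>i<d. v i) + d)" by (simp add: sum.distrib)
    moreover have "(\<Sum>i<d. v i) = k" using that by (simp add: layer_def)
    ultimately show ?thesis by (simp only:)
  qed
  have "layer_mean d G (Suc k) =
      (real (k + 1) * (\<Sum>v\<in>layer d (Suc k). G v)) / (real (k + 1) * real (card (layer d (Suc k))))"
    unfolding layer_mean_def by simp
  also have "\<dots> = (\<Sum>v\<in>layer d k. \<Sum>i<d. w v i * G (v(i := v i + 1)))"
    unfolding rec layer_sum_Suc[symmetric] w_def by (simp add: sum_divide_distrib)
  finally have 1: "layer_mean d G (Suc k) = (\<Sum>v\<in>layer d k. \<Sum>i<d. w v i * G (v(i := v i + 1)))" .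
  have "(\<Sum>v\<in>layer d k. \<Sum>i<d. w v i * G v) = (\<Sum>v\<in>layer d k. (\<Sum>i<d. real (v i + 1)) * G v / (real (k + d) * ?N))"
    unfolding w_def by (simp add: sum_divide_distrib sum_distrib_right)
  also have "\<dots> = (\<Sum>v\<in>layer d k. G v / ?N)"
    using kd by (intro sum.cong refl) (simp only: row, simp)
  also have "\<dots> = layer_mean d G k"
    unfolding layer_mean_def by (simp add: sum_divide_distrib)
  finally have 2: "layer_mean d G k = (\<Sum>v\<in>layer d k. \<Sum>i<d. w v i * G v)" by simp
  have "layer_mean d G (Suc k) - layer_mean d G k =
      (\<Sum>(v, i)\<in>layer d k \<times> {..<d}. w v i * (G (v(i := v i + 1)) - G v))"
    unfolding 1 2 sum.cartesian_product[symmetric] by (simp add: sum_subtractf right_diff_distrib)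
  also have "\<dots> = (\<Sum>z\<in>layer d k \<times> {..<d}. w (fst z) (snd z) * (G ((fst z)(snd z := fst z (snd z) + 1)) - G (fst z)))"
    by (simp add: case_prod_unfold)
  finally have step: "layer_mean d G (Suc k) - layer_mean d G k =
      (\<Sum>z\<in>layer d k \<times> {..<d}. w (fst z) (snd z) * (G ((fst z)(snd z := fst z (snd z) + 1)) - G (fst z)))" .
  have "(layer_mean d G (Suc k) - layer_mean d G k)\<^sup>2
      \<le> (\<Sum>z\<in>layer d k \<times> {..<d}. (w (fst z) (snd z))\<^sup>2) *
        (\<Sum>z\<in>layer d k \<times> {..<d}. (G ((fst z)(snd z := fst z (snd z) + 1)) - G (fst z))\<^sup>2)"
    unfolding step by (rule Cauchy_Schwarz_ineq_sum)
  also have "\<dots> = (\<Sum>v\<in>layer d k. \<Sum>i<d. (w v i)\<^sup>2) * (\<Sum>v\<in>layer d k. \<Sum>i<d. (G (v(i := v i + 1)) - G v)\<^sup>2)"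
    by (simp add: sum.cartesian_product case_prod_unfold)
  also have "\<dots> \<le> (1 / ?N) * (\<Sum>v\<in>layer d k. \<Sum>i<d. (G (v(i := v i + 1)) - G v)\<^sup>2)"
  proof (intro mult_right_mono sum_nonneg)
    have "(\<Sum>v\<in>layer d k. \<Sum>i<d. (w v i)\<^sup>2) \<le> (\<Sum>v\<in>layer d k. \<Sum>i<d. (1 / ?N) * w v i)"
    proof (intro sum_mono)
      fix v i assume v: "v \<in> layer d k" "i \<in> {..<d}"
      then have "real (v i + 1) \<le> real (k + d)" using layer_le[OF v(1), of i] d by auto
      then have "real (v i + 1) / (real (k + d) * ?N) \<le> real (k + d) / (real (k + d) * ?N)"
        using N kd by (intro divide_right_mono) auto
      then have "w v i \<le> 1 / ?N" using kd by (simp add: w_def)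
      moreover have "0 \<le> w v i" by (simp add: w_def)
      ultimately show "(w v i)\<^sup>2 \<le> (1 / ?N) * w v i"
        unfolding power2_eq_square by (rule mult_right_mono)
    qed
    also have "\<dots> = (1 / ?N) * (\<Sum>v\<in>layer d k. \<Sum>i<d. w v i * 1)"
      by (simp add: sum_distrib_left)
    also have "(\<Sum>v\<in>layer d k. \<Sum>i<d. w v i * 1) = (\<Sum>v\<in>layer d k. (\<Sum>i<d. real (v i + 1)) / (real (k + d) * ?N))"
      unfolding w_def by (simp add: sum_divide_distrib)
    also have "\<dots> = (\<Sum>v\<in>layer d k. 1 / ?N)"
      using kd by (intro sum.cong refl) (simp only: row, simp)
    also have "\<dots> = 1" using N by (auto simp: card_gt_0_iff)
    finally show "(\<Sum>v\<in>layer d k. \<Sum>i<d. (w v i)\<^sup>2) \<le> 1 / ?N" by simp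
  qed auto
  finally show ?thesis using N by (simp add: field_simps)
qed

lemma sum_layers_le:
  assumes "K \<le> L" "\<And>v. 0 \<le> H v"
  shows "(\<Sum>k<K. \<Sum>v\<in>layer d k. H v) \<le> (\<Sum>v\<in>torus_verts d L. (H v :: real))"
proof -
  have "(\<Sum>k<K. \<Sum>v\<in>layer d k. H v) = (\<Sum>v\<in>(\<Union>k<K. layer d k). H v)"
    by (rule sum.UNION_disjoint[symmetric]) (simp_all add: layer_disjoint)
  also have "\<dots> \<le> (\<Sum>v\<in>torus_verts d L. H v)"
  proof (intro sum_mono2)
    show "(\<Union>k<K. layer d k) \<subseteq> torus_verts d L"
      using assms(1) by (intro UN_least layer_subset_torus) auto
  qed (use assms in auto)
  finally show ?thesis .
qed

lemma layer_volume:
  assumes "1 \<le> d" "1 \<le> L"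
  shows "(real L / real d) ^ d \<le> (\<Sum>k<L. real (card (layer d k)))"
proof -
  \<comment> \<open>The layers below \<open>L\<close> contain a cube of side \<open>?m \<ge> L / d\<close>.\<close>
  let ?m = "(L - 1) div d + 1"
  have "L - 1 < ?m * d"
    using assms dividend_less_div_times[of d "L - 1"] by simp
  then have "L \<le> ?m * d" using assms by linarith
  then have "real L \<le> real ?m * real d" by (metis of_nat_le_iff of_nat_mult)
  then have "real L / real d \<le> real ?m" using assms by (simp add: pos_divide_le_eq)
  then have "(real L / real d) ^ d \<le> real ?m ^ d" by (intro power_mono) auto
  also have "\<dots> = real (card ({..<d} \<rightarrow>\<^sub>E {..<?m}))" by (simp add: card_PiE)
  also have "\<dots> \<le> real (card (\<Union>k<L. layer d k))"
  proof (intro of_nat_mono card_mono)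
    show "({..<d} \<rightarrow>\<^sub>E {..<?m}) \<subseteq> (\<Union>k<L. layer d k)"
    proof
      fix v assume v: "v \<in> {..<d} \<rightarrow>\<^sub>E {..<?m}"
      have "(\<Sum>i<d. v i) \<le> (\<Sum>i<d. (L - 1) div d)"
      proof (rule sum_mono)
        fix i assume "i \<in> {..<d}"
        then have "v i \<in> {..<?m}" using v by blast
        then show "v i \<le> (L - 1) div d" by simp
      qed
      also have "\<dots> \<le> L - 1" by simp
      also have "\<dots> < L" using assms by simp
      finally show "v \<in> (\<Union>k<L. layer d k)" using v by (auto simp: layer_def PiE_def)
    qed
  qed auto
  also have "card (\<Union>k<L. layer d k) = (\<Sum>k<L. card (layer d k))"
    by (rule card_UN_disjoint) (simp_all add: layer_disjoint)
  finally show ?thesis by simp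
qed

text \<open>The unit flow given by the urn has energy at most the sum of the reciprocal layer sizes; this is
  Thomson's principle for it.\<close>

lemma sum_layer_mean_diff:
  assumes d: "1 \<le> d"
  shows "(layer_mean d G K - layer_mean d G 0)\<^sup>2 \<le>
    (\<Sum>k<K. 1 / card (layer d k)) * (\<Sum>k<K. \<Sum>v\<in>layer d k. \<Sum>i<d. (G (v(i := v i + 1)) - G v)\<^sup>2)"
proof -
  let ?N = "\<lambda>k. real (card (layer d k))" and ?D = "\<lambda>k. layer_mean d G (Suc k) - layer_mean d G k"
  have N: "0 < ?N k" for k using card_layer_pos[OF d] by simp
  have cancel: "(1 / sqrt (?N k)) * (sqrt (?N k) * ?D k) = ?D k" for k
    using N[of k] by (auto simp: card_gt_0_iff)
  have "(layer_mean d G K - layer_mean d G 0)\<^sup>2 = (\<Sum>k<K. (1 / sqrt (?N k)) * (sqrt (?N k) * ?D k))\<^sup>2"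
    by (simp only: cancel sum_lessThan_telescope)
  also have "\<dots> \<le> (\<Sum>k<K. (1 / sqrt (?N k))\<^sup>2) * (\<Sum>k<K. (sqrt (?N k) * ?D k)\<^sup>2)"
    by (rule Cauchy_Schwarz_ineq_sum)
  also have "\<dots> = (\<Sum>k<K. 1 / ?N k) * (\<Sum>k<K. ?N k * (?D k)\<^sup>2)"
    by (simp add: power_mult_distrib power_divide)
  also have "\<dots> \<le> (\<Sum>k<K. 1 / ?N k) * (\<Sum>k<K. \<Sum>v\<in>layer d k. \<Sum>i<d. (G (v(i := v i + 1)) - G v)\<^sup>2)"
    by (intro mult_left_mono sum_mono layer_mean_step d sum_nonneg) auto
  finally show ?thesis .
qed

text \<open>The value at \<open>y\<close> is compared with the mean over each layer of the simplex at \<open>y\<close>, and the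
  layer means with the mean over the torus. The term with \<open>R\<close> is the effective resistance from \<open>y\<close>
  to a macroscopic set; the term with \<open>L\<^sup>2\<close> is of the order of the
  relaxation time of the random walk.\<close>

theorem torus_pinned_poincare:
  assumes d: "1 \<le> d" and L: "2 \<le> L" and y: "y \<in> torus_verts d L"
  defines "R \<equiv> (\<Sum>k<L. 1 / real (card (layer d k)))"
  shows "(\<Sum>x\<in>torus_verts d L. (g x - g y)\<^sup>2) \<le>
    ((2 + 4 * real d ^ d) * (real d * real L)\<^sup>2 + 4 * real L ^ d * R) *
    (\<Sum>(x, z)\<in>arcs (torus_edges d L). (g x - g z)\<^sup>2)"
proof -
  let ?V = "torus_verts d L" and ?E = "unit_step_energy d L g"
  let ?N = "\<lambda>k. real (card (layer d k))"
  define G where "G v = g (torus_shift d L v y)" for v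
  define m where "m = torus_mean d L g"
  define P where "P = (\<Sum>x\<in>?V. (g x - m)\<^sup>2)"
  define Z where "Z = (\<Sum>k<L. ?N k)"
  define n where "n = real L ^ d"
  have L0: "0 < L" using L by simp
  have N: "0 < ?N k" for k using card_layer_pos[OF d] by simp
  have Z: "(real L / real d) ^ d \<le> Z" unfolding Z_def using layer_volume[OF d] L by simp
  have Z0: "0 < Z" using L d by (intro less_le_trans[OF _ Z]) auto
  have n0: "0 < n" using L by (simp add: n_def)
  have E0: "0 \<le> ?E" by (rule unit_step_energy_nonneg)
  have P: "P \<le> (real d * real L)\<^sup>2 * ?E" unfolding P_def m_def by (rule torus_poincare[OF L0])
  have P0: "0 \<le> P" unfolding P_def by (intro sum_nonneg) auto
  have R0: "0 \<le> R" unfolding R_def by (intro sum_nonneg) auto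
  have nZ: "n \<le> real d ^ d * Z"
  proof -
    have "real d ^ d * (real L / real d) ^ d \<le> real d ^ d * Z" using Z by (intro mult_left_mono) auto
    then show ?thesis using d by (simp add: n_def power_divide)
  qed
  have G0: "layer_mean d G 0 = g y"
    using shift_period[OF y, of "\<lambda>i\<in>{..<d}. 0"] by (simp add: layer_mean_def layer_0 G_def)
  have mean: "(layer_mean d G k - g y)\<^sup>2 \<le> R * ?E" if k: "k < L" for k
  proof -
    have upd: "torus_shift d L (v(i := v i + 1)) y = torus_shift d L (unit_step i) (torus_shift d L v y)" for v i
      unfolding shift_shift by (auto simp: torus_shift_def unit_step_def fun_eq_iff)
    have "(\<Sum>j<k. \<Sum>v\<in>layer d j. \<Sum>i<d. (G (v(i := v i + 1)) - G v)\<^sup>2)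
        \<le> (\<Sum>v\<in>?V. \<Sum>i<d. (G (v(i := v i + 1)) - G v)\<^sup>2)"
      using k by (intro sum_layers_le sum_nonneg) auto
    also have "\<dots> = (\<Sum>v\<in>?V. (\<lambda>x. \<Sum>i<d. (g (torus_shift d L (unit_step i) x) - g x)\<^sup>2) (torus_shift d L v y))"
      by (simp only: G_def upd)
    also have "\<dots> = ?E"
      unfolding unit_step_energy_def by (rule sum_all_shifts[OF L0 y])
    finally have 1: "(\<Sum>j<k. \<Sum>v\<in>layer d j. \<Sum>i<d. (G (v(i := v i + 1)) - G v)\<^sup>2) \<le> ?E" .
    have 2: "(\<Sum>j<k. 1 / ?N j) \<le> R"
      unfolding R_def using k by (intro sum_mono2) auto
    have "(layer_mean d G k - layer_mean d G 0)\<^sup>2 \<le> R * ?E"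
      by (rule order_trans[OF sum_layer_mean_diff[OF d] mult_mono[OF 2 1]])
        (use R0 in \<open>auto intro!: sum_nonneg\<close>)
    then show ?thesis unfolding G0 .
  qed
  \<comment> \<open>Average the bound over all layers, weighted by their sizes: their union is a positive
      fraction of the torus, so the Poincare inequality controls the layer means on average.\<close>
  have pin: "Z * (g y - m)\<^sup>2 \<le> 2 * (R * ?E) * Z + 2 * P"
  proof -
    have "?N k * (g y - m)\<^sup>2 \<le> ?N k * (2 * (R * ?E)) + 2 * (\<Sum>v\<in>layer d k. (G v - m)\<^sup>2)" if k: "k < L" for k
    proof -
      have eq: "?N k * (layer_mean d G k - m) = (\<Sum>v\<in>layer d k. 1 * (G v - m))"
        using N[of k] by (simp add: layer_mean_def sum_subtractf algebra_simps)
      have "(?N k * (layer_mean d G k - m))\<^sup>2 \<le> (\<Sum>v\<in>layer d k. 1\<^sup>2) * (\<Sum>v\<in>layer d k. (G v - m)\<^sup>2)"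
        unfolding eq by (rule Cauchy_Schwarz_ineq_sum)
      then have "?N k * (?N k * (layer_mean d G k - m)\<^sup>2) \<le> ?N k * (\<Sum>v\<in>layer d k. (G v - m)\<^sup>2)"
        by (simp add: power_mult_distrib power2_eq_square algebra_simps)
      then have 1: "?N k * (layer_mean d G k - m)\<^sup>2 \<le> (\<Sum>v\<in>layer d k. (G v - m)\<^sup>2)"
        using N[of k] by simp
      have "(g y - m)\<^sup>2 \<le> 2 * (layer_mean d G k - g y)\<^sup>2 + 2 * (layer_mean d G k - m)\<^sup>2"
        using zero_le_power2[of "(layer_mean d G k - g y) + (layer_mean d G k - m)"]
        by (simp add: power2_eq_square algebra_simps)
      also have "\<dots> \<le> 2 * (R * ?E) + 2 * (layer_mean d G k - m)\<^sup>2" using mean[OF k] by simp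
      finally have "?N k * (g y - m)\<^sup>2 \<le> ?N k * (2 * (R * ?E) + 2 * (layer_mean d G k - m)\<^sup>2)"
        using N[of k] by (intro mult_left_mono) auto
      then show ?thesis using 1 by (simp add: algebra_simps)
    qed
    then have "(\<Sum>k<L. ?N k * (g y - m)\<^sup>2) \<le> (\<Sum>k<L. ?N k * (2 * (R * ?E)) + 2 * (\<Sum>v\<in>layer d k. (G v - m)\<^sup>2))"
      by (intro sum_mono) auto
    also have "\<dots> = 2 * (R * ?E) * Z + 2 * (\<Sum>k<L. \<Sum>v\<in>layer d k. (G v - m)\<^sup>2)"
      unfolding Z_def by (simp add: sum.distrib sum_distrib_left sum_distrib_right mult.commute)
    also have "(\<Sum>k<L. \<Sum>v\<in>layer d k. (G v - m)\<^sup>2) \<le> (\<Sum>v\<in>?V. (G v - m)\<^sup>2)"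
      by (intro sum_layers_le) auto
    also have "\<dots> = P"
      unfolding G_def P_def using sum_all_shifts[OF L0 y, of "\<lambda>x. (g x - m)\<^sup>2"] by simp
    finally show ?thesis by (simp add: Z_def sum_distrib_right)
  qed
  have "Z * (n * (g y - m)\<^sup>2) \<le> n * (2 * (R * ?E) * Z + 2 * P)"
    using mult_left_mono[OF pin, of n] n0 by (simp add: algebra_simps)
  also have "\<dots> \<le> 2 * n * (R * ?E) * Z + 2 * ((real d ^ d * Z) * P)"
    using mult_right_mono[OF nZ P0] by (simp add: algebra_simps)
  also have "\<dots> = Z * (2 * n * (R * ?E) + 2 * real d ^ d * P)"
    by (simp add: algebra_simps)
  finally have pin': "n * (g y - m)\<^sup>2 \<le> 2 * n * (R * ?E) + 2 * real d ^ d * P"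
    using Z0 by simp
  have "(\<Sum>x\<in>?V. (g x - g y)\<^sup>2) \<le> (\<Sum>x\<in>?V. 2 * (g x - m)\<^sup>2 + 2 * (g y - m)\<^sup>2)"
  proof (rule sum_mono)
    fix x show "(g x - g y)\<^sup>2 \<le> 2 * (g x - m)\<^sup>2 + 2 * (g y - m)\<^sup>2"
      using zero_le_power2[of "(g x - m) + (g y - m)"] by (simp add: power2_eq_square algebra_simps)
  qed
  also have "\<dots> = 2 * P + 2 * (n * (g y - m)\<^sup>2)"
    by (simp add: sum.distrib P_def sum_distrib_left card_torus_verts n_def)
  also have "\<dots> \<le> 2 * P + 2 * (2 * n * (R * ?E) + 2 * real d ^ d * P)"
    using pin' by simp
  also have "\<dots> = (2 + 4 * real d ^ d) * P + 4 * n * R * ?E" by (simp add: algebra_simps)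
  also have "\<dots> \<le> (2 + 4 * real d ^ d) * ((real d * real L)\<^sup>2 * ?E) + 4 * n * R * ?E"
    using P by (intro add_right_mono mult_left_mono) auto
  also have "\<dots> = ((2 + 4 * real d ^ d) * (real d * real L)\<^sup>2 + 4 * n * R) * ?E"
    by (simp add: algebra_simps)
  also have "\<dots> \<le> ((2 + 4 * real d ^ d) * (real d * real L)\<^sup>2 + 4 * n * R) *
      (\<Sum>(x, z)\<in>arcs (torus_edges d L). (g x - g z)\<^sup>2)"
    using n0 R0 by (intro mult_left_mono unit_step_energy_le_arcs[OF L]) auto
  finally show ?thesis by (simp add: n_def)
qed

section \<open>Reversible generators and decay of the density\<close>

text \<open>The function \<open>exp (t A) g\<close>.\<close>

definition op_exp :: "(('s \<Rightarrow> real) \<Rightarrow> 's \<Rightarrow> real) \<Rightarrow> ('s \<Rightarrow> real) \<Rightarrow> real \<Rightarrow> 's \<Rightarrow> real" where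
  "op_exp A g t x = (\<Sum>k. t ^ k / fact k * (A ^^ k) g x)"

lemma transition_prob_eq: "transition_prob A t x y = op_exp A (indicator {y}) t x"
  by (simp add: transition_prob_def op_exp_def)

text \<open>The operator acts on functions on a possibly infinite type, but on \<open>S\<close> it is the finite
  matrix \<open>Q\<close>.\<close>

locale finite_matrix =
  fixes S :: "'s set" and A :: "('s \<Rightarrow> real) \<Rightarrow> 's \<Rightarrow> real" and Q :: "'s \<Rightarrow> 's \<Rightarrow> real"
  assumes fin: "finite S" and A_eq: "\<And>f x. x \<in> S \<Longrightarrow> A f x = (\<Sum>z\<in>S. Q x z * f z)"
begin

lemma pow_bound:
  obtains B M where "0 \<le> B" "0 \<le> M" "\<And>k x. x \<in> S \<Longrightarrow> \<bar>(A ^^ k) g x\<bar> \<le> B ^ k * M"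
proof
  define B where "B = (\<Sum>x\<in>S. \<Sum>z\<in>S. \<bar>Q x z\<bar>)"
  define M where "M = (\<Sum>x\<in>S. \<bar>g x\<bar>)"
  show B: "0 \<le> B" and M: "0 \<le> M" by (auto simp: B_def M_def intro!: sum_nonneg)
  show "\<bar>(A ^^ k) g x\<bar> \<le> B ^ k * M" if "x \<in> S" for k x
    using that
  proof (induction k arbitrary: x)
    case 0
    then show ?case using fin by (auto simp: M_def intro!: member_le_sum[of _ S "\<lambda>x. \<bar>g x\<bar>"])
  next
    case (Suc k)
    have "\<bar>(A ^^ Suc k) g x\<bar> = \<bar>\<Sum>z\<in>S. Q x z * (A ^^ k) g z\<bar>"
      using A_eq[OF Suc.prems] by simp
    also have "\<dots> \<le> (\<Sum>z\<in>S. \<bar>Q x z\<bar> * (B ^ k * M))"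
      by (rule order_trans[OF sum_abs], rule sum_mono) (auto simp: abs_mult intro!: mult_left_mono Suc.IH)
    also have "\<dots> = (\<Sum>z\<in>S. \<bar>Q x z\<bar>) * (B ^ k * M)" by (simp add: sum_distrib_right)
    also have "\<dots> \<le> B * (B ^ k * M)"
      unfolding B_def using B M Suc.prems fin
      by (intro mult_right_mono member_le_sum[of x S "\<lambda>x. \<Sum>z\<in>S. \<bar>Q x z\<bar>"])
        (auto intro!: sum_nonneg simp: B_def[symmetric])
    finally show ?case by simp
  qed
qed

lemma summable_op_exp:
  assumes "x \<in> S"
  shows "summable (\<lambda>k. (A ^^ k) g x / fact k * t ^ k)"
proof -
  obtain B M where BM: "0 \<le> B" "0 \<le> M" "\<And>k x. x \<in> S \<Longrightarrow> \<bar>(A ^^ k) g x\<bar> \<le> B ^ k * M"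
    using pow_bound[of g] by metis
  have "summable (\<lambda>k. M * ((B * \<bar>t\<bar>) ^ k / fact k))"
    using summable_exp[of "B * \<bar>t\<bar>"] by (intro summable_mult) (simp add: divide_inverse mult.commute)
  then show ?thesis
  proof (rule summable_comparison_test'[where N = 0])
    fix k
    have "\<bar>(A ^^ k) g x\<bar> * \<bar>t\<bar> ^ k \<le> B ^ k * M * \<bar>t\<bar> ^ k"
      using BM(3)[OF assms] by (intro mult_right_mono) auto
    then have "\<bar>(A ^^ k) g x\<bar> * \<bar>t\<bar> ^ k / fact k \<le> B ^ k * M * \<bar>t\<bar> ^ k / fact k"
      by (rule divide_right_mono) simp
    then show "norm ((A ^^ k) g x / fact k * t ^ k) \<le> M * ((B * \<bar>t\<bar>) ^ k / fact k)"
      by (simp add: abs_mult power_abs power_mult_distrib mult_ac)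
  qed
qed

lemma op_exp_eq: "op_exp A g t x = (\<Sum>k. (A ^^ k) g x / fact k * t ^ k)"
  unfolding op_exp_def by (simp add: mult.commute)

lemma op_exp_0: "op_exp A g 0 x = g x"
  unfolding op_exp_eq powser_zero by simp

lemma op_exp_deriv:
  assumes x: "x \<in> S"
  shows "((\<lambda>t. op_exp A g t x) has_real_derivative A (op_exp A g t) x) (at t)"
proof -
  define c where "c k = (A ^^ k) g x / fact k" for k
  have "((\<lambda>t. \<Sum>k. c k * t ^ k) has_real_derivative (\<Sum>k. diffs c k * t ^ k)) (at t)"
    unfolding c_def by (intro termdiffs_strong_converges_everywhere summable_op_exp x)
  moreover have "(\<Sum>k. diffs c k * t ^ k) = A (op_exp A g t) x"
  proof -
    have "diffs c k * t ^ k = (\<Sum>z\<in>S. Q x z * ((A ^^ k) g z / fact k * t ^ k))" for k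
    proof -
      have "diffs c k = (A ^^ Suc k) g x / fact k"
        unfolding diffs_def c_def by (simp add: fact_Suc del: funpow.simps of_nat_Suc)
      also have "\<dots> = (\<Sum>z\<in>S. Q x z * (A ^^ k) g z) / fact k"
        using A_eq[OF x] by simp
      finally show ?thesis by (simp add: sum_divide_distrib sum_distrib_right mult.assoc)
    qed
    then have "(\<Sum>k. diffs c k * t ^ k) = (\<Sum>k. \<Sum>z\<in>S. Q x z * ((A ^^ k) g z / fact k * t ^ k))"
      by simp
    also have "\<dots> = (\<Sum>z\<in>S. \<Sum>k. Q x z * ((A ^^ k) g z / fact k * t ^ k))"
      by (intro suminf_sum summable_mult summable_op_exp) auto
    also have "\<dots> = (\<Sum>z\<in>S. Q x z * op_exp A g t z)"
      unfolding op_exp_eq by (intro sum.cong refl suminf_mult summable_op_exp)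
    finally show ?thesis using A_eq[OF x] by simp
  qed
  ultimately show ?thesis unfolding op_exp_eq c_def by simp
qed

end

locale reversible_generator = finite_matrix +
  fixes \<mu> :: "'a \<Rightarrow> real"
  assumes mu_pos: "\<And>x. x \<in> S \<Longrightarrow> 0 < \<mu> x"
    and mu_sum: "(\<Sum>x\<in>S. \<mu> x) = 1"
    and Q_nonneg: "\<And>x z. x \<in> S \<Longrightarrow> z \<in> S \<Longrightarrow> x \<noteq> z \<Longrightarrow> 0 \<le> Q x z"
    and Q_row: "\<And>x. x \<in> S \<Longrightarrow> (\<Sum>z\<in>S. Q x z) = 0"
    and sym: "\<And>f g. (\<Sum>x\<in>S. \<mu> x * (A f x * g x)) = (\<Sum>x\<in>S. \<mu> x * (f x * A g x))"
    and dirichlet_nonneg: "\<And>f. (\<Sum>x\<in>S. \<mu> x * (f x * A f x)) \<le> 0"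
begin

lemma A_const: "x \<in> S \<Longrightarrow> A (\<lambda>_. 1) x = 0"
  using Q_row[of x] by (simp add: A_eq)

lemma A_sum_zero: "(\<Sum>x\<in>S. \<mu> x * A f x) = 0"
  using sym[of f "\<lambda>_. 1"] by (simp add: A_const)

lemma pow_sym: "(\<Sum>x\<in>S. \<mu> x * ((A ^^ k) f x * g x)) = (\<Sum>x\<in>S. \<mu> x * (f x * (A ^^ k) g x))"
proof (induction k arbitrary: g)
  case (Suc k)
  have "(\<Sum>x\<in>S. \<mu> x * ((A ^^ Suc k) f x * g x)) = (\<Sum>x\<in>S. \<mu> x * (f x * (A ^^ k) (A g) x))"
    using sym[of "(A ^^ k) f" g] Suc.IH[of "A g"] by simp
  then show ?case by (simp add: funpow_swap1)
qed simp

text \<open>By reversibility the density at time \<open>t\<close>, as a function of the final state, is itself a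
  solution of the backward equation, started from the density of the point mass at \<open>x\<close>.\<close>

lemma transition_reversible:
  assumes "x \<in> S" "y \<in> S"
  shows "transition_prob A t x y / \<mu> y = op_exp A (\<lambda>z. indicator {x} z / \<mu> x) t y"
proof -
  have pick: "(\<Sum>z\<in>S. \<mu> z * (indicator {w} z * h z)) = \<mu> w * h w"
    if "w \<in> S" for w and h :: "'a \<Rightarrow> real"
  proof -
    have "(\<Sum>z\<in>S. \<mu> z * (indicator {w} z * h z)) = (\<Sum>z\<in>S. if z = w then \<mu> w * h w else 0)"
      by (intro sum.cong) auto
    then show ?thesis using that fin by simp
  qed
  have pick': "(\<Sum>z\<in>S. \<mu> z * (h z * indicator {w} z)) = \<mu> w * h w"
    if "w \<in> S" for w and h :: "'a \<Rightarrow> real"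
    using pick[OF that, of h] by (simp add: mult.commute)
  have lin: "z \<in> S \<Longrightarrow> (A ^^ k) (\<lambda>z. indicator {x} z / \<mu> x) z = (A ^^ k) (indicator {x}) z / \<mu> x" for k z
    by (induction k arbitrary: z) (auto simp: A_eq sum_divide_distrib intro!: sum.cong)
  have "\<mu> x * (A ^^ k) (indicator {y}) x = \<mu> y * (A ^^ k) (indicator {x}) y" for k
    using pow_sym[of k "indicator {y}" "indicator {x}"] assms by (simp only: pick pick')
  then have eq: "(A ^^ k) (indicator {y}) x / \<mu> y = (A ^^ k) (\<lambda>z. indicator {x} z / \<mu> x) y" for k
    using mu_pos[OF assms(1)] mu_pos[OF assms(2)] unfolding lin[OF assms(2)]
    by (simp add: field_simps)
  have "transition_prob A t x y / \<mu> y = (\<Sum>k. (A ^^ k) (indicator {y}) x / fact k * t ^ k / \<mu> y)"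
    unfolding transition_prob_eq op_exp_eq
    by (rule suminf_divide[symmetric]) (rule summable_op_exp[OF assms(1)])
  also have "\<dots> = (\<Sum>k. (A ^^ k) (\<lambda>z. indicator {x} z / \<mu> x) y / fact k * t ^ k)"
    unfolding eq[symmetric] by (simp add: mult_ac)
  finally show ?thesis unfolding op_exp_eq .
qed

lemma energy_deriv:
  assumes "\<And>x. x \<in> S \<Longrightarrow> ((\<lambda>t. u t x) has_real_derivative A (u t) x) (at t)"
  shows "((\<lambda>t. \<Sum>x\<in>S. \<mu> x * (u t x)\<^sup>2) has_real_derivative 2 * (\<Sum>x\<in>S. \<mu> x * (u t x * A (u t) x))) (at t)"
proof -
  have "((\<lambda>t. \<Sum>x\<in>S. \<mu> x * (u t x)\<^sup>2) has_real_derivative (\<Sum>x\<in>S. \<mu> x * (2 * u t x * A (u t) x))) (at t)"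
    by (auto intro!: derivative_eq_intros DERIV_sum assms simp: mult_ac)
  then show ?thesis by (simp add: sum_distrib_left mult_ac)
qed

text \<open>The \<open>L\<^sup>2\<close> norm of a solution does not increase.\<close>

lemma solution_unique_zero:
  assumes d: "\<And>t x. x \<in> S \<Longrightarrow> ((\<lambda>t. u t x) has_real_derivative A (u t) x) (at t)"
    and z: "\<And>x. x \<in> S \<Longrightarrow> u 0 x = 0" and t: "0 \<le> t" and x: "x \<in> S"
  shows "u t x = 0"
proof -
  let ?U = "\<lambda>t. \<Sum>x\<in>S. \<mu> x * (u t x)\<^sup>2"
  have "?U t \<le> ?U 0"
  proof (rule DERIV_nonpos_imp_nonincreasing[OF t])
    fix s
    have "2 * (\<Sum>x\<in>S. \<mu> x * (u s x * A (u s) x)) \<le> 0"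
      using dirichlet_nonneg[of "u s"] by simp
    then show "\<exists>D. (?U has_real_derivative D) (at s) \<and> D \<le> 0"
      using energy_deriv[of u s, OF d] by blast
  qed
  also have "?U 0 = 0" using z by simp
  finally have "?U t \<le> 0" .
  then have "?U t = 0" by (intro antisym sum_nonneg) (auto intro!: mult_nonneg_nonneg less_imp_le[OF mu_pos])
  then have "\<mu> x * (u t x)\<^sup>2 = 0"
    using x fin by (subst (asm) sum_nonneg_eq_0_iff) (auto intro!: mult_nonneg_nonneg less_imp_le[OF mu_pos])
  then show ?thesis using mu_pos[OF x] by simp
qed

lemma op_exp_nonneg:
  assumes g: "\<And>x. x \<in> S \<Longrightarrow> 0 \<le> g x" and t: "0 \<le> t" and x: "x \<in> S"
  shows "0 \<le> op_exp A g t x"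
proof -
  \<comment> \<open>Adding a large multiple of the identity makes all entries nonnegative, so that the
      exponential series has nonnegative terms.\<close>
  define c where "c = (\<Sum>x\<in>S. \<bar>Q x x\<bar>)"
  define Q' where "Q' x z = Q x z + (if z = x then c else 0)" for x z
  define A' where "A' f x = (\<Sum>z\<in>S. Q' x z * f z)" for f x
  have c: "- Q x x \<le> c" if "x \<in> S" for x
    using member_le_sum[of x S "\<lambda>x. \<bar>Q x x\<bar>"] that fin unfolding c_def by auto
  have Q': "0 \<le> Q' x z" if "x \<in> S" "z \<in> S" for x z
    using that Q_nonneg[of x z] c[of x] by (auto simp: Q'_def)
  interpret M: finite_matrix S A' Q' by unfold_locales (auto simp: fin A'_def)
  have A': "A' f x = A f x + c * f x" if "x \<in> S" for f x
    using that fin by (simp add: A'_def Q'_def A_eq distrib_right sum.distrib if_distrib[of "\<lambda>q. q * _"] cong: if_cong)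
  have pow: "x \<in> S \<Longrightarrow> 0 \<le> (A' ^^ k) g x" for k x
    by (induction k arbitrary: x) (auto simp: A'_def g intro!: sum_nonneg mult_nonneg_nonneg Q')
  have pos: "0 \<le> op_exp A' g t x"
    unfolding M.op_exp_eq using t x pow by (intro suminf_nonneg M.summable_op_exp) auto
  \<comment> \<open>Both terms solve the same initial value problem, the shift by \<open>c\<close> being undone by the
      exponential factor.\<close>
  let ?u = "\<lambda>t x. op_exp A g t x - exp (- c * t) * op_exp A' g t x"
  have "?u t x = 0"
  proof (rule solution_unique_zero[OF _ _ t x])
    fix t x assume x: "x \<in> S"
    have "A (?u t) x = A (op_exp A g t) x - exp (- c * t) * A (op_exp A' g t) x"
      using x by (simp add: A_eq right_diff_distrib sum_subtractf sum_distrib_left mult_ac)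
    also have "\<dots> = A (op_exp A g t) x - (exp (- c * t) * A' (op_exp A' g t) x - c * exp (- c * t) * op_exp A' g t x)"
      using x by (simp add: A' algebra_simps)
    finally show "((\<lambda>t. ?u t x) has_real_derivative A (?u t) x) (at t)"
      by (auto intro!: derivative_eq_intros op_exp_deriv[OF x] M.op_exp_deriv[OF x])
  next
    fix x show "?u 0 x = 0" by (simp add: op_exp_0 M.op_exp_0)
  qed
  then show ?thesis using pos by simp
qed

lemma density_mass:
  assumes t: "0 \<le> t"
  shows "(\<Sum>x\<in>S. \<mu> x * op_exp A g t x) = (\<Sum>x\<in>S. \<mu> x * g x)"
proof -
  have d: "((\<lambda>t. \<Sum>x\<in>S. \<mu> x * op_exp A g t x) has_real_derivative 0) (at t)" for t
  proof -
    have "((\<lambda>t. \<Sum>x\<in>S. \<mu> x * op_exp A g t x) has_real_derivative (\<Sum>x\<in>S. \<mu> x * A (op_exp A g t) x)) (at t)"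
      by (auto intro!: derivative_eq_intros DERIV_sum op_exp_deriv)
    then show ?thesis by (simp add: A_sum_zero)
  qed
  then have "(\<Sum>x\<in>S. \<mu> x * op_exp A g t x) = (\<Sum>x\<in>S. \<mu> x * op_exp A g 0 x)"
    by (intro DERIV_isconst_all) auto
  then show ?thesis by (simp add: op_exp_0)
qed

text \<open>From \<open>ln s \<ge> 1 - 1 / s\<close> with \<open>s = u / U\<close>: since \<open>u\<close> has mean one, \<open>\<mu>(u\<^sup>2 ln (u / U)) \<ge> 0\<close>.\<close>

lemma entropy_ge:
  assumes u: "\<And>x. x \<in> S \<Longrightarrow> 0 \<le> u x" and m: "(\<Sum>x\<in>S. \<mu> x * u x) = 1"
  defines "U \<equiv> (\<Sum>x\<in>S. \<mu> x * (u x)\<^sup>2)"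
  shows "U * ln U \<le> (\<Sum>x\<in>S. \<mu> x * ((u x)\<^sup>2 * ln ((u x)\<^sup>2 / U)))" "1 \<le> U"
proof -
  have "0 \<le> (\<Sum>x\<in>S. \<mu> x * (u x - 1)\<^sup>2)"
    by (intro sum_nonneg mult_nonneg_nonneg less_imp_le[OF mu_pos]) auto
  also have "\<dots> = U - 2 * (\<Sum>x\<in>S. \<mu> x * u x) + (\<Sum>x\<in>S. \<mu> x)"
    unfolding U_def by (simp add: power2_eq_square algebra_simps sum.distrib sum_subtractf sum_distrib_left)
  finally show U: "1 \<le> U" using m mu_sum by simp
  have pt: "(u x)\<^sup>2 * ln U + 2 * ((u x)\<^sup>2 - U * u x) \<le> (u x)\<^sup>2 * ln ((u x)\<^sup>2 / U)" if x: "x \<in> S" for x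
  proof (cases "u x = 0")
    case False
    then have ux: "0 < u x" using u[OF x] by simp
    have "ln (U / u x) \<le> U / u x - 1" using U ux by (intro ln_le_minus_one) auto
    then have "ln U - ln (u x) \<le> U / u x - 1" using U ux by (simp add: ln_div)
    then have "2 * (u x)\<^sup>2 * (ln U - ln (u x)) \<le> 2 * (u x)\<^sup>2 * (U / u x - 1)"
      by (intro mult_left_mono) auto
    also have "\<dots> = 2 * (U * u x - (u x)\<^sup>2)" using ux by (simp add: field_simps power2_eq_square)
    finally show ?thesis using U ux by (simp add: ln_div ln_realpow algebra_simps)
  qed simp
  have "U * ln U = (\<Sum>x\<in>S. \<mu> x * ((u x)\<^sup>2 * ln U + 2 * ((u x)\<^sup>2 - U * u x)))"
  proof -
    have "(\<Sum>x\<in>S. \<mu> x * ((u x)\<^sup>2 * ln U + 2 * ((u x)\<^sup>2 - U * u x))) =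
      (\<Sum>x\<in>S. \<mu> x * (u x)\<^sup>2) * ln U + 2 * ((\<Sum>x\<in>S. \<mu> x * (u x)\<^sup>2) - U * (\<Sum>x\<in>S. \<mu> x * u x))"
      by (simp add: algebra_simps sum.distrib sum_subtractf sum_distrib_left sum_distrib_right)
    then show ?thesis using m by (simp add: U_def[symmetric])
  qed
  also have "\<dots> \<le> (\<Sum>x\<in>S. \<mu> x * ((u x)\<^sup>2 * ln ((u x)\<^sup>2 / U)))"
    by (intro sum_mono mult_left_mono pt less_imp_le[OF mu_pos])
  finally show "U * ln U \<le> (\<Sum>x\<in>S. \<mu> x * ((u x)\<^sup>2 * ln ((u x)\<^sup>2 / U)))" .
qed

text \<open>Here \<open>U\<close> has derivative \<open>- 2 D(u)\<close>, and the logarithmic Sobolev inequality together with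
  \<open>entropy_ge\<close> bounds this by \<open>- (2 / C) U ln U\<close>. Initially \<open>U = 1 / \<mu> x\<close>.\<close>

lemma log_sobolev_L2_decay:
  assumes C: "0 < C"
    and LS: "\<And>f. (\<Sum>x\<in>S. \<mu> x * ((f x)\<^sup>2 * ln ((f x)\<^sup>2 / (\<Sum>z\<in>S. \<mu> z * (f z)\<^sup>2)))) \<le>
       C * - (\<Sum>x\<in>S. \<mu> x * (f x * A f x))"
    and x: "x \<in> S" and t: "0 \<le> t"
  defines "u \<equiv> op_exp A (\<lambda>z. indicator {x} z / \<mu> x)"
  shows "ln (\<Sum>y\<in>S. \<mu> y * (u t y)\<^sup>2) \<le> exp (- 2 * t / C) * ln (1 / \<mu> x)"
    and "1 \<le> (\<Sum>y\<in>S. \<mu> y * (u t y)\<^sup>2)"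
    and "(\<Sum>y\<in>S. \<mu> y * (u t y - 1)\<^sup>2) = (\<Sum>y\<in>S. \<mu> y * (u t y)\<^sup>2) - 1"
proof -
  let ?U = "\<lambda>t. \<Sum>y\<in>S. \<mu> y * (u t y)\<^sup>2"
  have mx: "0 < \<mu> x" by (rule mu_pos[OF x])
  have one: "(\<Sum>z\<in>S. \<mu> z * (indicator {x} z / \<mu> x)) = 1"
  proof -
    have "(\<Sum>z\<in>S. \<mu> z * (indicator {x} z / \<mu> x)) = (\<Sum>z\<in>S. if z = x then 1 else 0)"
      using mx by (intro sum.cong) auto
    then show ?thesis using x fin by simp
  qed
  have mass: "(\<Sum>y\<in>S. \<mu> y * u t y) = 1" if "0 \<le> t" for t
    unfolding u_def density_mass[OF that] by (rule one)
  have nonneg: "0 \<le> u t y" if "0 \<le> t" "y \<in> S" for t y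
    unfolding u_def using mx that by (intro op_exp_nonneg) auto
  note ent = entropy_ge[OF nonneg mass]
  show U1: "1 \<le> ?U t" using ent(2)[OF t _ t] by simp
  have "(\<Sum>y\<in>S. \<mu> y * (u t y - 1)\<^sup>2) = ?U t - 2 * (\<Sum>y\<in>S. \<mu> y * u t y) + (\<Sum>y\<in>S. \<mu> y)"
    by (simp add: power2_eq_square algebra_simps sum.distrib sum_subtractf sum_distrib_left)
  then show "(\<Sum>y\<in>S. \<mu> y * (u t y - 1)\<^sup>2) = ?U t - 1" using mass[OF t] mu_sum by simp
  have U0: "?U 0 = 1 / \<mu> x"
  proof -
    have "?U 0 = (\<Sum>y\<in>S. if y = x then 1 / \<mu> x else 0)"
      unfolding u_def op_exp_0 using mx by (intro sum.cong refl) (auto simp: power2_eq_square)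
    then show ?thesis using x fin by simp
  qed
  \<comment> \<open>The differential inequality \<open>(ln U)' \<le> - (2 / C) ln U\<close> says that \<open>?W\<close> decreases.\<close>
  let ?W = "\<lambda>t. exp (2 * t / C) * ln (?U t)"
  have "?W t \<le> ?W 0"
  proof (rule DERIV_nonpos_imp_nonincreasing[OF t])
    fix s assume s: "0 \<le> s" "s \<le> t"
    have Us: "1 \<le> ?U s" using ent(2)[OF s(1) _ s(1)] by simp
    let ?D = "(\<Sum>y\<in>S. \<mu> y * (u s y * A (u s) y))"
    have dU: "(?U has_real_derivative 2 * ?D) (at s)"
      unfolding u_def by (intro energy_deriv op_exp_deriv)
    have "?U s * ln (?U s) \<le> C * - ?D"
      using order_trans[OF ent(1)[OF s(1) _ s(1)] LS] by simp
    then have key: "2 / C * ln (?U s) + 2 * ?D / ?U s \<le> 0"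
      using C Us by (simp add: field_simps)
    have "((\<lambda>r. ln (?U r)) has_real_derivative 1 / ?U s * (2 * ?D)) (at s)"
      using Us by (intro DERIV_chain2[OF DERIV_ln_divide dU]) simp
    moreover have "((\<lambda>r. exp (2 * r / C)) has_real_derivative exp (2 * s / C) * (2 / C)) (at s)"
      using C by (auto intro!: derivative_eq_intros)
    ultimately have "((\<lambda>r. exp (2 * r / C) * ln (?U r)) has_real_derivative
        exp (2 * s / C) * (2 / C) * ln (?U s) + 1 / ?U s * (2 * ?D) * exp (2 * s / C)) (at s)"
      by (rule DERIV_mult[rotated])
    then have "(?W has_real_derivative exp (2 * s / C) * (2 / C * ln (?U s) + 2 * ?D / ?U s)) (at s)"
      by (simp add: algebra_simps)
    moreover have "exp (2 * s / C) * (2 / C * ln (?U s) + 2 * ?D / ?U s) \<le> 0"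
      using key by (simp add: mult_le_0_iff)
    ultimately show "\<exists>D. (?W has_real_derivative D) (at s) \<and> D \<le> 0" by blast
  qed
  then have "exp (2 * t / C) * ln (?U t) \<le> ln (1 / \<mu> x)" by (simp add: U0)
  then have "exp (- 2 * t / C) * (exp (2 * t / C) * ln (?U t)) \<le> exp (- 2 * t / C) * ln (1 / \<mu> x)"
    by (intro mult_left_mono) auto
  then show "ln (?U t) \<le> exp (- 2 * t / C) * ln (1 / \<mu> x)"
    by (simp add: mult.assoc[symmetric] exp_add[symmetric])
qed

end

section \<open>The FA-1f generator\<close>

lemma sum_pmf_bernoulli_plus:
  assumes "finite V" "V \<noteq> {}" "0 < p" "p < 1"
  shows "(\<Sum>\<eta>\<in>Omega_plus V. pmf (bernoulli_plus V p) \<eta> * h \<eta>) =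
    bexp p V (\<lambda>S. of_bool (S \<noteq> {}) * h (\<lambda>x. x \<in> S)) / (1 - (1 - p) ^ card V)"
proof -
  have "(\<Sum>\<eta>\<in>Omega_plus V. pmf (bernoulli_plus V p) \<eta> * h \<eta>) = measure_pmf.expectation (bernoulli_plus V p) h"
    using assms by (subst integral_measure_pmf_real[where A = "Omega_plus V"])
      (auto simp: finite_Omega_plus set_bernoulli_plus mult.commute)
  then show ?thesis using expectation_bernoulli_plus[OF assms] by simp
qed

lemma bexp_split_site:
  assumes "finite V" "x \<in> V"
  shows "bexp p V F = bexp p (V - {x}) (\<lambda>U. (1 - p) * F U + p * F (insert x U))"
proof -
  have "bexp p V F = bexp p (insert x (V - {x})) F" using assms by (simp add: insert_absorb)
  also have "\<dots> = bexp p (V - {x}) (\<lambda>U. (1 - p) * F U + p * F (insert x U))"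
    using assms by (subst bexp_insert) (auto simp: bexp_add bexp_cmult)
  finally show ?thesis .
qed

definition plus_mass :: "'v set \<Rightarrow> real \<Rightarrow> real" where
  "plus_mass V p = 1 - (1 - p) ^ card V"

lemma plus_mass_pos:
  assumes "finite V" "V \<noteq> {}" "0 < p" "p < 1"
  shows "0 < plus_mass V p"
  using assms by (auto simp: plus_mass_def card_gt_0_iff intro!: power_less_one_iff[THEN iffD2])

lemma cbsep_dirichlet_eq:
  assumes V: "finite V" "V \<noteq> {}" and p: "0 < p" "p < 1"
  shows "cbsep_dirichlet V E p f =
    (\<Sum>e\<in>E. cbsep_edge V p (\<lambda>S. f (\<lambda>x. x \<in> S)) e) / plus_mass V p"
proof -
  have ov: "override_on (\<lambda>x. x \<in> S) \<sigma> e = (\<lambda>x. x \<in> (S - e) \<union> {v. \<sigma> v} \<inter> e)" for S \<sigma> and e :: "'a set"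
    by (auto simp: override_on_def fun_eq_iff)
  have "measure_pmf.expectation (bernoulli_plus V p) (\<lambda>\<eta>. of_bool (\<exists>x\<in>e. \<eta> x) *
      measure_pmf.variance (bernoulli_plus e p) (\<lambda>\<sigma>. f (override_on \<eta> \<sigma> e))) =
      cbsep_edge V p (\<lambda>S. f (\<lambda>x. x \<in> S)) e / plus_mass V p" for e
    unfolding expectation_bernoulli_plus[OF V p] cbsep_edge_def plus_mass_def ov
    by (intro arg_cong2[where f = "(/)"] bexp_cong refl) auto
  then show ?thesis by (simp add: cbsep_dirichlet_def sum_divide_distrib)
qed

lemma entropy_eq_plus_entropy:
  assumes V: "finite V" "V \<noteq> {}" and p: "0 < p" "p < 1"
  shows "measure_pmf.expectation (bernoulli_plus V p) (\<lambda>x. (f x)\<^sup>2 *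
      ln ((f x)\<^sup>2 / measure_pmf.expectation (bernoulli_plus V p) (\<lambda>z. (f z)\<^sup>2))) =
    plus_entropy V p (\<lambda>S. f (\<lambda>x. x \<in> S)) / plus_mass V p"
  unfolding expectation_bernoulli_plus[OF V p] plus_entropy_def plus_mass_def Let_def ..

text \<open>A graph without loops, for which flips at \<open>x\<close> do not affect the constraint at \<open>x\<close>.\<close>

locale fa_setting =
  fixes V :: "'v set" and E :: "'v set set" and p :: real
  assumes V: "finite V" "V \<noteq> {}" and E: "\<And>e. e \<in> E \<Longrightarrow> e \<subseteq> V \<and> card e = 2" and p: "0 < p" "p < 1"
begin

abbreviation "con x S \<equiv> fa_constraint E x (\<lambda>v. v \<in> S)"

lemma no_loop: "{x, x} \<notin> E" using E[of "{x, x}"] by auto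

lemma con_insert: "con x (insert x U) = con x U"
  using no_loop[of x] by (auto simp: fa_constraint_def)

lemma con_nonempty: "con x U \<Longrightarrow> U \<noteq> {}"
  by (auto simp: fa_constraint_def)

lemma upd_member:
  assumes "x \<notin> U"
  shows "(\<lambda>v. v \<in> U)(x := True) = (\<lambda>v. v \<in> insert x U)" "(\<lambda>v. v \<in> U)(x := False) = (\<lambda>v. v \<in> U)"
    "(\<lambda>v. v \<in> insert x U)(x := True) = (\<lambda>v. v \<in> insert x U)" "(\<lambda>v. v \<in> insert x U)(x := False) = (\<lambda>v. v \<in> U)"
  using assms by (auto simp: fun_eq_iff)

text \<open>The polarised FA-1f Dirichlet form. Its symmetry is the reversibility of the generator.\<close>

definition fa_bilinear :: "(('v \<Rightarrow> bool) \<Rightarrow> real) \<Rightarrow> (('v \<Rightarrow> bool) \<Rightarrow> real) \<Rightarrow> real" where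
  "fa_bilinear f g = (\<Sum>x\<in>V. bexp p (V - {x}) (\<lambda>U. p * (1 - p) * (of_bool (con x U) *
      ((f (\<lambda>v. v \<in> insert x U) - f (\<lambda>v. v \<in> U)) * (g (\<lambda>v. v \<in> insert x U) - g (\<lambda>v. v \<in> U)))))) / plus_mass V p"

lemma generator_bilinear:
  "(\<Sum>\<eta>\<in>Omega_plus V. pmf (bernoulli_plus V p) \<eta> * (fa_generator V E p f \<eta> * g \<eta>)) = - fa_bilinear f g"
proof -
  let ?h = "\<lambda>x \<eta>. of_bool (fa_constraint E x \<eta>) * (p * f (\<eta>(x := True)) + (1 - p) * f (\<eta>(x := False)) - f \<eta>) * g \<eta>"
  have gen: "fa_generator V E p f \<eta> * g \<eta> = (\<Sum>x\<in>V. ?h x \<eta>)" for \<eta>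
    unfolding fa_generator_def sum_distrib_right using p by (intro sum.cong refl) simp
  have "bexp p V (\<lambda>S. of_bool (S \<noteq> {}) * (fa_generator V E p f (\<lambda>x. x \<in> S) * g (\<lambda>x. x \<in> S))) =
      (\<Sum>x\<in>V. bexp p V (\<lambda>S. of_bool (S \<noteq> {}) * ?h x (\<lambda>v. v \<in> S)))"
    unfolding gen sum_distrib_left bexp_sum ..
  also have "\<dots> = (\<Sum>x\<in>V. - bexp p (V - {x}) (\<lambda>U. p * (1 - p) * (of_bool (con x U) *
      ((f (\<lambda>v. v \<in> insert x U) - f (\<lambda>v. v \<in> U)) * (g (\<lambda>v. v \<in> insert x U) - g (\<lambda>v. v \<in> U))))))"
  proof (intro sum.cong refl)
    fix x assume x: "x \<in> V"
    have "bexp p V (\<lambda>S. of_bool (S \<noteq> {}) * ?h x (\<lambda>v. v \<in> S)) = bexp p (V - {x}) (\<lambda>U. (- 1) * (p * (1 - p) * (of_bool (con x U) *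
      ((f (\<lambda>v. v \<in> insert x U) - f (\<lambda>v. v \<in> U)) * (g (\<lambda>v. v \<in> insert x U) - g (\<lambda>v. v \<in> U))))))"
      unfolding bexp_split_site[OF V(1) x]
    proof (intro bexp_cong)
      fix U assume "U \<subseteq> V - {x}"
      then have xU: "x \<notin> U" by auto
      show "(1 - p) * (of_bool (U \<noteq> {}) * ?h x (\<lambda>v. v \<in> U)) + p * (of_bool (insert x U \<noteq> {}) * ?h x (\<lambda>v. v \<in> insert x U)) =
        (- 1) * (p * (1 - p) * (of_bool (con x U) *
      ((f (\<lambda>v. v \<in> insert x U) - f (\<lambda>v. v \<in> U)) * (g (\<lambda>v. v \<in> insert x U) - g (\<lambda>v. v \<in> U)))))"
        unfolding upd_member[OF xU] con_insert
        using con_nonempty[of x U] by (cases "con x U") (simp_all add: algebra_simps)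
    qed
    then show "bexp p V (\<lambda>S. of_bool (S \<noteq> {}) * ?h x (\<lambda>v. v \<in> S)) = - bexp p (V - {x}) (\<lambda>U. p * (1 - p) * (of_bool (con x U) *
      ((f (\<lambda>v. v \<in> insert x U) - f (\<lambda>v. v \<in> U)) * (g (\<lambda>v. v \<in> insert x U) - g (\<lambda>v. v \<in> U)))))"
      unfolding bexp_cmult[of p "V - {x}" "- 1"] by simp
  qed
  finally show ?thesis
    unfolding sum_pmf_bernoulli_plus[OF V p] fa_bilinear_def plus_mass_def[symmetric]
    by (simp add: sum_negf)
qed

lemma fa_dirichlet_bilinear: "fa_dirichlet V E p f = fa_bilinear f f"
proof -
  have "measure_pmf.expectation (bernoulli_plus V p)
        (\<lambda>\<eta>. of_bool (fa_constraint E x \<eta>) * (p * (1 - p) * (f (\<eta>(x := \<not> \<eta> x)) - f \<eta>)\<^sup>2)) =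
      bexp p (V - {x}) (\<lambda>U. p * (1 - p) * (of_bool (con x U) *
      ((f (\<lambda>v. v \<in> insert x U) - f (\<lambda>v. v \<in> U)) * (f (\<lambda>v. v \<in> insert x U) - f (\<lambda>v. v \<in> U))))) / plus_mass V p"
    if x: "x \<in> V" for x
    unfolding expectation_bernoulli_plus[OF V p] plus_mass_def bexp_split_site[OF V(1) x]
  proof (intro arg_cong2[where f = "(/)"] bexp_cong refl)
    fix U assume "U \<subseteq> V - {x}"
    then have xU: "x \<notin> U" by auto
    then have flip: "(\<not> (x \<in> U)) = True" "(\<not> (x \<in> insert x U)) = False" by auto
    show "(1 - p) * (of_bool (U \<noteq> {}) * (of_bool (con x U) * (p * (1 - p) * (f ((\<lambda>v. v \<in> U)(x := \<not> (x \<in> U))) - f (\<lambda>v. v \<in> U))\<^sup>2))) +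
       p * (of_bool (insert x U \<noteq> {}) * (of_bool (con x (insert x U)) * (p * (1 - p) * (f ((\<lambda>v. v \<in> insert x U)(x := \<not> (x \<in> insert x U))) - f (\<lambda>v. v \<in> insert x U))\<^sup>2))) =
       p * (1 - p) * (of_bool (con x U) * ((f (\<lambda>v. v \<in> insert x U) - f (\<lambda>v. v \<in> U)) * (f (\<lambda>v. v \<in> insert x U) - f (\<lambda>v. v \<in> U))))"
      unfolding flip upd_member[OF xU] con_insert
      using con_nonempty[of x U] by (cases "con x U") (simp_all add: power2_eq_square algebra_simps)
  qed
  then show ?thesis unfolding fa_dirichlet_def fa_bilinear_def by (simp add: sum_divide_distrib)
qed

lemma fa_dirichlet_nonneg: "0 \<le> fa_dirichlet V E p f"
  unfolding fa_dirichlet_bilinear fa_bilinear_def using p plus_mass_pos[OF V p]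
  by (intro divide_nonneg_pos sum_nonneg bexp_nonneg) auto

lemma fa_dirichlet_eq: "fa_dirichlet V E p f = fa_form V E p (\<lambda>S. f (\<lambda>v. v \<in> S)) / plus_mass V p"
proof -
  let ?F = "\<lambda>S. f (\<lambda>v. v \<in> S)"
  have "bexp p (V - {x}) (\<lambda>U. p * (1 - p) * (of_bool (con x U) * ((?F (insert x U) - ?F U) * (?F (insert x U) - ?F U)))) =
      p * bexp p V (\<lambda>S. of_bool (x \<notin> S \<and> con x S) * (?F (insert x S) - ?F S)\<^sup>2)" if x: "x \<in> V" for x
    unfolding bexp_split_site[OF V(1) x] bexp_cmult[of p _ p, symmetric]
    by (intro bexp_cong) (auto simp: power2_eq_square)
  then show ?thesis
    unfolding fa_dirichlet_bilinear fa_bilinear_def fa_form_def by (simp add: sum_distrib_left)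
qed

definition fa_rate :: "('v \<Rightarrow> bool) \<Rightarrow> ('v \<Rightarrow> bool) \<Rightarrow> real" where
  "fa_rate \<eta> \<xi> = (\<Sum>x\<in>V. of_bool (fa_constraint E x \<eta>) *
     (p * of_bool (\<xi> = \<eta>(x := True)) + (1 - p) * of_bool (\<xi> = \<eta>(x := False)) - of_bool (\<xi> = \<eta>)))"

lemma move_in_Omega_plus:
  assumes "\<eta> \<in> Omega_plus V" "x \<in> V" "fa_constraint E x \<eta>"
  shows "\<eta>(x := b) \<in> Omega_plus V"
proof -
  obtain y where y: "{x, y} \<in> E" "\<eta> y" using assms(3) by (auto simp: fa_constraint_def)
  then have "y \<noteq> x" "y \<in> V" using E[of "{x, y}"] no_loop[of x] by auto
  then show ?thesis using assms y by (auto simp: Omega_plus_def)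
qed

lemma generator_rate:
  assumes \<eta>: "\<eta> \<in> Omega_plus V"
  shows "fa_generator V E p f \<eta> = (\<Sum>\<xi>\<in>Omega_plus V. fa_rate \<eta> \<xi> * f \<xi>)"
proof -
  have pick: "(\<Sum>\<xi>\<in>Omega_plus V. of_bool (\<xi> = \<zeta>) * f \<xi>) = f \<zeta>" if "\<zeta> \<in> Omega_plus V" for \<zeta>
  proof -
    have "(\<Sum>\<xi>\<in>Omega_plus V. of_bool (\<xi> = \<zeta>) * f \<xi>) = (\<Sum>\<xi>\<in>Omega_plus V. if \<xi> = \<zeta> then f \<zeta> else 0)"
      by (intro sum.cong) auto
    then show ?thesis using that finite_Omega_plus[OF V(1)] by simp
  qed
  have "(\<Sum>\<xi>\<in>Omega_plus V. fa_rate \<eta> \<xi> * f \<xi>) = (\<Sum>x\<in>V. \<Sum>\<xi>\<in>Omega_plus V. of_bool (fa_constraint E x \<eta>) *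
     (p * (of_bool (\<xi> = \<eta>(x := True)) * f \<xi>) + (1 - p) * (of_bool (\<xi> = \<eta>(x := False)) * f \<xi>) - of_bool (\<xi> = \<eta>) * f \<xi>))"
    unfolding fa_rate_def sum_distrib_right by (subst sum.swap) (intro sum.cong refl, simp add: algebra_simps)
  also have "\<dots> = (\<Sum>x\<in>V. of_bool (fa_constraint E x \<eta>) *
     (p * (\<Sum>\<xi>\<in>Omega_plus V. of_bool (\<xi> = \<eta>(x := True)) * f \<xi>) + (1 - p) * (\<Sum>\<xi>\<in>Omega_plus V. of_bool (\<xi> = \<eta>(x := False)) * f \<xi>)
       - (\<Sum>\<xi>\<in>Omega_plus V. of_bool (\<xi> = \<eta>) * f \<xi>)))"
    by (simp only: sum.distrib sum_subtractf sum_distrib_left[symmetric])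
  also have "\<dots> = (\<Sum>x\<in>V. of_bool (fa_constraint E x \<eta>) *
     (p * f (\<eta>(x := True)) + (1 - p) * f (\<eta>(x := False)) - f \<eta>))"
  proof (intro sum.cong refl)
    fix x assume x: "x \<in> V"
    show "of_bool (fa_constraint E x \<eta>) *
     (p * (\<Sum>\<xi>\<in>Omega_plus V. of_bool (\<xi> = \<eta>(x := True)) * f \<xi>) + (1 - p) * (\<Sum>\<xi>\<in>Omega_plus V. of_bool (\<xi> = \<eta>(x := False)) * f \<xi>)
       - (\<Sum>\<xi>\<in>Omega_plus V. of_bool (\<xi> = \<eta>) * f \<xi>)) =
      of_bool (fa_constraint E x \<eta>) * (p * f (\<eta>(x := True)) + (1 - p) * f (\<eta>(x := False)) - f \<eta>)"
      using pick[OF move_in_Omega_plus[OF \<eta> x]] pick[OF \<eta>] by (cases "fa_constraint E x \<eta>") simp_all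
  qed
  also have "\<dots> = fa_generator V E p f \<eta>"
    unfolding fa_generator_def using p by (intro sum.cong refl) simp
  finally show ?thesis ..
qed

sublocale reversible_generator "Omega_plus V" "fa_generator V E p" fa_rate "pmf (bernoulli_plus V p)"
proof
  show "finite (Omega_plus V)" by (rule finite_Omega_plus[OF V(1)])
  show "fa_generator V E p f \<eta> = (\<Sum>\<xi>\<in>Omega_plus V. fa_rate \<eta> \<xi> * f \<xi>)" if "\<eta> \<in> Omega_plus V" for f \<eta>
    by (rule generator_rate[OF that])
  show "0 < pmf (bernoulli_plus V p) \<eta>" if "\<eta> \<in> Omega_plus V" for \<eta>
    using that by (intro pmf_positive) (simp add: set_bernoulli_plus[OF V p])
  show "(\<Sum>\<eta>\<in>Omega_plus V. pmf (bernoulli_plus V p) \<eta>) = 1"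
    by (intro sum_pmf_eq_1 finite_Omega_plus V) (simp add: set_bernoulli_plus[OF V p])
  show "0 \<le> fa_rate \<eta> \<xi>" if "\<eta> \<noteq> \<xi>" for \<eta> \<xi>
    unfolding fa_rate_def using that p by (intro sum_nonneg mult_nonneg_nonneg) auto
  show "(\<Sum>\<xi>\<in>Omega_plus V. fa_rate \<eta> \<xi>) = 0" if "\<eta> \<in> Omega_plus V" for \<eta>
    using generator_rate[OF that, of "\<lambda>_. 1"] p by (simp add: fa_generator_def)
  have flip: "(\<Sum>\<eta>\<in>Omega_plus V. pmf (bernoulli_plus V p) \<eta> * (f \<eta> * fa_generator V E p g \<eta>)) = - fa_bilinear g f" for f g
    using generator_bilinear[of g f] by (simp add: mult.commute)
  have "fa_bilinear f g = fa_bilinear g f" for f g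
    unfolding fa_bilinear_def by (simp only: mult.commute[of "f _ - f _"])
  then show "(\<Sum>\<eta>\<in>Omega_plus V. pmf (bernoulli_plus V p) \<eta> * (fa_generator V E p f \<eta> * g \<eta>)) =
      (\<Sum>\<eta>\<in>Omega_plus V. pmf (bernoulli_plus V p) \<eta> * (f \<eta> * fa_generator V E p g \<eta>))" for f g
    unfolding generator_bilinear flip by simp
  show "(\<Sum>\<eta>\<in>Omega_plus V. pmf (bernoulli_plus V p) \<eta> * (f \<eta> * fa_generator V E p f \<eta>)) \<le> 0" for f
    unfolding flip using fa_dirichlet_nonneg[of f] by (simp add: fa_dirichlet_bilinear)
qed

text \<open>The squared distance is \<open>U - 1\<close>, so the threshold \<open>1 / e\<close> is reached once \<open>ln U \<le> ln (1 + e\<^sup>-\<^sup>2)\<close>.\<close>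

lemma T2_le_log_sobolev:
  assumes C: "0 < C" and t: "0 < t"
    and LS: "\<And>f. measure_pmf.expectation (bernoulli_plus V p) (\<lambda>x. (f x)\<^sup>2 *
      ln ((f x)\<^sup>2 / measure_pmf.expectation (bernoulli_plus V p) (\<lambda>z. (f z)\<^sup>2))) \<le> C * fa_dirichlet V E p f"
    and dec: "\<And>x. x \<in> Omega_plus V \<Longrightarrow> exp (- 2 * t / C) * ln (1 / pmf (bernoulli_plus V p) x) \<le> ln (1 + exp (- 2))"
  shows "T2_FA V E p \<le> ereal t"
proof -
  let ?\<Omega> = "Omega_plus V" and ?M = "bernoulli_plus V p"
  have Ex: "measure_pmf.expectation ?M h = (\<Sum>\<eta>\<in>?\<Omega>. pmf ?M \<eta> * h \<eta>)" for h
    by (subst integral_measure_pmf_real[where A = ?\<Omega>]) (auto simp: fin set_bernoulli_plus[OF V p] mult.commute)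
  have LS': "(\<Sum>x\<in>?\<Omega>. pmf ?M x * ((f x)\<^sup>2 * ln ((f x)\<^sup>2 / (\<Sum>z\<in>?\<Omega>. pmf ?M z * (f z)\<^sup>2)))) \<le>
       C * - (\<Sum>x\<in>?\<Omega>. pmf ?M x * (f x * fa_generator V E p f x))" for f
  proof -
    have "- (\<Sum>x\<in>?\<Omega>. pmf ?M x * (f x * fa_generator V E p f x)) = fa_dirichlet V E p f"
      using generator_bilinear[of f f] by (simp add: mult.commute fa_dirichlet_bilinear)
    then show ?thesis using LS[of f] unfolding Ex by simp
  qed
  have "Lq_norm ?M 2 (\<lambda>y. rel_density ?M (fa_generator V E p) t x y - 1) \<le> 1 / exp 1" if x: "x \<in> ?\<Omega>" for x
  proof -
    let ?u = "op_exp (fa_generator V E p) (\<lambda>z. indicator {x} z / pmf ?M x) t"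
    let ?U = "\<Sum>y\<in>?\<Omega>. pmf ?M y * (?u y)\<^sup>2"
    note decay = log_sobolev_L2_decay[OF C LS' x less_imp_le[OF t]]
    have "ln ?U \<le> ln (1 + exp (- 2))" using decay(1) dec[OF x] by (rule order_trans)
    then have "?U \<le> 1 + exp (- 2)" using decay(2) by (subst (asm) ln_le_cancel_iff) (auto intro: add_pos_pos)
    then have e: "(\<Sum>y\<in>?\<Omega>. pmf ?M y * (?u y - 1)\<^sup>2) \<le> exp (- 2)" using decay(3) by simp
    have "measure_pmf.expectation ?M (\<lambda>y. \<bar>rel_density ?M (fa_generator V E p) t x y - 1\<bar> powr 2)
        = (\<Sum>y\<in>?\<Omega>. pmf ?M y * (?u y - 1)\<^sup>2)"
      unfolding Ex rel_density_def
      by (intro sum.cong refl) (simp add: transition_reversible[OF x])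
    then have "Lq_norm ?M 2 (\<lambda>y. rel_density ?M (fa_generator V E p) t x y - 1)
        = (\<Sum>y\<in>?\<Omega>. pmf ?M y * (?u y - 1)\<^sup>2) powr (1 / 2)"
      unfolding Lq_norm_def by simp
    also have "\<dots> \<le> exp (- 2) powr (1 / 2)"
      using e by (intro powr_mono2 sum_nonneg) auto
    also have "\<dots> = 1 / exp (1 :: real)" by (subst exp_powr_real) (simp add: exp_minus inverse_eq_divide)
    finally show ?thesis .
  qed
  then have "(MAX x\<in>?\<Omega>. Lq_norm ?M 2 (\<lambda>y. rel_density ?M (fa_generator V E p) t x y - 1)) \<le> 1 / exp 1"
    using fin Omega_plus_nonempty[OF V(2)] by (subst Max_le_iff) auto
  then show ?thesis
    unfolding T2_FA_def l2_mixing_time_def using t by (intro Inf_lower) auto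
qed

end

lemma Lq_norm_1_le_2:
  fixes M :: "'s pmf"
  assumes "finite (set_pmf M)"
  shows "Lq_norm M 1 g \<le> Lq_norm M 2 g"
proof -
  let ?E = "measure_pmf.expectation M"
  have int: "integrable (measure_pmf M) h" for h :: "'s \<Rightarrow> real"
    using assms by (rule integrable_measure_pmf_finite)
  have "0 \<le> measure_pmf.variance M (\<lambda>x. \<bar>g x\<bar>)" by (rule measure_pmf.variance_positive)
  also have "\<dots> = ?E (\<lambda>x. \<bar>g x\<bar>\<^sup>2) - (?E (\<lambda>x. \<bar>g x\<bar>))\<^sup>2"
    by (rule measure_pmf.variance_eq[OF int int])
  finally have "(?E (\<lambda>x. \<bar>g x\<bar>))\<^sup>2 \<le> ?E (\<lambda>x. (g x)\<^sup>2)" by simp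
  then have "?E (\<lambda>x. \<bar>g x\<bar>) \<le> sqrt (?E (\<lambda>x. (g x)\<^sup>2))" by (rule real_le_rsqrt)
  moreover have "0 \<le> ?E (\<lambda>x. \<bar>g x\<bar>)" "0 \<le> ?E (\<lambda>x. (g x)\<^sup>2)" by (auto intro!: integral_nonneg)
  ultimately show ?thesis unfolding Lq_norm_def by (simp add: powr_half_sqrt)
qed

lemma mixing_time_le_l2:
  assumes "finite S" "S \<noteq> {}" "finite (set_pmf M)"
  shows "mixing_time S M A \<le> l2_mixing_time S M A"
  unfolding mixing_time_def l2_mixing_time_def
proof (intro Inf_superset_mono image_mono Collect_mono impI conjI; elim conjE)
  fix t assume "(MAX x\<in>S. Lq_norm M 2 (\<lambda>y. rel_density M A t x y - 1)) \<le> 1 / exp 1"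
  then have 2: "Lq_norm M 2 (\<lambda>y. rel_density M A t x y - 1) \<le> 1 / exp 1" if "x \<in> S" for x
    using assms that by (subst (asm) Max_le_iff) auto
  have "1 / 2 * Lq_norm M 1 (\<lambda>y. rel_density M A t x y - 1) \<le> 1 / (2 * exp 1)" if "x \<in> S" for x
    using order_trans[OF Lq_norm_1_le_2[OF assms(3)] 2[OF that]] by simp
  then show "(MAX x\<in>S. 1 / 2 * Lq_norm M 1 (\<lambda>y. rel_density M A t x y - 1)) \<le> 1 / (2 * exp 1)"
    using assms by (subst Max_le_iff) auto
qed

text \<open>Positivity of all admissible constants lets them multiply comparisons of Dirichlet forms
  and serve as time scales.\<close>

lemma log_sobolev_const_pos:
  fixes M :: "'s pmf" and D :: "('s \<Rightarrow> real) \<Rightarrow> real"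
  assumes fin: "finite (set_pmf M)" and x: "x \<in> set_pmf M" "y \<in> set_pmf M" "x \<noteq> y"
    and D: "\<And>f. 0 \<le> D f"
    and LS: "\<And>f. measure_pmf.expectation M (\<lambda>x. (f x)\<^sup>2 * ln ((f x)\<^sup>2 / measure_pmf.expectation M (\<lambda>z. (f z)\<^sup>2))) \<le> C * D f"
  shows "0 < C"
proof -
  \<comment> \<open>Its entropy \<open>pmf M x * ln (1 / pmf M x)\<close> is positive, since \<open>y\<close> also carries mass.\<close>
  let ?f = "indicator {x} :: 's \<Rightarrow> real"
  have Ex: "measure_pmf.expectation M (\<lambda>z. ?f z * c) = pmf M x * c" for c
    by (simp add: measure_pmf_single)
  have f2: "(?f z)\<^sup>2 = ?f z" for z by (simp add: indicator_def)
  have "sum (pmf M) {x, y} \<le> sum (pmf M) (set_pmf M)" using fin x by (intro sum_mono2) auto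
  also have "\<dots> = 1" using fin by (intro sum_pmf_eq_1) auto
  finally have "pmf M x + pmf M y \<le> 1" using x by simp
  then have lt: "pmf M x < 1" "0 < pmf M x" using pmf_positive[OF x(2)] pmf_positive[OF x(1)] by auto
  have "measure_pmf.expectation M (\<lambda>z. (?f z)\<^sup>2 * ln ((?f z)\<^sup>2 / measure_pmf.expectation M (\<lambda>z. (?f z)\<^sup>2)))
      = measure_pmf.expectation M (\<lambda>z. ?f z * ln (1 / pmf M x))"
    unfolding f2 using Ex[of 1] by (intro Bochner_Integration.integral_cong refl) (auto simp: indicator_def)
  also have "\<dots> = pmf M x * ln (1 / pmf M x)" by (rule Ex)
  also have "0 < \<dots>" using lt by (intro mult_pos_pos ln_gt_zero) auto
  finally have "0 < C * D ?f" using LS[of ?f] by (rule less_le_trans)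
  then show ?thesis using D[of ?f] by (simp add: zero_less_mult_iff)
qed

lemma le_mult_Inf:
  fixes x :: ereal
  assumes "0 < K" "\<And>C. C \<in> A \<Longrightarrow> x \<le> ereal (K * C)"
  shows "x \<le> ereal K * Inf (ereal ` A)"
proof -
  have "x / ereal K \<le> Inf (ereal ` A)"
    using assms by (intro Inf_greatest) (auto simp: ereal_divide_le_pos)
  then show ?thesis using assms(1) by (simp add: ereal_divide_le_pos)
qed

section \<open>The constants on the torus\<close>

lemma torus_edges_card: "e \<in> torus_edges d L \<Longrightarrow> e \<subseteq> torus_verts d L \<and> card e = 2"
  by (auto simp: torus_edges_def)

lemma torus_degree:
  assumes x: "x \<in> torus_verts d L"
  shows "card {y. {x, y} \<in> torus_edges d L} \<le> 2 * d"
proof -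
  let ?A = "(\<lambda>i. x(i := (x i + 1) mod L)) ` {..<d}" and ?B = "(\<lambda>i. x(i := (x i + L - 1) mod L)) ` {..<d}"
  have "{y. {x, y} \<in> torus_edges d L} \<subseteq> ?A \<union> ?B"
  proof
    fix y assume "y \<in> {y. {x, y} \<in> torus_edges d L}"
    then obtain u w i where uw: "{x, y} = {u, w}" "u \<in> torus_verts d L" "w \<in> torus_verts d L" "i < d"
        "w i = (u i + 1) mod L" "\<forall>j. j \<noteq> i \<longrightarrow> w j = u j"
      by (auto simp: torus_edges_def)
    then consider "u = x" "w = y" | "u = y" "w = x" by (auto simp: doubleton_eq_iff)
    then show "y \<in> ?A \<union> ?B"
    proof cases
      case 1
      then have "y = x(i := (x i + 1) mod L)" using uw by (auto simp: fun_eq_iff)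
      then show ?thesis using uw by blast
    next
      case 2
      have yL: "y i < L" using uw 2 torus_vertsD by blast
      have "(x i + L - 1) mod L = ((y i + 1) mod L + (L - 1)) mod L" using uw 2 yL by simp
      also have "\<dots> = (y i + 1 + (L - 1)) mod L" by (rule mod_add_left_eq)
      also have "\<dots> = y i" using yL by simp
      finally have "y = x(i := (x i + L - 1) mod L)" using uw 2 by (auto simp: fun_eq_iff)
      then show ?thesis using uw by blast
    qed
  qed
  then have "card {y. {x, y} \<in> torus_edges d L} \<le> card (?A \<union> ?B)" by (intro card_mono) auto
  also have "\<dots> \<le> card ?A + card ?B" by (rule card_Un_le)
  also have "\<dots> \<le> d + d" by (intro add_mono order_trans[OF card_image_le]) auto
  finally show ?thesis by simp
qed

text \<open>The order of the sum over \<open>x\<close> of the effective resistances between \<open>x\<close> and a fixed site of a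
  \<open>d\<close>-dimensional torus with \<open>n\<close> sites.\<close>

definition resistance_scale :: "nat \<Rightarrow> real \<Rightarrow> real" where
  "resistance_scale d n = (if d = 1 then n\<^sup>2 else if d = 2 then n * ln n else n)"

lemma sum_inverse_le_ln:
  "1 \<le> L \<Longrightarrow> (\<Sum>k<L. 1 / real (k + 1)) \<le> 1 + ln (real L)"
proof (induction L rule: dec_induct)
  case (step L)
  have "1 - real L / real (L + 1) \<le> ln (real (L + 1) / real L)"
    using ln_le_minus_one[of "real L / real (L + 1)"] step by (simp add: ln_div)
  moreover have "1 - real L / real (L + 1) = 1 / real (L + 1)" by (simp add: field_simps)
  moreover have "ln (real (L + 1) / real L) = ln (real (L + 1)) - ln (real L)" using step by (simp add: ln_div)
  ultimately show ?case using step.IH by simp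
qed simp

lemma sum_triangular_le:
  "(\<Sum>k<L. 2 / (real (k + 1) * real (k + 2))) \<le> 2 - 2 / (real L + 1)"
proof (induction L)
  case (Suc L)
  have "2 / (real (L + 1) * real (L + 2)) = 2 / (real L + 1) - 2 / (real (Suc L) + 1)"
    by (simp add: field_simps)
  then show ?case using Suc by simp
qed simp

text \<open>The layer sizes are 1, \<open>k + 1\<close> and at least \<open>(k + 1) (k + 2) / 2\<close> for \<open>d = 1\<close>, \<open>d = 2\<close> and
  \<open>d \<ge> 3\<close>, so their reciprocals sum to \<open>L\<close>, a harmonic sum, and at most 2.\<close>

lemma torus_constant_le:
  fixes d L :: nat
  assumes d: "1 \<le> d" and L: "3 \<le> L"
  shows "(2 + 4 * real d ^ d) * (real d * real L)\<^sup>2 + 4 * real L ^ d * (\<Sum>k<L. 1 / real (card (layer d k)))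
    \<le> ((2 + 4 * real d ^ d) * (real d)\<^sup>2 + 8) * resistance_scale d (real L ^ d)"
proof -
  let ?R = "\<Sum>k<L. 1 / real (card (layer d k))"
  have L1: "1 \<le> real L" using L by simp
  consider "d = 1" | "d = 2" | "3 \<le> d" using d by linarith
  then show ?thesis
  proof cases
    case 1
    have "?R \<le> (\<Sum>k<L. 1)"
    proof (rule sum_mono)
      fix k show "1 / real (card (layer d k)) \<le> 1" using card_layer_pos[OF d, of k] by (simp add: divide_le_eq)
    qed
    then have "4 * real L * ?R \<le> 4 * real L * real L" using L1 by (intro mult_left_mono) auto
    moreover have "0 \<le> real L * real L" by simp
    ultimately have "6 * (real L)\<^sup>2 + 4 * real L * ?R \<le> 14 * (real L)\<^sup>2"
      unfolding power2_eq_square by linarith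
    then show ?thesis using 1 by (simp add: resistance_scale_def)
  next
    case 2
    have "exp 1 \<le> (3 :: real)" using exp_le by simp
    then have lnL: "1 \<le> ln (real L)" using L by (subst ln_ge_iff) auto
    have "?R = (\<Sum>k<L. 1 / real (k + 1))" using 2 by (simp add: card_layer_2)
    also have "\<dots> \<le> 1 + ln (real L)" using L by (intro sum_inverse_le_ln) auto
    also have "\<dots> \<le> ln (real L ^ 2)" using lnL L by (simp add: ln_realpow)
    finally have R: "?R \<le> ln (real L ^ 2)" .
    have one: "1 \<le> ln (real L ^ 2)" using lnL L by (simp add: ln_realpow)
    have "72 * real L ^ 2 + 4 * real L ^ 2 * ?R \<le> 72 * (real L ^ 2 * ln (real L ^ 2)) + 8 * (real L ^ 2 * ln (real L ^ 2))"
      using R one L1 by (intro add_mono) (auto intro!: mult_left_mono simp: mult.assoc)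
    then show ?thesis using 2 by (simp add: resistance_scale_def power_mult_distrib)
  next
    case 3
    have "?R \<le> (\<Sum>k<L. 2 / (real (k + 1) * real (k + 2)))"
    proof (rule sum_mono)
      fix k
      have "real ((k + 1) * (k + 2)) \<le> real (2 * card (layer d k))" using card_layer_ge_3[OF 3, of k] by (simp only: of_nat_le_iff)
      then have "real (k + 1) * real (k + 2) \<le> 2 * real (card (layer d k))" by (simp only: of_nat_mult of_nat_numeral)
      moreover have "0 < real (k + 1) * real (k + 2)" by simp
      ultimately show "1 / real (card (layer d k)) \<le> 2 / (real (k + 1) * real (k + 2))"
        using card_layer_pos[OF d, of k] by (simp add: frac_le_eq divide_simps mult.commute)
    qed
    also have "\<dots> \<le> 2" using sum_triangular_le[of L] by (smt (verit) divide_nonneg_nonneg of_nat_0_le_iff)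
    finally have R: "?R \<le> 2" .
    have "real L ^ 2 \<le> real L ^ d" using 3 L1 by (intro power_increasing) auto
    then have "(2 + 4 * real d ^ d) * (real d * real L)\<^sup>2 \<le> (2 + 4 * real d ^ d) * (real d)\<^sup>2 * real L ^ d"
      by (simp add: power_mult_distrib mult.assoc mult_left_mono)
    moreover have "4 * real L ^ d * ?R \<le> 4 * real L ^ d * 2" using R L1 by (intro mult_left_mono) auto
    ultimately show ?thesis using 3 by (simp add: resistance_scale_def distrib_right)
  qed
qed

lemma resistance_scale_nonneg: "1 \<le> n \<Longrightarrow> 0 \<le> resistance_scale d n"
  by (simp add: resistance_scale_def)

lemma pmf_bernoulli_plus_ge:
  assumes V: "finite V" "V \<noteq> {}" and p: "0 < p" "p \<le> 1 / 2" and \<eta>: "\<eta> \<in> Omega_plus V"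
  shows "p ^ card V \<le> pmf (bernoulli_plus V p) \<eta>"
proof -
  have p1: "p < 1" using p by simp
  obtain S where S: "\<eta> = (\<lambda>x. x \<in> S)" "S \<subseteq> V" "S \<noteq> {}" using \<eta> by (auto simp: Omega_plus_eq)
  have fS: "finite S" "card S + card (V - S) = card V" using S V by (auto simp: card_Diff_subset finite_subset card_mono)
  have "p ^ card V = p ^ card S * p ^ card (V - S)" by (simp add: fS(2)[symmetric] power_add)
  also have "\<dots> \<le> p ^ card S * (1 - p) ^ card (V - S)" using p by (intro mult_left_mono power_mono) auto
  also have "\<dots> \<le> p ^ card S * (1 - p) ^ card (V - S) / plus_mass V p"
  proof -
    have "plus_mass V p \<le> 1" "0 < plus_mass V p" using plus_mass_pos[OF V p(1) p1] p by (auto simp: plus_mass_def)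
    moreover have "0 \<le> p ^ card S * (1 - p) ^ card (V - S)" using p by simp
    ultimately show ?thesis by (simp add: pos_le_divide_eq mult_left_le)
  qed
  finally show ?thesis unfolding S(1) pmf_bernoulli_plus[OF V p(1) p1 S(2,3)] plus_mass_def .
qed

text \<open>The factors are the logarithmic Sobolev constant of the product measure, the cost of
  conditioning on being nonempty, and the comparison of single-site refreshes with CBSEP moves.\<close>

theorem torus_inv_alpha_CBSEP_le:
  fixes d L :: nat and p :: real
  assumes d: "1 \<le> d" and L: "3 \<le> L" and p: "0 < p" "p \<le> 1 / 2"
  shows "inv_alpha_CBSEP (torus_verts d L) (torus_edges d L) p \<le>
    ereal ((18 + 8 * ln (1 / p)) * (1 + 2 / (real L ^ d * p)) *
      (4 * (((2 + 4 * real d ^ d) * (real d)\<^sup>2 + 8) * resistance_scale d (real L ^ d))))"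
proof -
  let ?V = "torus_verts d L" and ?E = "torus_edges d L"
  let ?T = "((2 + 4 * real d ^ d) * (real d)\<^sup>2 + 8) * resistance_scale d (real L ^ d)"
  let ?K = "(18 + 8 * ln (1 / p)) * (1 + 2 / (real L ^ d * p))"
  have p1: "p < 1" using p by simp
  have V: "finite ?V" "?V \<noteq> {}" using L card_torus_verts[of d L] by (auto simp: card_gt_0_iff[symmetric])
  have T: "0 \<le> ?T" using L resistance_scale_nonneg[of "real L ^ d" d] by (simp add: one_le_power)
  have K: "0 \<le> ?K" using p by (intro mult_nonneg_nonneg add_nonneg_nonneg) auto
  have pin: "(\<Sum>x\<in>?V. (g x - g y)\<^sup>2) \<le> ?T * (\<Sum>(x, z)\<in>arcs ?E. (g x - g z)\<^sup>2)" if "y \<in> ?V" for g y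
  proof -
    have "0 \<le> (\<Sum>(x, z)\<in>arcs ?E. (g x - g z)\<^sup>2)" by (intro sum_nonneg) auto
    then show ?thesis
      using order_trans[OF torus_pinned_poincare[OF d _ that, where g = g] mult_right_mono[OF torus_constant_le[OF d L]]] L by auto
  qed
  have "measure_pmf.expectation (bernoulli_plus ?V p) (\<lambda>x. (f x)\<^sup>2 *
      ln ((f x)\<^sup>2 / measure_pmf.expectation (bernoulli_plus ?V p) (\<lambda>z. (f z)\<^sup>2))) \<le> ?K * (4 * ?T) * cbsep_dirichlet ?V ?E p f" for f
  proof -
    let ?F = "\<lambda>S. f (\<lambda>x. x \<in> S)"
    have "plus_entropy ?V p ?F \<le> ?K * site_form ?V p ?F"
      using plus_log_sobolev_site[OF V p, of ?F] by (simp add: card_torus_verts)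
    also have "\<dots> \<le> ?K * (4 * ?T * (\<Sum>e\<in>?E. cbsep_edge ?V p ?F e))"
      by (intro mult_left_mono site_form_le_cbsep[OF V(1) torus_edges_card p(1) p1 T pin] K)
    finally have "plus_entropy ?V p ?F / plus_mass ?V p \<le> ?K * (4 * ?T * (\<Sum>e\<in>?E. cbsep_edge ?V p ?F e)) / plus_mass ?V p"
      using plus_mass_pos[OF V p(1) p1] by (intro divide_right_mono) auto
    then show ?thesis
      unfolding entropy_eq_plus_entropy[OF V p(1) p1] cbsep_dirichlet_eq[OF V p(1) p1] by simp
  qed
  then show ?thesis
    unfolding inv_alpha_CBSEP_def inv_log_sobolev_def by (intro Inf_lower imageI CollectI allI)
qed

theorem inv_alpha_FA_le_CBSEP:
  assumes V: "finite V" "V \<noteq> {}" and E: "\<And>e. e \<in> E \<Longrightarrow> e \<subseteq> V \<and> card e = 2" and p: "0 < p" "p < 1"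
    and deg: "\<And>x. x \<in> V \<Longrightarrow> card {y. {x, y} \<in> E} \<le> \<Delta>" and \<Delta>: "0 < \<Delta>"
    and two: "\<eta> \<in> Omega_plus V" "\<xi> \<in> Omega_plus V" "\<eta> \<noteq> \<xi>"
  shows "inv_alpha_FA V E p \<le> ereal (2 * real \<Delta> / p) * inv_alpha_CBSEP V E p"
  unfolding inv_alpha_CBSEP_def inv_log_sobolev_def
proof (rule le_mult_Inf)
  show "0 < 2 * real \<Delta> / p" using p \<Delta> by simp
  fix C
  assume "C \<in> {C. \<forall>f. measure_pmf.expectation (bernoulli_plus V p) (\<lambda>x. (f x)\<^sup>2 *
      ln ((f x)\<^sup>2 / measure_pmf.expectation (bernoulli_plus V p) (\<lambda>z. (f z)\<^sup>2))) \<le> C * cbsep_dirichlet V E p f}"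
  then have C: "measure_pmf.expectation (bernoulli_plus V p) (\<lambda>x. (f x)\<^sup>2 *
      ln ((f x)\<^sup>2 / measure_pmf.expectation (bernoulli_plus V p) (\<lambda>z. (f z)\<^sup>2))) \<le> C * cbsep_dirichlet V E p f" for f by blast
  have Z: "0 < plus_mass V p" by (rule plus_mass_pos[OF V p])
  have nonneg: "0 \<le> cbsep_dirichlet V E p f" for f
    unfolding cbsep_dirichlet_def by (intro sum_nonneg integral_nonneg mult_nonneg_nonneg measure_pmf.variance_positive) auto
  have "0 < C"
    using two by (intro log_sobolev_const_pos[OF _ _ _ two(3) nonneg C])
      (auto simp: set_bernoulli_plus[OF V p] finite_Omega_plus[OF V(1)])
  interpret fa_setting V E p by unfold_locales (use V E p in auto)
  have cmp: "cbsep_dirichlet V E p f \<le> 2 * real \<Delta> / p * fa_dirichlet V E p f" for f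
    using divide_right_mono[OF cbsep_le_fa_form[OF V(1) E p deg, of "\<lambda>S. f (\<lambda>v. v \<in> S)"] less_imp_le[OF Z]]
    unfolding cbsep_dirichlet_eq[OF V p] fa_dirichlet_eq by simp
  have "measure_pmf.expectation (bernoulli_plus V p) (\<lambda>x. (f x)\<^sup>2 *
      ln ((f x)\<^sup>2 / measure_pmf.expectation (bernoulli_plus V p) (\<lambda>z. (f z)\<^sup>2))) \<le> 2 * real \<Delta> / p * C * fa_dirichlet V E p f" for f
    using order_trans[OF C mult_left_mono[OF cmp less_imp_le[OF \<open>0 < C\<close>]]] by (simp add: mult_ac)
  then show "inv_alpha_FA V E p \<le> ereal (2 * real \<Delta> / p * C)"
    unfolding inv_alpha_FA_def inv_log_sobolev_def by (intro Inf_lower imageI CollectI allI)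
qed

text \<open>Every admissible constant \<open>C\<close> gives \<open>T\<^sub>2 \<le> l C\<close>; the infimum over \<open>C\<close> is taken at the end.\<close>

theorem T2_FA_le_inv_alpha:
  assumes V: "finite V" "V \<noteq> {}" and E: "\<And>e. e \<in> E \<Longrightarrow> e \<subseteq> V \<and> card e = 2" and p: "0 < p" "p < 1"
    and two: "\<eta> \<in> Omega_plus V" "\<xi> \<in> Omega_plus V" "\<eta> \<noteq> \<xi>"
    and l: "0 < l" and dec: "\<And>\<zeta>. \<zeta> \<in> Omega_plus V \<Longrightarrow> exp (- 2 * l) * ln (1 / pmf (bernoulli_plus V p) \<zeta>) \<le> ln (1 + exp (- 2))"
  shows "T2_FA V E p \<le> inv_alpha_FA V E p * ereal l"
proof -
  interpret fa_setting V E p by unfold_locales (use V E p in auto)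
  have "T2_FA V E p \<le> ereal l * inv_alpha_FA V E p"
    unfolding inv_alpha_FA_def inv_log_sobolev_def
  proof (rule le_mult_Inf[OF l])
    fix C
    assume "C \<in> {C. \<forall>f. measure_pmf.expectation (bernoulli_plus V p) (\<lambda>x. (f x)\<^sup>2 *
        ln ((f x)\<^sup>2 / measure_pmf.expectation (bernoulli_plus V p) (\<lambda>z. (f z)\<^sup>2))) \<le> C * fa_dirichlet V E p f}"
    then have C: "measure_pmf.expectation (bernoulli_plus V p) (\<lambda>x. (f x)\<^sup>2 *
        ln ((f x)\<^sup>2 / measure_pmf.expectation (bernoulli_plus V p) (\<lambda>z. (f z)\<^sup>2))) \<le> C * fa_dirichlet V E p f" for f by blast
    have "0 < C"
      using two by (intro log_sobolev_const_pos[OF _ _ _ two(3) fa_dirichlet_nonneg C])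
        (auto simp: set_bernoulli_plus[OF V p] finite_Omega_plus[OF V(1)])
    then show "T2_FA V E p \<le> ereal (l * C)"
      using l dec by (intro T2_le_log_sobolev[OF _ _ C]) auto
  qed
  then show ?thesis by (simp add: mult.commute)
qed

section \<open>The chain of inequalities\<close>

lemma two_configurations:
  assumes "finite V" "2 \<le> card V"
  obtains \<eta> \<xi> where "\<eta> \<in> Omega_plus V" "\<xi> \<in> Omega_plus V" "\<eta> \<noteq> \<xi>"
proof -
  obtain x y where "x \<in> V" "y \<in> V" "x \<noteq> y"
  proof -
    have "\<not> card V \<le> Suc 0" using assms(2) by simp
    then show ?thesis using that unfolding card_le_Suc0_iff_eq[OF assms(1)] by blast
  qed
  then show ?thesis
    by (intro that[of "\<lambda>v. v = x" "\<lambda>v. v = y"]) (auto simp: Omega_plus_def fun_eq_iff)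
qed

text \<open>The four inequalities for one torus, with all largeness requirements on \<open>L\<close> explicit. For the
  second one, the initial value of \<open>ln U\<close> is at most \<open>n ln (1 / p) \<le> 2 n ln n\<close>, and the time
  \<open>C ln n\<close> reduces it by the factor \<open>n\<^sup>-\<^sup>2\<close>.\<close>

lemma torus_comparison_chain:
  fixes d L :: nat and p a :: real
  assumes d: "1 \<le> d" and L: "3 \<le> L" and a: "0 < a" and p: "p \<le> 1 / 2" "a / real (L ^ d) \<le> p"
    and log1: "1 \<le> ln (real (L ^ d))" and loga: "ln (real (L ^ d) / a) \<le> 2 * ln (real (L ^ d))"
    and small: "2 * ln (real (L ^ d)) / real (L ^ d) \<le> ln (1 + exp (- 2))"
  defines "n \<equiv> real (L ^ d)" and "V \<equiv> torus_verts d L" and "E \<equiv> torus_edges d L"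
    and "c \<equiv> 4 * real d / a"
    and "K \<equiv> 136 * (1 + 2 / a) * ((2 + 4 * real d ^ d) * (real d)\<^sup>2 + 8)"
  shows "Tmix_FA V E p \<le> T2_FA V E p"
    and "T2_FA V E p \<le> inv_alpha_FA V E p * ereal (ln n)"
    and "inv_alpha_FA V E p * ereal (ln n) \<le> ereal (c * n * ln n) * inv_alpha_CBSEP V E p"
    and "ereal (c * n * ln n) * inv_alpha_CBSEP V E p \<le> ereal (c * K * (n * (ln n)\<^sup>2 * resistance_scale d n))"
proof -
  let ?A = "inv_alpha_FA V E p" and ?B = "inv_alpha_CBSEP V E p"
  have n: "0 < n" using L by (simp add: n_def)
  have "0 < a / real (L ^ d)" using a n by (simp add: n_def)
  then have p0: "0 < p" using p(2) by (rule less_le_trans)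
  have p1: "p < 1" using p by simp
  have "L \<le> L ^ d" using L d by (intro self_le_power) auto
  then have "3 \<le> L ^ d" using L by linarith
  then have card: "card V = L ^ d" "2 \<le> card V" by (simp_all add: V_def card_torus_verts)
  have V: "finite V" "V \<noteq> {}" using card(2) by (auto simp: V_def)
  have E: "e \<subseteq> V \<and> card e = 2" if "e \<in> E" for e
    using torus_edges_card[of e d L] that by (simp add: V_def E_def)
  obtain \<eta> \<xi> where two: "\<eta> \<in> Omega_plus V" "\<xi> \<in> Omega_plus V" "\<eta> \<noteq> \<xi>"
    using two_configurations[OF V(1) card(2)] by metis
  have "1 / p \<le> n / a" using p(2) p0 a n by (simp add: n_def field_simps)
  then have "ln (1 / p) \<le> ln (n / a)" using p0 a n by (subst ln_le_cancel_iff) auto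
  then have lnp: "ln (1 / p) \<le> 2 * ln n" using loga by (simp add: n_def)
  have ln1: "1 \<le> ln n" using log1 by (simp add: n_def)

  show "Tmix_FA V E p \<le> T2_FA V E p"
    unfolding Tmix_FA_def T2_FA_def using V Omega_plus_nonempty[OF V(2)]
    by (intro mixing_time_le_l2) (auto simp: finite_Omega_plus set_bernoulli_plus[OF V p0 p1])

  show "T2_FA V E p \<le> ?A * ereal (ln n)"
  proof (rule T2_FA_le_inv_alpha[OF V E p0 p1 two])
    fix \<zeta> assume \<zeta>: "\<zeta> \<in> Omega_plus V"
    have ge: "p ^ card V \<le> pmf (bernoulli_plus V p) \<zeta>"
      by (rule pmf_bernoulli_plus_ge[OF V p0 p(1) \<zeta>])
    have pc: "0 < p ^ card V" using p0 by simp
    have pz: "0 < pmf (bernoulli_plus V p) \<zeta>" using pc ge by (rule less_le_trans)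
    have "1 / pmf (bernoulli_plus V p) \<zeta> \<le> 1 / p ^ card V"
      using ge pc by (intro divide_left_mono mult_pos_pos pz) auto
    then have "ln (1 / pmf (bernoulli_plus V p) \<zeta>) \<le> ln (1 / p ^ card V)"
      using pz pc by (subst ln_le_cancel_iff) auto
    also have "\<dots> = n * ln (1 / p)" using p0 by (simp add: ln_div ln_realpow card n_def)
    also have "\<dots> \<le> n * (2 * ln n)" using lnp n by (intro mult_left_mono) auto
    finally have "exp (- 2 * ln n) * ln (1 / pmf (bernoulli_plus V p) \<zeta>) \<le> exp (- 2 * ln n) * (n * (2 * ln n))"
      by (intro mult_left_mono) auto
    also have "\<dots> = 2 * ln n / n"
    proof -
      have "exp (- 2 * ln n) = 1 / (exp (ln n) * exp (ln n))" by (simp add: exp_minus inverse_eq_divide exp_add[symmetric])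
      then show ?thesis using n by simp
    qed
    also have "\<dots> \<le> ln (1 + exp (- 2))" using small by (simp add: n_def)
    finally show "exp (- 2 * ln n) * ln (1 / pmf (bernoulli_plus V p) \<zeta>) \<le> ln (1 + exp (- 2))" .
  qed (use ln1 in auto)

  have B0: "0 \<le> ?B"
  proof -
    have "0 \<le> cbsep_dirichlet V E p f" for f
      unfolding cbsep_dirichlet_def by (intro sum_nonneg integral_nonneg mult_nonneg_nonneg measure_pmf.variance_positive) auto
    note nonneg = this
    show ?thesis
      unfolding inv_alpha_CBSEP_def inv_log_sobolev_def
    proof (rule Inf_greatest, elim imageE CollectE)
      fix z C
      assume z: "z = ereal C" and C: "\<forall>f. measure_pmf.expectation (bernoulli_plus V p) (\<lambda>x. (f x)\<^sup>2 *
        ln ((f x)\<^sup>2 / measure_pmf.expectation (bernoulli_plus V p) (\<lambda>z. (f z)\<^sup>2))) \<le> C * cbsep_dirichlet V E p f"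
      have "0 < C"
        using two C[rule_format] by (intro log_sobolev_const_pos[OF _ _ _ two(3) nonneg, where M = "bernoulli_plus V p"])
          (simp_all add: set_bernoulli_plus[OF V p0 p1] finite_Omega_plus[OF V(1)])
      then show "0 \<le> z" unfolding z by simp
    qed
  qed
  have "?A \<le> ereal (2 * real (2 * d) / p) * ?B"
  proof (rule inv_alpha_FA_le_CBSEP[OF V E p0 p1 _ _ two])
    fix x assume "x \<in> V"
    then show "card {y. {x, y} \<in> E} \<le> 2 * d" unfolding V_def E_def by (rule torus_degree)
  qed (use d in auto)
  also have "\<dots> \<le> ereal (c * n) * ?B"
  proof (rule ereal_mult_right_mono[OF _ B0])
    have "2 * real (2 * d) * (1 / p) \<le> 2 * real (2 * d) * (n / a)"
      using \<open>1 / p \<le> n / a\<close> by (intro mult_left_mono) auto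
    then show "ereal (2 * real (2 * d) / p) \<le> ereal (c * n)" by (simp add: c_def)
  qed
  finally have "?A * ereal (ln n) \<le> ereal (c * n) * ?B * ereal (ln n)"
    using ln1 by (intro ereal_mult_right_mono) auto
  also have "\<dots> = ereal (c * n * ln n) * ?B"
  proof -
    have "ereal (c * n * ln n) = ereal (c * n) * ereal (ln n)" by simp
    then show ?thesis by (simp only: mult_ac)
  qed
  finally show "?A * ereal (ln n) \<le> ereal (c * n * ln n) * ?B" .

  have "0 \<le> c" "0 \<le> ln n" using a ln1 by (simp add: c_def, linarith)
  then have cn: "0 \<le> c * n * ln n" using n by (intro mult_nonneg_nonneg less_imp_le[OF n])
  have n1: "1 \<le> n" using L by (simp add: n_def one_le_power)
  have scale: "0 \<le> resistance_scale d n" by (rule resistance_scale_nonneg[OF n1])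
  have "?B \<le> ereal ((18 + 8 * ln (1 / p)) * (1 + 2 / (n * p)) *
      (4 * (((2 + 4 * real d ^ d) * (real d)\<^sup>2 + 8) * resistance_scale d n)))"
    using torus_inv_alpha_CBSEP_le[OF d L p0 p(1)] by (simp add: V_def E_def n_def)
  also have "\<dots> \<le> ereal ((34 * ln n) * (1 + 2 / a) *
      (4 * (((2 + 4 * real d ^ d) * (real d)\<^sup>2 + 8) * resistance_scale d n)))"
  proof -
    have 1: "18 + 8 * ln (1 / p) \<le> 34 * ln n" using lnp ln1 by linarith
    have "a \<le> n * p" using p(2) n by (simp add: n_def field_simps)
    then have 2: "1 + 2 / (n * p) \<le> 1 + 2 / a" using a by (intro add_left_mono divide_left_mono) auto
    show ?thesis
      using 1 2 p0 p1 a n n1 ln1 scale by (intro ereal_less_eq(3)[THEN iffD2] mult_mono mult_nonneg_nonneg add_nonneg_nonneg) auto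
  qed
  also have "\<dots> = ereal (K * ln n * resistance_scale d n)"
  proof -
    have "(34 * l) * q * (4 * (k * r)) = 136 * q * k * l * r" for l q k r :: real by simp
    then show ?thesis by (simp only: K_def)
  qed
  finally have "ereal (c * n * ln n) * ?B \<le> ereal (c * n * ln n) * ereal (K * ln n * resistance_scale d n)"
    using cn by (intro ereal_mult_left_mono) auto
  also have "\<dots> = ereal (c * K * (n * (ln n)\<^sup>2 * resistance_scale d n))"
    by (simp add: power2_eq_square mult_ac)
  finally show "ereal (c * n * ln n) * ?B \<le> ereal (c * K * (n * (ln n)\<^sup>2 * resistance_scale d n))" .
qed

theorem corollary3p2:
  fixes d :: nat and a b :: real
  assumes "d \<ge> 1" and "0 < a" and "a \<le> b"
  shows "\<exists>c>0. \<exists>C>0. \<forall>p :: nat \<Rightarrow> real.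
    (\<forall>\<^sub>F n in sequentially. a / real n \<le> p n \<and> p n \<le> b / real n) \<longrightarrow>
    (\<forall>\<^sub>F L in sequentially.
      let n = L ^ d; V = torus_verts d L; E = torus_edges d L in
        Tmix_FA V E (p n) \<le> T2_FA V E (p n) \<and>
        T2_FA V E (p n) \<le> inv_alpha_FA V E (p n) * ereal (ln (real n)) \<and>
        inv_alpha_FA V E (p n) * ereal (ln (real n))
          \<le> ereal (c * real n * ln (real n)) * inv_alpha_CBSEP V E (p n) \<and>
        ereal (c * real n * ln (real n)) * inv_alpha_CBSEP V E (p n)
          \<le> ereal (C * (if d = 1 then real n ^ 3 * (ln (real n)) ^ 2
                         else if d = 2 then real n ^ 2 * (ln (real n)) ^ 3
                         else real n ^ 2 * (ln (real n)) ^ 2)))"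
proof -
  define c where "c = 4 * real d / a"
  define K where "K = 136 * (1 + 2 / a) * ((2 + 4 * real d ^ d) * (real d)\<^sup>2 + 8)"
  have c: "0 < c" using assms by (simp add: c_def)
  have K: "0 < K" using assms unfolding K_def
    by (intro mult_pos_pos add_pos_pos add_nonneg_pos) auto
  have scale: "n * (ln n)\<^sup>2 * resistance_scale d n = (if d = 1 then n ^ 3 * (ln n) ^ 2
      else if d = 2 then n ^ 2 * (ln n) ^ 3 else n ^ 2 * (ln n) ^ 2)" for n
    by (simp add: resistance_scale_def power2_eq_square power3_eq_cube)
  have pow: "filterlim (\<lambda>L. L ^ d) sequentially sequentially"
  proof (rule filterlim_at_top_mono[OF filterlim_ident])
    show "\<forall>\<^sub>F L in sequentially. L \<le> L ^ d"
      using eventually_ge_at_top[of 1] by eventually_elim (use assms in \<open>auto intro: self_le_power\<close>)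
  qed
  have "\<forall>\<^sub>F L in sequentially.
      let n = L ^ d; V = torus_verts d L; E = torus_edges d L in
        Tmix_FA V E (p n) \<le> T2_FA V E (p n) \<and>
        T2_FA V E (p n) \<le> inv_alpha_FA V E (p n) * ereal (ln (real n)) \<and>
        inv_alpha_FA V E (p n) * ereal (ln (real n))
          \<le> ereal (c * real n * ln (real n)) * inv_alpha_CBSEP V E (p n) \<and>
        ereal (c * real n * ln (real n)) * inv_alpha_CBSEP V E (p n)
          \<le> ereal (c * K * (if d = 1 then real n ^ 3 * (ln (real n)) ^ 2
                         else if d = 2 then real n ^ 2 * (ln (real n)) ^ 3
                         else real n ^ 2 * (ln (real n)) ^ 2))"
    if p: "\<forall>\<^sub>F n in sequentially. a / real n \<le> p n \<and> p n \<le> b / real n" for p :: "nat \<Rightarrow> real"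
  proof -
    have "\<forall>\<^sub>F n :: nat in sequentially. b / real n < 1 / 2" by real_asymp
    moreover have "\<forall>\<^sub>F n :: nat in sequentially. 1 < ln (real n)" by real_asymp
    moreover have "\<forall>\<^sub>F n :: nat in sequentially. ln (real n / a) < 2 * ln (real n)"
      using \<open>0 < a\<close> by real_asymp
    moreover have "\<forall>\<^sub>F n :: nat in sequentially. 2 * ln (real n) / real n < ln (1 + exp (- 2))"
    proof (rule order_tendstoD(2))
      show "(\<lambda>n. 2 * ln (real n) / real n) \<longlonglongrightarrow> 0" by real_asymp
      show "0 < ln (1 + exp (- 2 :: real))" by (intro ln_gt_zero) simp
    qed
    ultimately have "\<forall>\<^sub>F n in sequentially. p n \<le> 1 / 2 \<and> a / real n \<le> p n \<and> 1 \<le> ln (real n) \<and>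
        ln (real n / a) \<le> 2 * ln (real n) \<and> 2 * ln (real n) / real n \<le> ln (1 + exp (- 2))"
      using p by eventually_elim (intro conjI; linarith)
    then have "\<forall>\<^sub>F L in sequentially. p (L ^ d) \<le> 1 / 2 \<and> a / real (L ^ d) \<le> p (L ^ d) \<and> 1 \<le> ln (real (L ^ d)) \<and>
        ln (real (L ^ d) / a) \<le> 2 * ln (real (L ^ d)) \<and> 2 * ln (real (L ^ d)) / real (L ^ d) \<le> ln (1 + exp (- 2))"
      using pow by (rule eventually_compose_filterlim)
    then show ?thesis
      using eventually_ge_at_top[of 3]
    proof eventually_elim
      case (elim L)
      then show ?case
        using torus_comparison_chain[OF assms(1) elim(2) assms(2), of "p (L ^ d)"]
        unfolding Let_def c_def[symmetric] K_def[symmetric] scale by blast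
    qed
  qed
  then show ?thesis
    using c K by (intro exI[of _ c] conjI exI[of _ "c * K"] allI impI) auto
qed

end
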